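(* Let $\mathcal{T}=(T_1,T_2,T_3)$ be a spherically symmetric solution to Nahm's equations, with values in $\mathfrak{su}(n)^{\oplus 3}$, whose generators $(Y_1,Y_2,Y_3)$ induce a representation $(\mathbb{C}^n,\rho)$ of $\mathfrak{so}(3)$, i.e. $\rho(X_i)=Y_i$. Write the decomposition of $(\mathbb{C}^n,\rho)$ into irreducible summands as $$(\mathbb{C}^n,\rho)\simeq\bigoplus_{a=1}^k (V_{n_a},\rho_{n_a}),\qquad n_1\geqslant n_2\geqslant\cdots\geqslant n_k ,$$ and, for $i\in\{1,2,3\}$ and $a\in\{1,\ldots,k\}$, let $Y_{i,a}:=\rho_{n_a}(X_i)$, so that $Y_i=\rho(X_i)=\mathrm{diag}(Y_{i,1},\ldots,Y_{i,k})$. Fix $t_0$ in the domain of $\mathcal{T}$ and, for each $i\in\{1,2,3\}$, write $T_i(t_0)$ as a block matrix $\big((T_i)_{ab}\big)_{a,b=1}^k$ according to this decomposition, with $(T_i)_{ab}=-(T_i)_{ba}^*\in V_{n_a}\otimes V_{n_b}^*$ and $(T_i)_{aa}\in\mathfrak{su}(V_{n_a})$. Then, up to a $\rho$-invariant gauge (that is, after replacing $T_i$ by $UT_iU^{-1}$ for all $i$, for some $U\in\mathrm{SU}(n)$ commuting with $Y_1,Y_2,Y_3$), for all $a,b\in\{1,\ldots,k\}$: 1. There exists $c_a\in\mathbb{R}$ such that $(T_i)_{aa}=c_aY_{i,a}$ for all $i\in\{1,2,3\}$. 2. If $a\neq b$ and $|n_a-n_b|\neq 2$, then $(T_i)_{ab}=0$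 for all $i \in \{1,2,3\}$. 3. If $n_a=n_b+2$, then there exists $c_{ab}\in\mathbb{C}$ such that $(T_i)_{ab}=c_{ab}B_i^{n_b}$ for all $i\in\{1,2,3\}$.
   Context: Nahm's equations for a triple $\mathcal{T}=(T_1,T_2,T_3)$ of functions from an open interval to $\mathfrak{su}(n)$ are $\dot T_1=[T_2,T_3]$, $\dot T_2=[T_3,T_1]$, $\dot T_3=[T_1,T_2]$. For $A\in\mathrm{SO}(3)$ and $U\in\mathrm{SU}(n)$ set ${}^AT_i:=\sum_j A_{ij}T_j$ and ${}_UT_i:=UT_iU^{-1}$. A solution $\mathcal{T}$ is spherically symmetric if for every $A\in\mathrm{SO}(3)$ there is $U_A\in\mathrm{SU}(n)$ such that ${}^A\mathcal{T}={}_{U_A^{-1}}\mathcal{T}$ (on the whole domain). A triple $(Y_1,Y_2,Y_3)\in\mathfrak{su}(n)^{\oplus 3}$ is a triple of generators of the spherical symmetry for $\mathcal{T}$ if $[Y_i,T_j]=\sum_{k=1}^3\epsilon_{ijk}T_k$ for all $i,j\in\{1,2,3\}$ (at every point of the domain), where $\epsilon_{ijk}$ is the Levi-Civita symbol. $(X_1,X_2,X_3)$ is the standard basis of $\mathfrak{so}(3)$, $(X_i)_{jk}=-\epsilon_{ijk}$, so $[X_i,X_j]=\sum_k\epsilon_{ijk}X_k$. The generators induce a representation $\rho$ of $\mathfrak{so}(3)$ if $[Y_i,Y_j]=\sum_k\epsilon_{ijk}Y_k$ for all $i,j$, in which case $\rho(X_i):=Y_i$. $(V_m,\rho_m)$ denotes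 the $m$-dimensional irreducible complex representation of the Lie algebra $\mathfrak{so}(3)$, with an invariant Hermitian inner product, so $\rho_m(X_i)\in\mathfrak{su}(V_m)$; the decomposition of $\mathbb{C}^n$ is orthogonal. For $m\geqslant1$, $V_{m+2}\otimes V_m\otimes V_3$ contains a unique 1-dimensional irreducible summand; $B^m=(B_1^m,B_2^m,B_3^m)$ denotes a unit length generator of it (well-defined up to a $\mathrm{U}(1)$ factor), regarded as a triple of linear maps $B_i^m:V_m\to V_{m+2}$. Equivalently, $B^m$ is a triple of unit length (with respect to $\sum_i\mathrm{tr}((B_i^m)^*B_i^m)$) satisfying $\rho_{m+2}(X_j)B_k^m-B_k^m\rho_m(X_j)=\sum_{i=1}^3\epsilon_{ijk}B_i^m$ for all $j,k$. *)

theory Defs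
  imports
    "HOL-Analysis.Analysis"
    "Jordan_Normal_Form.Schur_Decomposition"
    "Jordan_Normal_Form.VS_Connect"
begin

text \<open>
  Matrices are the dimension-free ones of \<open>Jordan_Normal_Form\<close>, because the block sizes \<open>n\<^sub>a\<close> vary
  inside the statement.  Matrix rows, columns and blocks are counted from 0.  The index
  \<open>i \<in> {1,2,3}\<close> of a triple lives in the three-element type \<open>3\<close>, whose elements are \<open>1\<close>, \<open>2\<close>, \<open>3\<close>
  (with \<open>3 = 0\<close> in that type).
\<close>

definition levi_civita :: "3 \<Rightarrow> 3 \<Rightarrow> 3 \<Rightarrow> complex" where
  "levi_civita i j k =
     (if (i, j, k) \<in> {(1, 2, 3), (2, 3, 1), (3, 1, 2)} then 1
      else if (i, j, k) \<in> {(3, 2, 1), (2, 1, 3), (1, 3, 2)} then - 1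
      else 0)"

text \<open>The sum \<open>\<Sum>\<^sub>k c\<^sub>k M\<^sub>k\<close>; spelled out because matrices of unspecified size form no additive monoid.\<close>

definition lincomb3 :: "(3 \<Rightarrow> complex) \<Rightarrow> (3 \<Rightarrow> complex mat) \<Rightarrow> complex mat" where
  "lincomb3 c M = c 1 \<cdot>\<^sub>m M 1 + c 2 \<cdot>\<^sub>m M 2 + c 3 \<cdot>\<^sub>m M 3"

definition commutator :: "complex mat \<Rightarrow> complex mat \<Rightarrow> complex mat" where
  "commutator M N = M * N - N * M"

definition mat_trace :: "complex mat \<Rightarrow> complex" where
  "mat_trace M = (\<Sum>r<dim_row M. M $$ (r, r))"

definition su :: "nat \<Rightarrow> complex mat set" where
  "su n = {M \<in> carrier_mat n n. mat_adjoint M = - M \<and> mat_trace M = 0}"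

definition unitary_group :: "nat \<Rightarrow> complex mat set" where
  "unitary_group n = {U \<in> carrier_mat n n. U * mat_adjoint U = 1\<^sub>m n \<and> mat_adjoint U * U = 1\<^sub>m n}"

definition SU :: "nat \<Rightarrow> complex mat set" where
  "SU n = {U \<in> unitary_group n. Determinant.det U = 1}"

definition SO3 :: "(real ^ 3 ^ 3) set" where
  "SO3 = {A. orthogonal_matrix A \<and> Determinants.det A = 1}"

text \<open>\<open>U M U\<^sup>-\<^sup>1\<close>; only used for unitary \<open>U\<close>, whose inverse is the adjoint.\<close>

definition gauge_transform :: "complex mat \<Rightarrow> complex mat \<Rightarrow> complex mat" where
  "gauge_transform U M = U * M * mat_adjoint U"

definition has_mat_derivative :: "(real \<Rightarrow> complex mat) \<Rightarrow> complex mat \<Rightarrow> real \<Rightarrow> bool" where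
  "has_mat_derivative M D t \<longleftrightarrow>
     (\<forall>r<dim_row D. \<forall>s<dim_col D.
        ((\<lambda>u. M u $$ (r, s)) has_vector_derivative D $$ (r, s)) (at t))"

definition nahm_solution :: "nat \<Rightarrow> real set \<Rightarrow> (3 \<Rightarrow> real \<Rightarrow> complex mat) \<Rightarrow> bool" where
  "nahm_solution n I T \<longleftrightarrow>
     open I \<and> is_interval I \<and> (\<forall>t\<in>I. \<forall>i. T i t \<in> su n) \<and>
     (\<forall>t\<in>I. has_mat_derivative (T 1) (commutator (T 2 t) (T 3 t)) t \<and>
            has_mat_derivative (T 2) (commutator (T 3 t) (T 1 t)) t \<and>
            has_mat_derivative (T 3) (commutator (T 1 t) (T 2 t)) t)"

definition spherically_symmetric ::
    "nat \<Rightarrow> real set \<Rightarrow> (3 \<Rightarrow> real \<Rightarrow> complex mat) \<Rightarrow> bool" where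
  "spherically_symmetric n I T \<longleftrightarrow>
     (\<forall>A\<in>SO3. \<exists>U\<in>SU n. \<forall>t\<in>I. \<forall>i.
        lincomb3 (\<lambda>j. complex_of_real (vec_nth (vec_nth A i) j)) (\<lambda>j. T j t)
          = gauge_transform (mat_adjoint U) (T i t))"

definition symmetry_generators ::
    "nat \<Rightarrow> real set \<Rightarrow> (3 \<Rightarrow> real \<Rightarrow> complex mat) \<Rightarrow> (3 \<Rightarrow> complex mat) \<Rightarrow> bool" where
  "symmetry_generators n I T Y \<longleftrightarrow>
     (\<forall>i. Y i \<in> su n) \<and>
     (\<forall>t\<in>I. \<forall>i j. commutator (Y i) (T j t) = lincomb3 (levi_civita i j) (\<lambda>k. T k t))"

text \<open>A representation \<open>\<rho>\<close> of \<open>\<ss>\<oo>(3)\<close> is given by the triple \<open>\<rho>(X\<^sub>1), \<rho>(X\<^sub>2), \<rho>(X\<^sub>3)\<close>.\<close>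

definition induces_so3_rep :: "(3 \<Rightarrow> complex mat) \<Rightarrow> bool" where
  "induces_so3_rep Y \<longleftrightarrow> (\<forall>i j. commutator (Y i) (Y j) = lincomb3 (levi_civita i j) Y)"

text \<open>
  An \<open>m\<close>-dimensional irreducible representation, written in an orthonormal basis for an invariant
  Hermitian inner product, i.e. on \<open>\<complex>\<^sup>m\<close> with its standard inner product.
\<close>

definition irreducible_so3_rep :: "nat \<Rightarrow> (3 \<Rightarrow> complex mat) \<Rightarrow> bool" where
  "irreducible_so3_rep m R \<longleftrightarrow>
     m \<ge> 1 \<and> (\<forall>i. R i \<in> su m) \<and> induces_so3_rep R \<and>
     (\<forall>W. VectorSpace.subspace class_ring W (module_vec TYPE(complex) m) \<longrightarrow>
          (\<forall>i. \<forall>w\<in>W. R i *\<^sub>v w \<in> W) \<longrightarrow> W = {0\<^sub>v m} \<or> W = carrier_vec m)"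

text \<open>
  Action of \<open>X\<^sub>j\<close> on \<open>Hom(V\<^sub>m, V\<^sub>m\<^sub>+\<^sub>2) \<otimes> V\<^sub>3\<close>, where \<open>R\<close>, \<open>S\<close> are the representations on \<open>V\<^sub>m\<^sub>+\<^sub>2\<close>, \<open>V\<^sub>m\<close>,
  and \<open>V\<^sub>3 = \<complex>\<^sup>3\<close> is the (complexified) defining representation, \<open>(X\<^sub>j)\<^sub>k\<^sub>i = - \<epsilon>\<^sub>j\<^sub>k\<^sub>i\<close>.
  An element is a triple \<open>C = \<Sum>\<^sub>k C\<^sub>k \<otimes> e\<^sub>k\<close>; the result is given by its \<open>k\<close>-th component.
\<close>

definition so3_tensor_action ::
    "(3 \<Rightarrow> complex mat) \<Rightarrow> (3 \<Rightarrow> complex mat) \<Rightarrow> 3 \<Rightarrow> (3 \<Rightarrow> complex mat) \<Rightarrow> 3 \<Rightarrow> complex mat" where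
  "so3_tensor_action R S j C k =
     R j * C k - C k * S j + lincomb3 (\<lambda>i. - levi_civita j k i) C"

text \<open>
  \<open>B\<close> is a unit vector spanning a 1-dimensional subrepresentation of \<open>Hom(V\<^sub>m, V\<^sub>m\<^sub>+\<^sub>2) \<otimes> V\<^sub>3\<close>
  (subrepresentations are summands, by complete reducibility).
\<close>

definition unit_generator ::
    "(nat \<Rightarrow> 3 \<Rightarrow> complex mat) \<Rightarrow> nat \<Rightarrow> (3 \<Rightarrow> complex mat) \<Rightarrow> bool" where
  "unit_generator \<rho> m B \<longleftrightarrow>
     (\<forall>i. B i \<in> carrier_mat (m + 2) m) \<and>
     (\<Sum>i\<in>UNIV. mat_trace (mat_adjoint (B i) * B i)) = 1 \<and>
     (\<forall>j. \<exists>l. \<forall>k. so3_tensor_action (\<rho> (m + 2)) (\<rho> m) j B k = l \<cdot>\<^sub>m B k)"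

text \<open>
  An orthogonal decomposition of \<open>(\<complex>\<^sup>n, Y)\<close> into irreducible summands of dimensions \<open>ns\<close>: the unitary
  matrix \<open>P\<close> is the isomorphism \<open>\<complex>\<^sup>n \<rightarrow> \<Oplus>\<^sub>a V\<^bsub>n\<^sub>a\<^esub>\<close>.
\<close>

definition irreducible_decomposition ::
    "(nat \<Rightarrow> 3 \<Rightarrow> complex mat) \<Rightarrow> nat \<Rightarrow> (3 \<Rightarrow> complex mat) \<Rightarrow> nat list \<Rightarrow> complex mat \<Rightarrow> bool" where
  "irreducible_decomposition \<rho> n Y ns P \<longleftrightarrow>
     sorted_wrt (\<ge>) ns \<and> (\<forall>m\<in>set ns. m \<ge> 1) \<and> sum_list ns = n \<and>
     P \<in> unitary_group n \<and>
     (\<forall>i. gauge_transform P (Y i) = diag_block_mat (map (\<lambda>m. \<rho> m i) ns))"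

definition mat_block :: "nat list \<Rightarrow> complex mat \<Rightarrow> nat \<Rightarrow> nat \<Rightarrow> complex mat" where
  "mat_block ns M a b =
     mat (ns ! a) (ns ! b)
       (\<lambda>(r, s). M $$ (sum_list (take a ns) + r, sum_list (take b ns) + s))"

end

theory Submission
  imports Defs "Jordan_Normal_Form.Spectral_Radius"
begin

text \<open>The inner product enters through the claim that the highest weight is determined by the
  dimension. The vectors obtained by repeatedly lowering a highest weight vector span the space by
  irreducibility, and they are orthogonal because R_3 is antihermitian and their weights differ.
  They are counted by splitting the identity into the projections onto them and taking the trace.
  The same orthogonality gives uniqueness of the highest weight vector. Two obstacles shape the
  rest. \<open>unit_generator\<close> lets so(3) act on B by a character, which must be shown to
  vanish before B can serve as a model triple. And the gauge that diagonalizes d also mixes blocks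
  between summands of dimensions m + 2 and m. This does no harm, since all those blocks are
  multiples of the same triple. The matrix d can be taken hermitian because T_i and the
  representation are both antihermitian, and a final phase brings the determinant of the gauge to 1
  without changing the conjugation.\<close>

text \<open>
  The symmetry condition says that each block \<open>(T\<^sub>i)\<^sub>a\<^sub>b\<close> is an equivariant triple, i.e. an intertwiner
  \<open>V\<^sub>3 \<otimes> V\<^sub>b \<rightarrow> V\<^sub>a\<close>.  Let \<open>v\<close> be a highest weight vector of \<open>V\<^sub>b\<close>, of weight \<open>j\<close>, and \<open>C\<close> such a triple.  Then
  \<open>C\<^sub>+ v\<close> is a highest weight vector of weight \<open>j + 1\<close> or zero; if it is zero, then \<open>C\<^sub>3 v\<close> has weight \<open>j\<close> or
  is zero; if that is zero as well, then \<open>C\<^sub>- v\<close> has weight \<open>j - 1\<close> or is zero; and if all three vanish,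
  then \<open>C = 0\<close>, since the common kernel is invariant.  As the highest weight of an irreducible
  representation is determined by its dimension and its highest weight vector is unique up to scalars,
  \<open>C\<close> vanishes unless \<open>n\<^sub>a - n\<^sub>b \<in> {0, 2, -2}\<close>, and it is unique up to scalars for \<open>n\<^sub>a - n\<^sub>b \<in> {0, 2}\<close>.
  Thus the blocks between summands of the same dimension \<open>m\<close> are \<open>d\<^sub>a\<^sub>b \<rho>\<^sub>m\<close> with a hermitian matrix \<open>d\<close>,
  and the gauge transformation acting by unitary scalar matrices that diagonalize \<open>d\<close> for every \<open>m\<close>
  removes those with \<open>a \<noteq> b\<close>.
\<close>

section \<open>Equivariant triples\<close>

lemma smult_mat_vec:
  fixes a :: "'a :: field"
  assumes "A \<in> carrier_mat nr nc" "v \<in> carrier_vec nc"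
  shows "(a \<cdot>\<^sub>m A) *\<^sub>v v = a \<cdot>\<^sub>v (A *\<^sub>v v)"
  using assms by (intro eq_vecI) auto

lemma index_mult_mat_vec_sum:
  assumes "A \<in> carrier_mat nr nc" "v \<in> carrier_vec nc" "r < nr"
  shows "(A *\<^sub>v v) $ r = (\<Sum>s<nc. A $$ (r, s) * v $ s)"
  using assms by (auto simp: scalar_prod_def lessThan_atLeast0)

lemma lincomb3_mult_vec:
  assumes "\<And>k. C k \<in> carrier_mat p m" "v \<in> carrier_vec m"
  shows "lincomb3 c C *\<^sub>v v = c 1 \<cdot>\<^sub>v (C 1 *\<^sub>v v) + c 2 \<cdot>\<^sub>v (C 2 *\<^sub>v v) + c 3 \<cdot>\<^sub>v (C 3 *\<^sub>v v)"
  using assms unfolding lincomb3_def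
  by (simp add: add_mult_distrib_mat_vec[where nr = p and nc = m] smult_mat_vec[where nr = p and nc = m])

text \<open>In the language of \<open>so3_tensor_action\<close>: the element with components C_k of
  Hom(V_m, V_p) tensor V_3 is annihilated by so(3). Target and source are independent, so blocks of
  any shape are covered.\<close>

definition equivariant ::
    "nat \<Rightarrow> nat \<Rightarrow> (3 \<Rightarrow> complex mat) \<Rightarrow> (3 \<Rightarrow> complex mat) \<Rightarrow> (3 \<Rightarrow> complex mat) \<Rightarrow> bool" where
  "equivariant p m R S C \<longleftrightarrow>
     (\<forall>k. C k \<in> carrier_mat p m) \<and>
     (\<forall>j k. R j * C k - C k * S j = lincomb3 (levi_civita j k) C)"

text \<open>In terms of \<open>J\<^sub>k = \<i> R\<^sub>k\<close>, \<open>raise R\<close> and \<open>lower R\<close> are \<open>- \<i>\<close> times the usual ladder operators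
  \<open>J\<^sub>1 \<plusminus> \<i> J\<^sub>2\<close>.\<close>

definition raise :: "(3 \<Rightarrow> complex mat) \<Rightarrow> complex vec \<Rightarrow> complex vec" where
  "raise C v = C 1 *\<^sub>v v + \<i> \<cdot>\<^sub>v (C 2 *\<^sub>v v)"

definition lower :: "(3 \<Rightarrow> complex mat) \<Rightarrow> complex vec \<Rightarrow> complex vec" where
  "lower C v = C 1 *\<^sub>v v + (- \<i>) \<cdot>\<^sub>v (C 2 *\<^sub>v v)"

text \<open>The relation applied to a vector and solved for R_j C_k v, so that as a rewrite rule it
  moves the representation to the right of the triple.\<close>

lemma equivariant_vec:
  assumes "equivariant p m R S C" "\<And>j. R j \<in> carrier_mat p p" "\<And>j. S j \<in> carrier_mat m m"
    and v: "v \<in> carrier_vec m"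
  shows "R j *\<^sub>v (C k *\<^sub>v v) = C k *\<^sub>v (S j *\<^sub>v v) +
    (levi_civita j k 1 \<cdot>\<^sub>v (C 1 *\<^sub>v v) + levi_civita j k 2 \<cdot>\<^sub>v (C 2 *\<^sub>v v) + levi_civita j k 3 \<cdot>\<^sub>v (C 3 *\<^sub>v v))"
proof -
  have C: "\<And>k. C k \<in> carrier_mat p m" using assms(1) by (auto simp: equivariant_def)
  have "(R j * C k - C k * S j) *\<^sub>v v = lincomb3 (levi_civita j k) C *\<^sub>v v"
    using assms(1) by (simp add: equivariant_def)
  hence eq: "R j *\<^sub>v (C k *\<^sub>v v) - C k *\<^sub>v (S j *\<^sub>v v) =
    levi_civita j k 1 \<cdot>\<^sub>v (C 1 *\<^sub>v v) + levi_civita j k 2 \<cdot>\<^sub>v (C 2 *\<^sub>v v) + levi_civita j k 3 \<cdot>\<^sub>v (C 3 *\<^sub>v v)"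
    unfolding lincomb3_mult_vec[OF C v]
      minus_mult_distrib_mat_vec[OF mult_carrier_mat[OF assms(2) C] mult_carrier_mat[OF C assms(3)] v]
      assoc_mult_mat_vec[OF assms(2) C v] assoc_mult_mat_vec[OF C assms(3) v] .
  have "R j *\<^sub>v (C k *\<^sub>v v) = C k *\<^sub>v (S j *\<^sub>v v) + (R j *\<^sub>v (C k *\<^sub>v v) - C k *\<^sub>v (S j *\<^sub>v v))"
    using carrier_matD(1)[OF C] carrier_matD(1)[OF assms(2)] by (intro eq_vecI) (auto simp del: index_mult_mat_vec)
  thus ?thesis unfolding eq .
qed

context
  fixes p m :: nat and R S C :: "3 \<Rightarrow> complex mat"
  assumes eq: "equivariant p m R S C"
    and RS: "\<And>j. R j \<in> carrier_mat p p" "\<And>j. S j \<in> carrier_mat m m"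
begin

lemma equivariant_carrier: "C k \<in> carrier_mat p m"
  using eq by (simp add: equivariant_def)

lemma equivariant_dims: "dim_row (C k) = p" "dim_row (R k) = p" "dim_row (S k) = m"
  by (rule carrier_matD(1)[OF equivariant_carrier] carrier_matD(1)[OF RS(1)] carrier_matD(1)[OF RS(2)])+

context
  fixes v :: "complex Matrix.vec" assumes v: "v \<in> carrier_vec m"
begin

lemma applied_carrier: "R j *\<^sub>v (C k *\<^sub>v v) \<in> carrier_vec p" "C k *\<^sub>v (S j *\<^sub>v v) \<in> carrier_vec p" "C k *\<^sub>v v \<in> carrier_vec p"
   "S j *\<^sub>v v \<in> carrier_vec m"
  by (rule mult_mat_vec_carrier[OF RS(1)] mult_mat_vec_carrier[OF RS(2) v] mult_mat_vec_carrier[OF equivariant_carrier v]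
    mult_mat_vec_carrier[OF equivariant_carrier])+

lemma mult_combination_left: "R j *\<^sub>v (C k *\<^sub>v v + a \<cdot>\<^sub>v (C l *\<^sub>v v)) = R j *\<^sub>v (C k *\<^sub>v v) + a \<cdot>\<^sub>v (R j *\<^sub>v (C l *\<^sub>v v))"
  using RS applied_carrier by (simp add: equivariant_carrier mult_add_distrib_mat_vec[where nr = p and nc = p] mult_mat_vec[where nr = p and nc = p])

lemma mult_combination_right: "C j *\<^sub>v (S k *\<^sub>v v + a \<cdot>\<^sub>v (S l *\<^sub>v v)) = C j *\<^sub>v (S k *\<^sub>v v) + a \<cdot>\<^sub>v (C j *\<^sub>v (S l *\<^sub>v v))"
  using RS applied_carrier by (simp add: equivariant_carrier mult_add_distrib_mat_vec[where nr = p and nc = m] mult_mat_vec[where nr = p and nc = m])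

text \<open>With J_3 = i R_3 these say that C_+, C_3 and C_- change the weight by 1, 0 and -1: they
  are the spherical components of a vector operator.\<close>

lemma weight_relations:
  "R 3 *\<^sub>v raise C v = raise C (S 3 *\<^sub>v v) + (- \<i>) \<cdot>\<^sub>v raise C v"
  "R 3 *\<^sub>v (C 3 *\<^sub>v v) = C 3 *\<^sub>v (S 3 *\<^sub>v v)"
  "R 3 *\<^sub>v lower C v = lower C (S 3 *\<^sub>v v) + \<i> \<cdot>\<^sub>v lower C v"
  unfolding raise_def lower_def mult_combination_left mult_combination_right equivariant_vec[OF eq RS v]
  by (rule eq_vecI; simp add: equivariant_dims levi_civita_def algebra_simps del: index_mult_mat_vec)+

text \<open>Commuting with the raising operator sends C_- to C_3, C_3 to C_+ and C_+ to zero. This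
  triangular shape is why the three components are examined in the order C_+, C_3, C_-.\<close>

lemma raise_relations:
  "raise R (raise C v) = raise C (raise S v)"
  "raise R (C 3 *\<^sub>v v) = C 3 *\<^sub>v raise S v + \<i> \<cdot>\<^sub>v raise C v"
  "raise R (lower C v) = lower C (raise S v) + (- 2 * \<i>) \<cdot>\<^sub>v (C 3 *\<^sub>v v)"
  unfolding raise_def lower_def mult_combination_left mult_combination_right equivariant_vec[OF eq RS v]
  by (rule eq_vecI; simp add: equivariant_dims levi_civita_def algebra_simps del: index_mult_mat_vec)+

end
end

section \<open>Subspaces, adjoints and the Hermitian inner product on column vectors\<close>

lemma subspace_vecI:
  assumes "W \<subseteq> carrier_vec n" "0\<^sub>v n \<in> W"
    and "\<And>u v. u \<in> W \<Longrightarrow> v \<in> W \<Longrightarrow> u + v \<in> W"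
    and "\<And>c v. v \<in> W \<Longrightarrow> c \<cdot>\<^sub>v v \<in> W"
  shows "VectorSpace.subspace class_ring W (module_vec TYPE(complex) n)"
  unfolding VectorSpace.subspace_def submodule_def
  using assms vec_vs vec_module by (auto simp: module_vec_simps)

lemma mat_adjoint_carrier [simp]:
  "M \<in> carrier_mat nr nc \<Longrightarrow> mat_adjoint M \<in> carrier_mat nc nr"
  by (auto simp: mat_adjoint_def mat_of_rows_def)

lemma dim_mat_adjoint [simp]:
  "dim_row (mat_adjoint M) = dim_col M" "dim_col (mat_adjoint M) = dim_row M"
  by (auto simp: mat_adjoint_def mat_of_rows_def)

lemma index_mat_adjoint [simp]:
  fixes M :: "complex mat"
  assumes "r < dim_col M" "s < dim_row M"
  shows "mat_adjoint M $$ (r, s) = cnj (M $$ (s, r))"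
  using assms by (simp add: mat_adjoint_def mat_of_rows_def)

definition inner_vec :: "complex vec \<Rightarrow> complex vec \<Rightarrow> complex" where
  "inner_vec u v = (\<Sum>r<dim_vec v. u $ r * cnj (v $ r))"

lemma inner_vec_self:
  "inner_vec v v = complex_of_real (\<Sum>r<dim_vec v. (cmod (v $ r))\<^sup>2)"
  by (simp add: inner_vec_def complex_norm_square del: of_real_power)

lemma inner_vec_self_eq_0:
  assumes "v \<in> carrier_vec n" "inner_vec v v = 0"
  shows "v = 0\<^sub>v n"
proof -
  have "(\<Sum>r<n. (cmod (v $ r))\<^sup>2) = 0"
    using assms by (simp add: inner_vec_self del: of_real_sum)
  hence "\<forall>r<n. v $ r = 0" by (subst (asm) sum_nonneg_eq_0_iff) auto
  thus ?thesis using assms by auto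
qed

lemma inner_vec_antihermitian:
  assumes A: "A \<in> su n" and u: "u \<in> carrier_vec n" and v: "v \<in> carrier_vec n"
  shows "inner_vec (A *\<^sub>v u) v = - inner_vec u (A *\<^sub>v v)"
proof -
  have c: "A \<in> carrier_mat n n" and ad: "mat_adjoint A = - A" using A by (auto simp: su_def)
  have e: "cnj (A $$ (r, s)) = - A $$ (s, r)" if "r < n" "s < n" for r s
  proof -
    have "mat_adjoint A $$ (s, r) = (- A) $$ (s, r)" by (simp add: ad)
    thus ?thesis using that c by simp
  qed
  have "inner_vec (A *\<^sub>v u) v = (\<Sum>r<n. \<Sum>s<n. A $$ (r, s) * u $ s * cnj (v $ r))"
    using v by (simp add: inner_vec_def index_mult_mat_vec_sum[OF c u] sum_distrib_right del: index_mult_mat_vec)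
  also have "\<dots> = (\<Sum>s<n. \<Sum>r<n. A $$ (r, s) * u $ s * cnj (v $ r))" by (rule sum.swap)
  also have "\<dots> = - inner_vec u (A *\<^sub>v v)"
    using c by (simp add: inner_vec_def index_mult_mat_vec_sum[OF c v] sum_distrib_left e del: index_mult_mat_vec
      flip: sum_negf) (simp add: mult_ac)
  finally show ?thesis .
qed

section \<open>Irreducible representations and highest weights\<close>

locale so3_irrep =
  fixes m :: nat and R :: "3 \<Rightarrow> complex mat"
  assumes irreducible: "irreducible_so3_rep m R"
begin

lemma dim_pos: "m > 0" and in_su: "R i \<in> su m" and carrier [simp]: "R i \<in> carrier_mat m m"
  using irreducible by (auto simp: irreducible_so3_rep_def su_def)

lemma dims [simp]: "dim_row (R i) = m" "dim_col (R i) = m"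
  by (rule carrier_matD[OF carrier])+

lemma invariant_subspace:
  assumes "W \<subseteq> carrier_vec m" "0\<^sub>v m \<in> W"
    and "\<And>u v. u \<in> W \<Longrightarrow> v \<in> W \<Longrightarrow> u + v \<in> W"
    and "\<And>c v. v \<in> W \<Longrightarrow> c \<cdot>\<^sub>v v \<in> W"
    and "\<And>i v. v \<in> W \<Longrightarrow> R i *\<^sub>v v \<in> W"
    and "w \<in> W" "w \<noteq> 0\<^sub>v m"
  shows "W = carrier_vec m"
proof -
  have "VectorSpace.subspace class_ring W (module_vec TYPE(complex) m)"
    by (rule subspace_vecI) (fact assms)+
  hence "W = {0\<^sub>v m} \<or> W = carrier_vec m"
    using irreducible assms(5) unfolding irreducible_so3_rep_def by simp
  thus ?thesis using assms(6,7) by auto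
qed

text \<open>The bracket relations make a representation an equivariant triple over itself, so its
  own ladder relations are instances of those for triples.\<close>

lemma self_equivariant: "equivariant m m R R R"
  using irreducible by (auto simp: equivariant_def irreducible_so3_rep_def induces_so3_rep_def commutator_def)

lemma dim_raise [simp]: "dim_vec (raise R v) = m" "dim_vec (lower R v) = m"
  by (simp_all add: raise_def lower_def)

lemma raise_carrier [simp]: "v \<in> carrier_vec m \<Longrightarrow> raise R v \<in> carrier_vec m"
  and lower_carrier [simp]: "v \<in> carrier_vec m \<Longrightarrow> lower R v \<in> carrier_vec m"
  by (auto simp: raise_def lower_def intro!: add_carrier_vec mult_mat_vec_carrier[OF carrier])

lemmas weight = weight_relations[OF self_equivariant carrier carrier]
lemmas raising = raise_relations[OF self_equivariant carrier carrier]

text \<open>The weight \<open>\<mu>\<close> is the eigenvalue of \<open>J\<^sub>3 = \<i> R\<^sub>3\<close>.\<close>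

definition weight_vec :: "complex \<Rightarrow> complex Matrix.vec \<Rightarrow> bool" where
  "weight_vec \<mu> v \<longleftrightarrow> v \<in> carrier_vec m \<and> R 3 *\<^sub>v v = (- \<i> * \<mu>) \<cdot>\<^sub>v v"

text \<open>The zero vector counts as a weight vector of every weight, so it does not matter here
  whether raising kills v.\<close>

lemma weight_vec_raise:
  assumes "weight_vec \<mu> v"
  shows "weight_vec (\<mu> + 1) (raise R v)"
proof -
  have v: "v \<in> carrier_vec m" and e: "R 3 *\<^sub>v v = (- \<i> * \<mu>) \<cdot>\<^sub>v v"
    using assms by (auto simp: weight_vec_def)
  have "raise R ((- \<i> * \<mu>) \<cdot>\<^sub>v v) = (- \<i> * \<mu>) \<cdot>\<^sub>v raise R v"
    using v by (intro eq_vecI) (auto simp: raise_def mult_mat_vec[OF carrier v] algebra_simps simp del: index_mult_mat_vec)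
  thus ?thesis using v weight(1)[OF v] unfolding e weight_vec_def
    by (auto intro!: eq_vecI simp: algebra_simps simp del: index_mult_mat_vec)
qed

lemma weight_vec_lower:
  assumes "weight_vec \<mu> v"
  shows "weight_vec (\<mu> - 1) (lower R v)"
proof -
  have v: "v \<in> carrier_vec m" and e: "R 3 *\<^sub>v v = (- \<i> * \<mu>) \<cdot>\<^sub>v v"
    using assms by (auto simp: weight_vec_def)
  have "lower R ((- \<i> * \<mu>) \<cdot>\<^sub>v v) = (- \<i> * \<mu>) \<cdot>\<^sub>v lower R v"
    using v by (intro eq_vecI) (auto simp: lower_def mult_mat_vec[OF carrier v] algebra_simps simp del: index_mult_mat_vec)
  thus ?thesis using v weight(3)[OF v] unfolding e weight_vec_def
    by (auto intro!: eq_vecI simp: algebra_simps simp del: index_mult_mat_vec)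
qed

text \<open>Otherwise the f k would be eigenvectors of R_3 for infinitely many distinct eigenvalues,
  while the spectrum is finite.\<close>

lemma weight_sequence_vanishes:
  assumes f: "\<And>k::nat. weight_vec (a k) (f k)" and "inj a"
  shows "\<exists>k. f k = 0\<^sub>v m"
proof (rule ccontr)
  assume nz: "\<nexists>k. f k = 0\<^sub>v m"
  have "- \<i> * a k \<in> spectrum (R 3)" for k
    using f[of k] nz by (auto simp: spectrum_def eigenvalue_def eigenvector_def weight_vec_def intro!: exI[of _ "f k"])
  hence "range (\<lambda>k. - \<i> * a k) \<subseteq> spectrum (R 3)" by blast
  hence "finite (range (\<lambda>k. - \<i> * a k))"
    using card_finite_spectrum(1)[OF carrier[of 3]] finite_subset by blast
  moreover have "inj (\<lambda>k. - \<i> * a k)" using \<open>inj a\<close> by (auto simp: inj_def)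
  ultimately show False using finite_imageD infinite_UNIV_nat by blast
qed

text \<open>Eigenvectors of an antihermitian matrix for distinct eigenvalues. The weights are taken
  real because the second argument of the inner product is conjugated.\<close>

lemma weight_vecs_orthogonal:
  assumes "weight_vec (complex_of_real x) u" "weight_vec (complex_of_real y) v" "x \<noteq> y"
  shows "inner_vec u v = 0"
proof -
  have u: "u \<in> carrier_vec m" and v: "v \<in> carrier_vec m" using assms by (auto simp: weight_vec_def)
  have "inner_vec (R 3 *\<^sub>v u) v = - inner_vec u (R 3 *\<^sub>v v)"
    by (rule inner_vec_antihermitian[OF in_su u v])
  moreover have "inner_vec (R 3 *\<^sub>v u) v = - \<i> * x * inner_vec u v"
    using assms u v by (auto simp: weight_vec_def inner_vec_def sum_distrib_left mult_ac sum_negf)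
  moreover have "inner_vec u (R 3 *\<^sub>v v) = \<i> * y * inner_vec u v"
    using assms u v by (auto simp: weight_vec_def inner_vec_def sum_distrib_left mult_ac)
  ultimately have "\<i> * (of_real x - of_real y) * inner_vec u v = 0" by (simp add: algebra_simps)
  thus ?thesis using \<open>x \<noteq> y\<close> by simp
qed

definition highest_weight :: "complex \<Rightarrow> complex Matrix.vec \<Rightarrow> bool" where
  "highest_weight \<mu> v \<longleftrightarrow> weight_vec \<mu> v \<and> raise R v = 0\<^sub>v m"

text \<open>Raise an eigenvector of R_3 repeatedly: the sequence must reach zero, and its last
  nonzero member is a highest weight vector.\<close>

lemma highest_weight_ex:
  "\<exists>\<mu> v. highest_weight \<mu> v \<and> v \<noteq> 0\<^sub>v m"
proof -
  obtain a where "a \<in> spectrum (R 3)"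
    using spectrum_non_empty[OF carrier dim_pos] by blast
  then obtain u where u: "u \<in> carrier_vec m" "u \<noteq> 0\<^sub>v m" "R 3 *\<^sub>v u = a \<cdot>\<^sub>v u"
    by (auto simp: spectrum_def eigenvalue_def eigenvector_def)
  \<comment> \<open>The eigenvalue a of R_3 = - i J_3 corresponds to the weight i a.\<close>
  have w: "weight_vec (\<i> * a + of_nat k) ((raise R ^^ k) u)" for k
  proof (induction k)
    case 0
    thus ?case using u by (simp add: weight_vec_def)
  next
    case (Suc k)
    from weight_vec_raise[OF this] show ?case by (simp add: add_ac)
  qed
  have "\<exists>k. (raise R ^^ k) u = 0\<^sub>v m"
    by (rule weight_sequence_vanishes[OF w]) (auto simp: inj_def)
  hence "\<exists>k. (raise R ^^ k) u \<noteq> 0\<^sub>v m \<and> (raise R ^^ (Suc k)) u = 0\<^sub>v m"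
  proof (rule contrapos_pp)
    assume *: "\<not> (\<exists>k. (raise R ^^ k) u \<noteq> 0\<^sub>v m \<and> (raise R ^^ (Suc k)) u = 0\<^sub>v m)"
    have "(raise R ^^ k) u \<noteq> 0\<^sub>v m" for k
      by (induction k) (use u(2) * in auto)
    thus "\<not> (\<exists>k. (raise R ^^ k) u = 0\<^sub>v m)" by blast
  qed
  then obtain k where "(raise R ^^ k) u \<noteq> 0\<^sub>v m" "raise R ((raise R ^^ k) u) = 0\<^sub>v m" by auto
  thus ?thesis using w[of k] unfolding highest_weight_def by blast
qed

section \<open>Lowering chains and their span\<close>

lemma lower_weight:
  assumes "highest_weight \<mu> w"
  shows "weight_vec (\<mu> - of_nat k) ((lower R ^^ k) w)"
proof (induction k)
  case 0
  thus ?case using assms by (simp add: highest_weight_def)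
next
  case (Suc k)
  from weight_vec_lower[OF this] show ?case by (simp add: algebra_simps)
qed

text \<open>The textbook identity J_+ J_-^(k+1) w = (k + 1) (2 \<mu> - k) J_-^k w; the sign comes
  from the factors - i in \<open>raise\<close> and \<open>lower\<close>. The induction step commutes
  one raising operator past one lowering operator, which contributes twice the weight of the vector
  below.\<close>

lemma raise_lower:
  assumes "highest_weight \<mu> w"
  shows "raise R ((lower R ^^ Suc k) w) = (- (of_nat (Suc k) * (2 * \<mu> - of_nat k))) \<cdot>\<^sub>v (lower R ^^ k) w"
proof (induction k)
  case 0
  have w: "w \<in> carrier_vec m" "R 3 *\<^sub>v w = (- \<i> * \<mu>) \<cdot>\<^sub>v w" "raise R w = 0\<^sub>v m"
    using assms by (auto simp: highest_weight_def weight_vec_def)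
  have "lower R (0\<^sub>v m) = 0\<^sub>v m" by (intro eq_vecI) (auto simp: lower_def scalar_prod_def)
  thus ?case using raising(3)[OF w(1)] w by (auto simp: algebra_simps intro!: eq_vecI)
next
  case (Suc k)
  let ?w = "\<lambda>k. (lower R ^^ k) w"
  have w: "?w k \<in> carrier_vec m" "R 3 *\<^sub>v ?w k = (- \<i> * (\<mu> - of_nat k)) \<cdot>\<^sub>v ?w k" for k
    using lower_weight[OF assms] by (auto simp: weight_vec_def)
  have L: "lower R (c \<cdot>\<^sub>v v) = c \<cdot>\<^sub>v lower R v" if "v \<in> carrier_vec m" for c v
    using that by (intro eq_vecI) (auto simp: lower_def mult_mat_vec[OF carrier that] algebra_simps simp del: index_mult_mat_vec)
  have "raise R (?w (Suc (Suc k))) = lower R (raise R (?w (Suc k))) + (- 2 * \<i>) \<cdot>\<^sub>v (R 3 *\<^sub>v ?w (Suc k))"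
    using raising(3)[OF w(1)[of "Suc k"]] by simp
  also have "\<dots> = (- (of_nat (Suc k) * (2 * \<mu> - of_nat k)) - 2 * (\<mu> - of_nat (Suc k))) \<cdot>\<^sub>v ?w (Suc k)"
    unfolding Suc w(2) L[OF w(1)] using w(1)[of "Suc k"] by (intro eq_vecI) (auto simp: algebra_simps)
  also have "- (of_nat (Suc k) * (2 * \<mu> - of_nat k)) - 2 * (\<mu> - of_nat (Suc k)) =
      - (of_nat (Suc (Suc k)) * (2 * \<mu> - of_nat (Suc k)))" by (simp add: algebra_simps)
  finally show ?case .
qed

text \<open>Its range over all coefficient functions is the span of the first K vectors of the
  chain. With explicit coefficients, invariance of the span reduces to three formulas for how R_3,
  \<open>lower\<close> and \<open>raise\<close> transform c.\<close>

definition ladder :: "nat \<Rightarrow> complex Matrix.vec \<Rightarrow> (nat \<Rightarrow> complex) \<Rightarrow> complex Matrix.vec" where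
  "ladder K w c = vec m (\<lambda>r. \<Sum>k<K. c k * (lower R ^^ k) w $ r)"

context
  fixes \<mu> w K
  assumes w: "highest_weight \<mu> w" and K: "(lower R ^^ Suc K) w = 0\<^sub>v m"
begin

lemma lower_pow_carrier [simp]: "(lower R ^^ k) w \<in> carrier_vec m"
  using lower_weight[OF w] by (simp add: weight_vec_def)

lemma dim_lower_pow [simp]: "dim_vec ((lower R ^^ k) w) = m"
  by (rule carrier_vecD[OF lower_pow_carrier])

lemma mult_ladder:
  "(R i *\<^sub>v ladder (Suc K) w c) $ r = (\<Sum>k<Suc K. c k * (R i *\<^sub>v (lower R ^^ k) w) $ r)" if "r < m"
proof -
  have l: "ladder (Suc K) w c \<in> carrier_vec m" by (simp add: ladder_def)
  show ?thesis
    unfolding index_mult_mat_vec_sum[OF carrier l that] index_mult_mat_vec_sum[OF carrier lower_pow_carrier that]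
    by (simp add: ladder_def sum_distrib_left mult_ac del: sum.lessThan_Suc) (subst sum.swap, rule refl)
qed

lemma R3_ladder: "R 3 *\<^sub>v ladder (Suc K) w c = ladder (Suc K) w (\<lambda>k. - \<i> * (\<mu> - of_nat k) * c k)"
proof (rule eq_vecI)
  fix r assume "r < dim_vec (ladder (Suc K) w (\<lambda>k. - \<i> * (\<mu> - of_nat k) * c k))"
  hence r: "r < m" by (simp add: ladder_def)
  have "(R 3 *\<^sub>v (lower R ^^ k) w) $ r = (- \<i> * (\<mu> - of_nat k)) * (lower R ^^ k) w $ r" for k
    using lower_weight[OF w, of k] r by (simp add: weight_vec_def del: index_mult_mat_vec)
  thus "(R 3 *\<^sub>v ladder (Suc K) w c) $ r = ladder (Suc K) w (\<lambda>k. - \<i> * (\<mu> - of_nat k) * c k) $ r"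
    unfolding mult_ladder[OF r] using r by (simp add: ladder_def mult_ac del: sum.lessThan_Suc)
qed (simp add: ladder_def)

text \<open>Lowering shifts the coefficients by one place; the one that would leave the range
  multiplies the vector at position K + 1, which is zero.\<close>

lemma lower_ladder: "lower R (ladder (Suc K) w c) = ladder (Suc K) w (\<lambda>k. if k = 0 then 0 else c (k - 1))"
proof (rule eq_vecI)
  fix r assume "r < dim_vec (ladder (Suc K) w (\<lambda>k. if k = 0 then 0 else c (k - 1)))"
  hence r: "r < m" by (simp add: ladder_def)
  have "lower R (ladder (Suc K) w c) $ r = (\<Sum>k<Suc K. c k * (lower R ^^ Suc k) w $ r)"
    using r by (simp add: lower_def mult_ladder right_diff_distrib mult_ac sum_distrib_left sum.distrib sum_negf sum_subtractf del: index_mult_mat_vec sum.lessThan_Suc)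
  also have "\<dots> = (\<Sum>k<K. c k * (lower R ^^ Suc k) w $ r)" using K r by simp
  also have "\<dots> = (\<Sum>k<Suc K. (if k = 0 then 0 else c (k - 1)) * (lower R ^^ k) w $ r)"
    unfolding sum.lessThan_Suc_shift by simp
  finally show "lower R (ladder (Suc K) w c) $ r = ladder (Suc K) w (\<lambda>k. if k = 0 then 0 else c (k - 1)) $ r"
    using r by (simp add: ladder_def del: sum.lessThan_Suc)
qed (simp add: ladder_def lower_def)

lemma raise_ladder: "raise R (ladder (Suc K) w c) =
  ladder (Suc K) w (\<lambda>k. if k < K then - (of_nat (Suc k) * (2 * \<mu> - of_nat k)) * c (Suc k) else 0)" (is "_ = ladder _ _ ?d")
proof (rule eq_vecI)
  fix r assume "r < dim_vec (ladder (Suc K) w ?d)"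
  hence r: "r < m" by (simp add: ladder_def)
  have "raise R (ladder (Suc K) w c) $ r = (\<Sum>k<Suc K. c k * raise R ((lower R ^^ k) w) $ r)"
    using r by (simp add: raise_def mult_ladder algebra_simps sum_distrib_left sum.distrib sum_negf del: index_mult_mat_vec sum.lessThan_Suc)
  also have "\<dots> = (\<Sum>k<K. c (Suc k) * raise R ((lower R ^^ Suc k) w) $ r)"
    unfolding sum.lessThan_Suc_shift using w r by (simp add: highest_weight_def)
  also have "\<dots> = (\<Sum>k<K. ?d k * (lower R ^^ k) w $ r)"
    unfolding raise_lower[OF w] using r by (intro sum.cong) auto
  also have "\<dots> = (\<Sum>k<Suc K. ?d k * (lower R ^^ k) w $ r)" by simp
  finally show "raise R (ladder (Suc K) w c) $ r = ladder (Suc K) w ?d $ r"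
    using r by (simp add: ladder_def del: sum.lessThan_Suc)
qed (simp add: ladder_def raise_def)

lemma ladder_add: "ladder (Suc K) w c + ladder (Suc K) w d = ladder (Suc K) w (\<lambda>k. c k + d k)"
  by (rule eq_vecI) (auto simp: ladder_def algebra_simps sum.distrib simp del: sum.lessThan_Suc)

lemma ladder_smult: "a \<cdot>\<^sub>v ladder (Suc K) w c = ladder (Suc K) w (\<lambda>k. a * c k)"
  by (rule eq_vecI) (auto simp: ladder_def algebra_simps sum_distrib_left simp del: sum.lessThan_Suc)

lemma range_ladder:
  assumes "w \<noteq> 0\<^sub>v m"
  shows "range (ladder (Suc K) w) = carrier_vec m"
proof (rule invariant_subspace)
  show "range (ladder (Suc K) w) \<subseteq> carrier_vec m" by (auto simp: ladder_def)
  have "0\<^sub>v m = ladder (Suc K) w (\<lambda>k. 0)" by (auto simp: ladder_def)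
  thus "0\<^sub>v m \<in> range (ladder (Suc K) w)" by blast
  have "(\<Sum>k<Suc K. (if k = 0 then 1 else 0) * (lower R ^^ k) w $ r) = w $ r" for r
    by (simp add: if_distrib[of "\<lambda>x. x * _"] sum.lessThan_Suc_shift cong: if_cong del: sum.lessThan_Suc)
  hence "w = ladder (Suc K) w (\<lambda>k. if k = 0 then 1 else 0)"
    using w by (auto simp: ladder_def highest_weight_def weight_vec_def simp del: sum.lessThan_Suc)
  thus "w \<in> range (ladder (Suc K) w)" by blast
  show "w \<noteq> 0\<^sub>v m" by fact
  show "u + v \<in> range (ladder (Suc K) w)" if "u \<in> range (ladder (Suc K) w)" "v \<in> range (ladder (Suc K) w)" for u v
    using that by (auto simp: ladder_add)
  show sm: "a \<cdot>\<^sub>v v \<in> range (ladder (Suc K) w)" if "v \<in> range (ladder (Suc K) w)" for a v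
    using that by (auto simp: ladder_smult)
  show "R i *\<^sub>v v \<in> range (ladder (Suc K) w)" if "v \<in> range (ladder (Suc K) w)" for i v
  proof -
    obtain c where v: "v = ladder (Suc K) w c" using \<open>v \<in> _\<close> by blast
    have d: "dim_vec v = m" by (simp add: v ladder_def)
    \<comment> \<open>R_1 and R_2 are recovered from the two ladder operators, for which invariance
      is already known.\<close>
    have 1: "R 1 *\<^sub>v v = (1/2) \<cdot>\<^sub>v raise R v + (1/2) \<cdot>\<^sub>v lower R v"
      using d by (intro eq_vecI) (auto simp: raise_def lower_def algebra_simps simp del: index_mult_mat_vec)
    have 2: "R 2 *\<^sub>v v = (- \<i> / 2) \<cdot>\<^sub>v raise R v + (\<i> / 2) \<cdot>\<^sub>v lower R v"
      using d by (intro eq_vecI) (auto simp: raise_def lower_def algebra_simps simp del: index_mult_mat_vec)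
    have "i = 1 \<or> i = 2 \<or> i = 3" using exhaust_3 by blast
    thus ?thesis
    proof (elim disjE)
      assume "i = 1"
      thus ?thesis using 1 unfolding v raise_ladder lower_ladder ladder_smult ladder_add by simp
    next
      assume "i = 2"
      thus ?thesis using 2 unfolding v raise_ladder lower_ladder ladder_smult ladder_add by simp
    next
      assume "i = 3"
      thus ?thesis unfolding v by (simp add: R3_ladder)
    qed
  qed
qed

end

end

section \<open>The highest weight in terms of the dimension, and uniqueness of its vector\<close>

lemma inner_vec_conv: "u \<in> carrier_vec n \<Longrightarrow> v \<in> carrier_vec n \<Longrightarrow> inner_vec u v = (\<Sum>r<n. u $ r * cnj (v $ r))"
  by (simp add: inner_vec_def)

context so3_irrep
begin

lemma raise_zero: "raise R (0\<^sub>v m) = 0\<^sub>v m"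
  by (intro eq_vecI) (auto simp: raise_def scalar_prod_def)

text \<open>K is the last position at which the chain is nonzero. Raising the zero vector at
  position K + 1 gives (K + 1) (2 \<mu> - K) times a nonzero vector, up to sign, which forces 2
  \<mu> = K.\<close>

lemma highest_weight_ladder:
  assumes w: "highest_weight \<mu> w" and nz: "w \<noteq> 0\<^sub>v m"
  obtains K where "(lower R ^^ Suc K) w = 0\<^sub>v m" "\<And>k. k \<le> K \<Longrightarrow> (lower R ^^ k) w \<noteq> 0\<^sub>v m"
    "\<mu> = of_nat K / 2"
proof -
  have ex: "\<exists>k. (lower R ^^ k) w = 0\<^sub>v m"
    by (rule weight_sequence_vanishes[OF lower_weight[OF w]]) (auto simp: inj_def)
  define L where "L = (LEAST k. (lower R ^^ k) w = 0\<^sub>v m)"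
  have L: "(lower R ^^ L) w = 0\<^sub>v m" "\<And>k. k < L \<Longrightarrow> (lower R ^^ k) w \<noteq> 0\<^sub>v m"
    unfolding L_def using LeastI_ex[OF ex] not_less_Least by blast+
  have "L \<noteq> 0" using L(1) nz by (cases L) auto
  then obtain K where K: "L = Suc K" by (cases L) auto
  have "0\<^sub>v m = (- (of_nat (Suc K) * (2 * \<mu> - of_nat K))) \<cdot>\<^sub>v (lower R ^^ K) w"
    using raise_lower[OF w, of K] L(1) raise_zero unfolding K by metis
  moreover have "\<exists>r<m. (lower R ^^ K) w $ r \<noteq> 0"
  proof (rule ccontr)
    assume "\<not> ?thesis"
    hence "(lower R ^^ K) w = 0\<^sub>v m"
      using lower_weight[OF w, of K] by (intro eq_vecI) (auto simp: weight_vec_def)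
    thus False using L(2)[of K] K by simp
  qed
  then obtain r where "r < m" "(lower R ^^ K) w $ r \<noteq> 0" by blast
  ultimately have "(of_nat (Suc K) * (2 * \<mu> - of_nat K)) = 0"
    using lower_weight[OF w, of K] 
    by (auto simp: weight_vec_def simp del: of_nat_Suc dest!: arg_cong[of _ _ "\<lambda>v. v $ r"])
  hence "2 * \<mu> = of_nat K" by (simp del: of_nat_Suc)
  hence "\<mu> = of_nat K / 2" by (simp add: field_simps)
  thus ?thesis using that[of K] L K by (simp del: funpow.simps)
qed

lemma inner_ladder:
  assumes w: "highest_weight \<mu> w" and v: "v \<in> carrier_vec m"
  shows "inner_vec v (ladder K w c) = (\<Sum>k<K. cnj (c k) * inner_vec v ((lower R ^^ k) w))"
    and "inner_vec (ladder K w c) v = (\<Sum>k<K. c k * inner_vec ((lower R ^^ k) w) v)"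
proof -
  have c: "(lower R ^^ k) w \<in> carrier_vec m" for k
    using lower_weight[OF w, of k] by (simp add: weight_vec_def)
  have l: "ladder K w c \<in> carrier_vec m" by (simp add: ladder_def)
  show "inner_vec v (ladder K w c) = (\<Sum>k<K. cnj (c k) * inner_vec v ((lower R ^^ k) w))"
    unfolding inner_vec_conv[OF v l] inner_vec_conv[OF v c]
    by (simp add: ladder_def sum_distrib_left mult_ac) (subst sum.swap, rule refl)
  show "inner_vec (ladder K w c) v = (\<Sum>k<K. c k * inner_vec ((lower R ^^ k) w) v)"
    unfolding inner_vec_conv[OF l v] inner_vec_conv[OF c v]
    by (simp add: ladder_def sum_distrib_right sum_distrib_left mult_ac) (subst sum.swap, rule refl)
qed

lemma lower_pow_orthogonal:
  assumes w: "highest_weight (complex_of_real x) w" and "k \<noteq> l"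
  shows "inner_vec ((lower R ^^ k) w) ((lower R ^^ l) w) = 0"
proof (rule weight_vecs_orthogonal)
  show "weight_vec (complex_of_real (x - real k)) ((lower R ^^ k) w)"
    "weight_vec (complex_of_real (x - real l)) ((lower R ^^ l) w)"
    using lower_weight[OF w, of k] lower_weight[OF w, of l] by simp_all
qed (use \<open>k \<noteq> l\<close> in simp)

text \<open>The K + 1 chain vectors form an orthogonal basis, so m = K + 1. The count uses no
  dimension theory: the identity is the sum of the projections onto the chain vectors, and its trace
  m is compared with the K + 1 traces equal to 1.\<close>

lemma highest_weight_value:
  assumes w: "highest_weight \<mu> w" and nz: "w \<noteq> 0\<^sub>v m"
  shows "\<mu> = of_nat (m - 1) / 2"
proof -
  obtain K where K: "(lower R ^^ Suc K) w = 0\<^sub>v m" "\<And>k. k \<le> K \<Longrightarrow> (lower R ^^ k) w \<noteq> 0\<^sub>v m"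
    and \<mu>: "\<mu> = of_nat K / 2"
    using highest_weight_ladder[OF w nz] by blast
  have wr: "highest_weight (complex_of_real (real K / 2)) w" using w \<mu> by simp
  let ?w = "\<lambda>k. (lower R ^^ k) w"
  have c: "?w k \<in> carrier_vec m" for k
    using lower_weight[OF w, of k] by (simp add: weight_vec_def)
  have g: "inner_vec (?w k) (?w k) \<noteq> 0" if "k < Suc K" for k
    using inner_vec_self_eq_0[OF c[of k]] K(2)[of k] that by auto
  \<comment> \<open>Diagonal entry (s, s) of the identity, expanded in the projections. The
    coefficients of \<open>unit_vec m s\<close> in the chain are found by pairing with each chain
    vector.\<close>
  have one: "(\<Sum>k<Suc K. ?w k $ s * cnj (?w k $ s) / inner_vec (?w k) (?w k)) = 1" if s: "s < m" for s
  proof -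
    have "unit_vec m s \<in> range (ladder (Suc K) w)"
      using range_ladder[OF w K(1) nz] by simp
    then obtain d where d: "unit_vec m s = ladder (Suc K) w d" by blast
    have dl: "d l = cnj (?w l $ s) / inner_vec (?w l) (?w l)" if l: "l < Suc K" for l
    proof -
      have "cnj (?w l $ s) = inner_vec (unit_vec m s) (?w l)"
        using s unfolding inner_vec_conv[OF unit_vec_carrier c]
        by (simp add: unit_vec_def if_distrib[of "\<lambda>x. x * _"] cong: if_cong)
      also have "\<dots> = (\<Sum>k<Suc K. d k * inner_vec (?w k) (?w l))"
        unfolding d by (rule inner_ladder(2)[OF w c])
      also have "\<dots> = (\<Sum>k<Suc K. if k = l then d l * inner_vec (?w l) (?w l) else 0)"
        by (intro sum.cong) (auto simp: lower_pow_orthogonal[OF wr])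
      also have "\<dots> = d l * inner_vec (?w l) (?w l)" using l by (simp del: sum.lessThan_Suc)
      finally show ?thesis using g[OF l] by (simp add: field_simps)
    qed
    have "1 = unit_vec m s $ s" using s by simp
    also have "\<dots> = (\<Sum>k<Suc K. d k * ?w k $ s)"
      unfolding d using s by (simp add: ladder_def del: sum.lessThan_Suc)
    also have "\<dots> = (\<Sum>k<Suc K. ?w k $ s * cnj (?w k $ s) / inner_vec (?w k) (?w k))"
      by (intro sum.cong) (auto simp: dl)
    finally show ?thesis by simp
  qed
  \<comment> \<open>One double sum in two orders: summing over k first gives m by
    \<open>one\<close>, summing over s first gives a norm divided by itself for each k.\<close>
  have "of_nat m = (\<Sum>s<m. \<Sum>k<Suc K. ?w k $ s * cnj (?w k $ s) / inner_vec (?w k) (?w k))"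
    using one by simp
  also have "\<dots> = (\<Sum>k<Suc K. \<Sum>s<m. ?w k $ s * cnj (?w k $ s) / inner_vec (?w k) (?w k))"
    by (rule sum.swap)
  also have "\<dots> = (\<Sum>k<Suc K. inner_vec (?w k) (?w k) / inner_vec (?w k) (?w k))"
    unfolding inner_vec_conv[OF c c] by (simp only: sum_divide_distrib)
  also have "\<dots> = (\<Sum>k<Suc K. 1)" by (intro sum.cong) (use g in auto)
  finally have "m = Suc K" by (simp del: of_nat_Suc sum.lessThan_Suc)
  thus ?thesis using \<mu> by simp
qed

lemma highest_weight_add_smult:
  assumes "highest_weight \<mu> u" "highest_weight \<mu> v"
  shows "highest_weight \<mu> (u + a \<cdot>\<^sub>v v)"
proof -
  have uv: "u \<in> carrier_vec m" "v \<in> carrier_vec m" "R 3 *\<^sub>v u = (- \<i> * \<mu>) \<cdot>\<^sub>v u" "R 3 *\<^sub>v v = (- \<i> * \<mu>) \<cdot>\<^sub>v v"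
     "raise R u = 0\<^sub>v m" "raise R v = 0\<^sub>v m"
    using assms by (auto simp: highest_weight_def weight_vec_def)
  have lin: "R i *\<^sub>v (u + a \<cdot>\<^sub>v v) = R i *\<^sub>v u + a \<cdot>\<^sub>v (R i *\<^sub>v v)" for i
    using mult_add_distrib_mat_vec[OF carrier uv(1), of "a \<cdot>\<^sub>v v" i] uv mult_mat_vec[OF carrier uv(2)] by simp
  have "raise R (u + a \<cdot>\<^sub>v v) = raise R u + a \<cdot>\<^sub>v raise R v"
    unfolding raise_def lin by (intro eq_vecI) (auto simp: algebra_simps simp del: index_mult_mat_vec)
  thus ?thesis unfolding highest_weight_def weight_vec_def lin uv
    using uv(1,2) by (auto intro!: eq_vecI simp: algebra_simps)
qed

text \<open>Subtract from v its projection onto w. The rest u is orthogonal to w by construction and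
  to the lower chain vectors because their weights differ; as the chain spans, u is orthogonal to
  itself.\<close>

lemma highest_weight_unique:
  assumes w: "highest_weight \<mu> w" and nz: "w \<noteq> 0\<^sub>v m" and v: "highest_weight \<mu> v"
  shows "\<exists>a. v = a \<cdot>\<^sub>v w"
proof -
  obtain K where K: "(lower R ^^ Suc K) w = 0\<^sub>v m" and \<mu>: "\<mu> = of_nat K / 2"
    using highest_weight_ladder[OF w nz] by blast
  let ?w = "\<lambda>k. (lower R ^^ k) w"
  have c: "w \<in> carrier_vec m" "v \<in> carrier_vec m" using w v by (auto simp: highest_weight_def weight_vec_def)
  define a where "a = inner_vec v w / inner_vec w w"
  define u where "u = v + (- a) \<cdot>\<^sub>v w"
  have u: "highest_weight \<mu> u" unfolding u_def by (rule highest_weight_add_smult[OF v w])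
  have uc: "u \<in> carrier_vec m" using u by (auto simp: highest_weight_def weight_vec_def)
  have "inner_vec w w \<noteq> 0" using inner_vec_self_eq_0 c(1) nz by blast
  have "inner_vec u w = inner_vec v w - a * inner_vec w w"
    unfolding inner_vec_conv[OF uc c(1)] inner_vec_conv[OF c(2,1)] inner_vec_conv[OF c(1,1)]
    unfolding u_def using c by (simp add: algebra_simps sum_subtractf sum_distrib_left)
  hence u0: "inner_vec u w = 0" using \<open>inner_vec w w \<noteq> 0\<close> by (simp add: a_def)
  have "inner_vec u (?w k) = 0" for k
  proof (cases "k = 0")
    case False
    show ?thesis
    proof (rule weight_vecs_orthogonal)
      show "weight_vec (complex_of_real (real K / 2)) u" using u \<mu> by (simp add: highest_weight_def)
      show "weight_vec (complex_of_real (real K / 2 - real k)) (?w k)" using lower_weight[OF w, of k] \<mu> by simp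
    qed (use False in simp)
  qed (use u0 in simp)
  moreover obtain d where d: "u = ladder (Suc K) w d"
    using range_ladder[OF w K nz] uc by (metis imageE)
  have "inner_vec u u = (\<Sum>k<Suc K. cnj (d k) * inner_vec u (?w k))"
    using inner_ladder(1)[OF w uc, of "Suc K" d] d by metis
  ultimately have "inner_vec u u = 0" by simp
  hence "u = 0\<^sub>v m" using inner_vec_self_eq_0[OF uc] by simp
  have "v = a \<cdot>\<^sub>v w"
  proof (rule eq_vecI)
    fix r assume "r < dim_vec (a \<cdot>\<^sub>v w)"
    hence "r < m" using c by simp
    thus "v $ r = (a \<cdot>\<^sub>v w) $ r" using c arg_cong[OF \<open>u = 0\<^sub>v m\<close>, of "\<lambda>x. x $ r"] by (simp add: u_def)
  qed (use c in simp)
  thus ?thesis by blast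
qed

end

section \<open>Equivariant triples between irreducible representations\<close>

lemma equivariant_add_smult:
  assumes C: "equivariant p m R S C" and B: "equivariant p m R S B"
    and R: "\<And>j. R j \<in> carrier_mat p p" and S: "\<And>j. S j \<in> carrier_mat m m"
  shows "equivariant p m R S (\<lambda>k. C k + a \<cdot>\<^sub>m B k)"
proof -
  have c: "C k \<in> carrier_mat p m" "B k \<in> carrier_mat p m" for k
    using C B by (auto simp: equivariant_def)
  have d: "dim_row (C k) = p" "dim_row (B k) = p" "dim_col (C k) = m" "dim_col (B k) = m" for k
    using c[of k] by auto
  have d': "dim_row (R k) = p" "dim_col (S k) = m" for k
    using R[of k] S[of k] by auto
  have ab: "a \<cdot>\<^sub>m B k \<in> carrier_mat p m" for k using c by simp
  have "R j * (C k + a \<cdot>\<^sub>m B k) - (C k + a \<cdot>\<^sub>m B k) * S j = lincomb3 (levi_civita j k) (\<lambda>k. C k + a \<cdot>\<^sub>m B k)" for j k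
  proof (rule eq_matI)
    fix r s assume "r < dim_row (lincomb3 (levi_civita j k) (\<lambda>k. C k + a \<cdot>\<^sub>m B k))"
      "s < dim_col (lincomb3 (levi_civita j k) (\<lambda>k. C k + a \<cdot>\<^sub>m B k))"
    hence rs: "r < p" "s < m" using c by (auto simp: lincomb3_def d)
    have "(R j * C k - C k * S j) $$ (r, s) = lincomb3 (levi_civita j k) C $$ (r, s)"
      "(R j * B k - B k * S j) $$ (r, s) = lincomb3 (levi_civita j k) B $$ (r, s)"
      using C B by (simp_all add: equivariant_def)
    hence "(R j * C k) $$ (r, s) - (C k * S j) $$ (r, s) = lincomb3 (levi_civita j k) C $$ (r, s)"
      "(R j * B k) $$ (r, s) - (B k * S j) $$ (r, s) = lincomb3 (levi_civita j k) B $$ (r, s)"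
      using rs by (simp_all add: d d' del: index_mult_mat(1))
    thus "(R j * (C k + a \<cdot>\<^sub>m B k) - (C k + a \<cdot>\<^sub>m B k) * S j) $$ (r, s) =
        lincomb3 (levi_civita j k) (\<lambda>k. C k + a \<cdot>\<^sub>m B k) $$ (r, s)"
      unfolding mult_add_distrib_mat[OF R c(1) ab] add_mult_distrib_mat[OF c(1) ab S]
        mult_smult_distrib[OF R c(2)] mult_smult_assoc_mat[OF c(2) S]
      using rs by (simp add: lincomb3_def d d' algebra_simps del: index_mult_mat(1))
  qed (simp_all add: lincomb3_def d d')
  thus ?thesis using c by (simp add: equivariant_def)
qed

text \<open>The source V_m with S precedes the target V_p with R here, whereas
  \<open>equivariant\<close> lists the target first.\<close>

locale equivariant_triple = S: so3_irrep m S + R: so3_irrep p R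
  for m S p R +
  fixes C :: "3 \<Rightarrow> complex mat"
  assumes equivariant: "equivariant p m R S C"
begin

lemma triple_carrier: "C k \<in> carrier_mat p m"
  using equivariant by (simp add: equivariant_def)

lemma triple_dims [simp]: "dim_row (C k) = p" "dim_col (C k) = m"
  by (rule carrier_matD[OF triple_carrier])+

lemmas weight = weight_relations[OF equivariant R.carrier S.carrier]
lemmas raising = raise_relations[OF equivariant R.carrier S.carrier]

lemma triple_mult_zero: "C k *\<^sub>v 0\<^sub>v m = 0\<^sub>v p" "raise C (0\<^sub>v m) = 0\<^sub>v p" "lower C (0\<^sub>v m) = 0\<^sub>v p"
  by (auto simp: raise_def lower_def scalar_prod_def intro!: eq_vecI)

text \<open>The common kernel of the \<open>C\<^sub>k\<close> is an invariant subspace.\<close>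

lemma zero_triple:
  assumes w: "w \<in> carrier_vec m" "w \<noteq> 0\<^sub>v m" and z: "\<And>k. C k *\<^sub>v w = 0\<^sub>v p"
  shows "C k = 0\<^sub>m p m"
proof -
  let ?W = "{u \<in> carrier_vec m. \<forall>k. C k *\<^sub>v u = 0\<^sub>v p}"
  have "?W = carrier_vec m"
  proof (rule S.invariant_subspace)
    show "u + v \<in> ?W" if "u \<in> ?W" "v \<in> ?W" for u v
      using that by (auto simp: mult_add_distrib_mat_vec[OF triple_carrier])
    show "c \<cdot>\<^sub>v v \<in> ?W" if "v \<in> ?W" for c v
      using that by (auto simp: mult_mat_vec[OF triple_carrier])
    show "S i *\<^sub>v v \<in> ?W" if "v \<in> ?W" for i v
    proof -
      have v: "v \<in> carrier_vec m" "\<And>k. C k *\<^sub>v v = 0\<^sub>v p" using that by auto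
      have "R i *\<^sub>v 0\<^sub>v p = 0\<^sub>v p" by (auto simp: scalar_prod_def intro!: eq_vecI)
      \<comment> \<open>Commuting R_i past C_k produces only vectors C_l v, and these vanish on the
        common kernel.\<close>
      hence "0\<^sub>v p = C k *\<^sub>v (S i *\<^sub>v v) + (levi_civita i k 1 \<cdot>\<^sub>v 0\<^sub>v p + levi_civita i k 2 \<cdot>\<^sub>v 0\<^sub>v p + levi_civita i k 3 \<cdot>\<^sub>v 0\<^sub>v p)" for k
        using equivariant_vec[OF equivariant R.carrier S.carrier v(1), of i k] by (simp only: v(2))
      hence *: "C k *\<^sub>v (S i *\<^sub>v v) + (levi_civita i k 1 \<cdot>\<^sub>v 0\<^sub>v p + levi_civita i k 2 \<cdot>\<^sub>v 0\<^sub>v p + levi_civita i k 3 \<cdot>\<^sub>v 0\<^sub>v p) = 0\<^sub>v p" for k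
        by (rule sym)
      have "C k *\<^sub>v (S i *\<^sub>v v) = 0\<^sub>v p" for k
      proof (rule eq_vecI)
        fix r assume "r < dim_vec (0\<^sub>v p :: complex Matrix.vec)"
        thus "(C k *\<^sub>v (S i *\<^sub>v v)) $ r = 0\<^sub>v p $ r"
          using arg_cong[OF *[of k], of "\<lambda>x. x $ r"] by (simp del: index_mult_mat_vec)
      qed simp
      thus ?thesis using mult_mat_vec_carrier[OF S.carrier v(1)] by blast
    qed
    show "w \<in> ?W" using w z by simp
    show "w \<noteq> 0\<^sub>v m" by fact
  qed (auto simp: triple_mult_zero)
  hence u: "C k *\<^sub>v unit_vec m s = 0\<^sub>v p" for s
    using unit_vec_carrier by blast
  show ?thesis
  proof (rule eq_matI)
    fix r s assume "r < dim_row (0\<^sub>m p m :: complex mat)" "s < dim_col (0\<^sub>m p m :: complex mat)"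
    hence rs: "r < p" "s < m" by auto
    have "0 = (C k *\<^sub>v unit_vec m s) $ r" using u rs by simp
    also have "\<dots> = C k $$ (r, s)"
      using rs by (simp)
    finally show "C k $$ (r, s) = 0\<^sub>m p m $$ (r, s)" using rs by simp
  qed auto
qed

lemma raise_smult: "v \<in> carrier_vec m \<Longrightarrow> raise C (a \<cdot>\<^sub>v v) = a \<cdot>\<^sub>v raise C v"
  "v \<in> carrier_vec m \<Longrightarrow> lower C (a \<cdot>\<^sub>v v) = a \<cdot>\<^sub>v lower C v"
  by (auto simp: raise_def lower_def mult_mat_vec[OF triple_carrier] algebra_simps intro!: eq_vecI simp del: index_mult_mat_vec)

context
  fixes \<mu> v assumes v: "S.highest_weight \<mu> v"
begin

lemma highest_weight_facts: "v \<in> carrier_vec m" "S 3 *\<^sub>v v = (- \<i> * \<mu>) \<cdot>\<^sub>v v" "raise S v = 0\<^sub>v m"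
  using v by (auto simp: S.highest_weight_def S.weight_vec_def)

lemma triple_vec_carrier [simp]: "raise C v \<in> carrier_vec p" "lower C v \<in> carrier_vec p" "C k *\<^sub>v v \<in> carrier_vec p"
  unfolding raise_def lower_def 
  by (intro add_carrier_vec smult_carrier_vec[THEN iffD2] mult_mat_vec_carrier[OF triple_carrier highest_weight_facts(1)])+

lemma triple_vec_dim [simp]: "dim_vec (raise C v) = p" "dim_vec (lower C v) = p"
  by (rule carrier_vecD[OF triple_vec_carrier(1)] carrier_vecD[OF triple_vec_carrier(2)])+

text \<open>The raising operator passes through C_+ and then kills v. In the two lemmas below it
  leaves a multiple of C_+ v or of C_3 v behind, which is why these are assumed to vanish
  there.\<close>

lemma highest_weight_raise: "R.highest_weight (\<mu> + 1) (raise C v)"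
  unfolding R.highest_weight_def R.weight_vec_def
  using weight(1)[OF highest_weight_facts(1)] raising(1)[OF highest_weight_facts(1)]
  by (auto simp: highest_weight_facts triple_mult_zero raise_smult algebra_simps intro!: eq_vecI simp del: index_mult_mat_vec)

lemma highest_weight_mid:
  assumes "raise C v = 0\<^sub>v p"
  shows "R.highest_weight \<mu> (C 3 *\<^sub>v v)"
  unfolding R.highest_weight_def R.weight_vec_def
  using weight(2)[OF highest_weight_facts(1)] raising(2)[OF highest_weight_facts(1)]
  by (auto simp: highest_weight_facts triple_mult_zero assms mult_mat_vec[OF triple_carrier highest_weight_facts(1)] intro!: eq_vecI simp del: index_mult_mat_vec)

lemma highest_weight_lower:
  assumes "raise C v = 0\<^sub>v p" "C 3 *\<^sub>v v = 0\<^sub>v p"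
  shows "R.highest_weight (\<mu> - 1) (lower C v)"
  unfolding R.highest_weight_def R.weight_vec_def
  using weight(3)[OF highest_weight_facts(1)] raising(3)[OF highest_weight_facts(1)]
  by (auto simp: highest_weight_facts triple_mult_zero assms raise_smult algebra_simps intro!: eq_vecI simp del: index_mult_mat_vec)

text \<open>A nonzero C_- v would be a highest weight vector of weight (m - 1)/2 - 1, hence m = p +
  2. So all three components kill v, and the kernel argument of \<open>zero_triple\<close>
  applies.\<close>

lemma zero_triple_highest_weight:
  assumes "v \<noteq> 0\<^sub>v m" "raise C v = 0\<^sub>v p" "C 3 *\<^sub>v v = 0\<^sub>v p" "m \<noteq> p + 2"
  shows "C k = 0\<^sub>m p m"
proof (rule zero_triple[OF highest_weight_facts(1) assms(1)])
  have "\<mu> = of_nat (m - 1) / 2" by (rule S.highest_weight_value[OF v assms(1)])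
  moreover have "\<mu> - 1 = of_nat (p - 1) / 2" if "lower C v \<noteq> 0\<^sub>v p"
    by (rule R.highest_weight_value[OF highest_weight_lower[OF assms(2,3)] that])
  moreover have "(of_nat (m - 1) / 2 - 1 :: complex) \<noteq> of_nat (p - 1) / 2"
  proof
    assume "(of_nat (m - 1) / 2 - 1 :: complex) = of_nat (p - 1) / 2"
    hence "2 * (of_nat (m - 1) / 2 - 1 :: complex) = 2 * (of_nat (p - 1) / 2)" by (simp only:)
    hence "(of_nat (m - 1) - 2 :: complex) = of_nat (p - 1)" by (simp add: right_diff_distrib)
    hence "(of_nat (m - 1) :: complex) = of_nat (p - 1 + 2)" by (simp add: diff_eq_eq)
    hence "m - 1 = p - 1 + 2" by (simp only: of_nat_eq_iff)
    thus False using assms(4) S.dim_pos R.dim_pos by simp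
  qed
  ultimately have l: "lower C v = 0\<^sub>v p" by auto
  have 1: "C 1 *\<^sub>v v = (1/2) \<cdot>\<^sub>v raise C v + (1/2) \<cdot>\<^sub>v lower C v"
    by (intro eq_vecI) (auto simp: raise_def lower_def algebra_simps simp del: index_mult_mat_vec)
  have 2: "C 2 *\<^sub>v v = (- \<i> / 2) \<cdot>\<^sub>v raise C v + (\<i> / 2) \<cdot>\<^sub>v lower C v"
    by (intro eq_vecI) (auto simp: raise_def lower_def algebra_simps simp del: index_mult_mat_vec)
  fix k :: 3
  have "k = 1 \<or> k = 2 \<or> k = 3" by (rule exhaust_3)
  thus "C k *\<^sub>v v = 0\<^sub>v p"
  proof (elim disjE)
    assume "k = 1" thus ?thesis using 1 unfolding l assms(2) by (auto intro!: eq_vecI simp del: index_mult_mat_vec)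
  next
    assume "k = 2" thus ?thesis using 2 unfolding l assms(2) by (auto intro!: eq_vecI simp del: index_mult_mat_vec)
  next
    assume "k = 3" thus ?thesis using assms(3) by simp
  qed
qed

end

end

section \<open>Classification of equivariant triples\<close>

text \<open>Raising the highest weight (a - 1)/2 by 1 raises the dimension by 2. Positivity keeps
  the natural subtractions from being truncated.\<close>

lemma weight_shift_dim:
  assumes "a > 0" "b > 0" "(of_nat (a - 1) / 2 + 1 :: complex) = of_nat (b - 1) / 2"
  shows "b = a + 2"
proof -
  have "2 * (of_nat (a - 1) / 2 + 1 :: complex) = 2 * (of_nat (b - 1) / 2)" using assms(3) by (simp only:)
  hence "(of_nat (a - 1 + 2) :: complex) = of_nat (b - 1)" by (simp add: distrib_left add.commute)
  hence "a - 1 + 2 = b - 1" by (simp only: of_nat_eq_iff)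
  thus ?thesis using assms by simp
qed

lemma raise_add_smult:
  assumes "\<And>k. C k \<in> carrier_mat p m" "\<And>k. B k \<in> carrier_mat p m" "v \<in> carrier_vec m"
  shows "(C k + a \<cdot>\<^sub>m B k) *\<^sub>v v = C k *\<^sub>v v + a \<cdot>\<^sub>v (B k *\<^sub>v v)"
    and "raise (\<lambda>k. C k + a \<cdot>\<^sub>m B k) v = raise C v + a \<cdot>\<^sub>v raise B v"
proof -
  have "a \<cdot>\<^sub>m B k \<in> carrier_mat p m" for k using assms by simp
  thus *: "(C k + a \<cdot>\<^sub>m B k) *\<^sub>v v = C k *\<^sub>v v + a \<cdot>\<^sub>v (B k *\<^sub>v v)" for k
    using add_mult_distrib_mat_vec[OF assms(1) _ assms(3)] smult_mat_vec[OF assms(2,3)] by metis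
  show "raise (\<lambda>k. C k + a \<cdot>\<^sub>m B k) v = raise C v + a \<cdot>\<^sub>v raise B v"
    unfolding raise_def * using carrier_matD(1)[OF assms(1)] carrier_matD(1)[OF assms(2)]
    by (intro eq_vecI) (auto simp: algebra_simps simp del: index_mult_mat_vec)
qed

lemma add_smult_mat_eq_0:
  fixes C :: "complex mat"
  assumes "C \<in> carrier_mat p m" "B \<in> carrier_mat p m" "C + (- a) \<cdot>\<^sub>m B = 0\<^sub>m p m"
  shows "C = a \<cdot>\<^sub>m B"
proof (rule eq_matI)
  fix r s assume "r < dim_row (a \<cdot>\<^sub>m B)" "s < dim_col (a \<cdot>\<^sub>m B)"
  hence "r < p" "s < m" using assms by auto
  moreover have "(C + (- a) \<cdot>\<^sub>m B) $$ (r, s) = 0\<^sub>m p m $$ (r, s)" by (simp only: assms(3))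
  ultimately show "C $$ (r, s) = (a \<cdot>\<^sub>m B) $$ (r, s)" using assms(1,2) by simp
qed (use assms in auto)

context equivariant_triple
begin

lemma raise_highest_weight_zero:
  assumes v: "S.highest_weight \<mu> v" "v \<noteq> 0\<^sub>v m" and "p \<noteq> m + 2"
  shows "raise C v = 0\<^sub>v p"
proof (rule ccontr)
  assume nz: "raise C v \<noteq> 0\<^sub>v p"
  have "of_nat (m - 1) / 2 + 1 = (of_nat (p - 1) / 2 :: complex)"
    using R.highest_weight_value[OF highest_weight_raise[OF v(1)] nz] S.highest_weight_value[OF v] by simp
  hence "p = m + 2" by (rule weight_shift_dim[OF S.dim_pos R.dim_pos])
  thus False using assms(3) by simp
qed

lemma mid_highest_weight_zero:
  assumes v: "S.highest_weight \<mu> v" "v \<noteq> 0\<^sub>v m" and r: "raise C v = 0\<^sub>v p" and "p \<noteq> m"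
  shows "C 3 *\<^sub>v v = 0\<^sub>v p"
proof (rule ccontr)
  assume nz: "C 3 *\<^sub>v v \<noteq> 0\<^sub>v p"
  have "of_nat (m - 1) = (of_nat (p - 1) :: complex)"
    using R.highest_weight_value[OF highest_weight_mid[OF v(1) r] nz] S.highest_weight_value[OF v] by simp
  hence "m - 1 = p - 1" by (simp only: of_nat_eq_iff)
  thus False using assms(4) R.dim_pos S.dim_pos by simp
qed

lemma triple_zero:
  assumes "p \<noteq> m" "p \<noteq> m + 2" "m \<noteq> p + 2"
  shows "C k = 0\<^sub>m p m"
proof -
  obtain \<mu> v where v: "S.highest_weight \<mu> v" "v \<noteq> 0\<^sub>v m" using S.highest_weight_ex by blast
  have r: "raise C v = 0\<^sub>v p" by (rule raise_highest_weight_zero[OF v assms(2)])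
  have "C 3 *\<^sub>v v = 0\<^sub>v p" by (rule mid_highest_weight_zero[OF v r assms(1)])
  thus ?thesis by (rule zero_triple_highest_weight[OF v r _ assms(3)])
qed

end

text \<open>A traceless 1 by 1 matrix is zero.\<close>

lemma (in so3_irrep) trivial_rep:
  assumes "m = 1"
  shows "R i = 0\<^sub>m m m"
proof (rule eq_matI)
  have "mat_trace (R i) = 0" using in_su[of i] by (simp add: su_def)
  thus "R i $$ (r, s) = 0\<^sub>m m m $$ (r, s)" if "r < dim_row (0\<^sub>m m m :: complex mat)" "s < dim_col (0\<^sub>m m m :: complex mat)" for r s
    using that assms by (simp add: mat_trace_def)
qed auto

text \<open>C_+ v vanishes for lack of a highest weight vector one step above. Once c is chosen so
  that C_3 v = c R_3 v, the triple C - c R is killed by the highest weight criterion.\<close>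

lemma (in so3_irrep) equivariant_endo:
  assumes C: "equivariant m m R R C"
  shows "\<exists>c. \<forall>k. C k = c \<cdot>\<^sub>m R k"
proof -
  interpret C: equivariant_triple m R m R C by unfold_locales (rule C)
  obtain \<mu> v where v: "highest_weight \<mu> v" "v \<noteq> 0\<^sub>v m" using highest_weight_ex by blast
  have vc: "v \<in> carrier_vec m" and v3: "R 3 *\<^sub>v v = (- \<i> * \<mu>) \<cdot>\<^sub>v v" and vr: "raise R v = 0\<^sub>v m"
    using v by (auto simp: highest_weight_def weight_vec_def)
  have r: "raise C v = 0\<^sub>v m" by (rule C.raise_highest_weight_zero[OF v]) simp
  have "\<exists>c. C 3 *\<^sub>v v = c \<cdot>\<^sub>v (R 3 *\<^sub>v v)"
  \<comment> \<open>In dimension 1 the weight is 0, so R_3 v = 0 and no quotient can define c. There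
    the representation is zero, and the relation for raising C_- v reduces to C_3 v = 0.\<close>
  proof (cases "m = 1")
    case True
    have z: "R i *\<^sub>v u = 0\<^sub>v m" if "u \<in> carrier_vec m" for i u
      using that by (auto simp: trivial_rep[OF True] intro!: eq_vecI)
    hence "raise R u = 0\<^sub>v m" if "u \<in> carrier_vec m" for u
      using that by (auto simp: raise_def)
    hence "0\<^sub>v m = 0\<^sub>v m + (- 2 * \<i>) \<cdot>\<^sub>v (C 3 *\<^sub>v v)"
      using C.raising(3)[OF vc] C.triple_vec_carrier(2)[OF v(1)] vc C.triple_mult_zero(3) by metis
    hence e: "0\<^sub>v m + (- 2 * \<i>) \<cdot>\<^sub>v (C 3 *\<^sub>v v) = 0\<^sub>v m" by (rule sym)
    have "C 3 *\<^sub>v v = 0\<^sub>v m"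
    proof (rule eq_vecI)
      fix r assume "r < dim_vec (0\<^sub>v m :: complex Matrix.vec)"
      thus "(C 3 *\<^sub>v v) $ r = 0\<^sub>v m $ r"
        using arg_cong[OF e, of "\<lambda>x. x $ r"] by (simp del: index_mult_mat_vec)
    qed simp
    thus ?thesis using z vc by (intro exI[of _ 0] eq_vecI) (simp_all del: index_mult_mat_vec)
  next
    case False
    hence "m - 1 \<noteq> 0" using dim_pos by simp
    hence \<mu>: "\<mu> \<noteq> 0"
      using highest_weight_value[OF v] by (metis divide_eq_0_iff of_nat_eq_0_iff zero_neq_numeral)
    obtain a where a: "C 3 *\<^sub>v v = a \<cdot>\<^sub>v v"
      using highest_weight_unique[OF v C.highest_weight_mid[OF v(1) r]] by blast
    \<comment> \<open>Both C_3 v and R_3 v are multiples of v, with factors a and - i \<mu>; c is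
      their quotient.\<close>
    have "a \<cdot>\<^sub>v v = (a / (- \<i> * \<mu>)) \<cdot>\<^sub>v ((- \<i> * \<mu>) \<cdot>\<^sub>v v)"
      using \<mu> by (intro eq_vecI) auto
    thus ?thesis unfolding v3 a by blast
  qed
  then obtain c where c: "C 3 *\<^sub>v v = c \<cdot>\<^sub>v (R 3 *\<^sub>v v)" by blast
  interpret D: equivariant_triple m R m R "\<lambda>k. C k + (- c) \<cdot>\<^sub>m R k"
    by unfold_locales (rule equivariant_add_smult[OF C self_equivariant carrier carrier])
  have "C k + (- c) \<cdot>\<^sub>m R k = 0\<^sub>m m m" for k
  proof (rule D.zero_triple_highest_weight[OF v])
    show "raise (\<lambda>k. C k + (- c) \<cdot>\<^sub>m R k) v = 0\<^sub>v m"
      by (rule D.raise_highest_weight_zero[OF v]) simp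
    show "(C 3 + (- c) \<cdot>\<^sub>m R 3) *\<^sub>v v = 0\<^sub>v m"
      unfolding raise_add_smult(1)[where C = C and B = R and k = 3, OF C.triple_carrier carrier vc] c
      using vc by (intro eq_vecI) (auto simp del: index_mult_mat_vec)
  qed simp
  thus ?thesis using add_smult_mat_eq_0[OF C.triple_carrier carrier] by blast
qed

text \<open>B_+ v is nonzero, since otherwise the weights would force B = 0. As C_+ v is a highest
  weight vector of the same weight, C_+ v = c B_+ v, and then C - c B has vanishing raised component
  and is zero.\<close>

lemma equivariant_proportional:
  assumes "so3_irrep m S" "so3_irrep (m + 2) R"
    and C: "equivariant (m + 2) m R S C" and B: "equivariant (m + 2) m R S B" and "B k \<noteq> 0\<^sub>m (m + 2) m"
  shows "\<exists>c. \<forall>k. C k = c \<cdot>\<^sub>m B k"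
proof -
  interpret S: so3_irrep m S by fact
  interpret R: so3_irrep "m + 2" R by fact
  interpret C: equivariant_triple m S "m + 2" R C by unfold_locales (rule C)
  interpret B: equivariant_triple m S "m + 2" R B by unfold_locales (rule B)
  obtain \<mu> v where v: "S.highest_weight \<mu> v" "v \<noteq> 0\<^sub>v m" using S.highest_weight_ex by blast
  have vc: "v \<in> carrier_vec m" using v by (auto simp: S.highest_weight_def S.weight_vec_def)
  have Bv: "raise B v \<noteq> 0\<^sub>v (m + 2)"
  proof
    assume r: "raise B v = 0\<^sub>v (m + 2)"
    have "B k = 0\<^sub>m (m + 2) m"
      by (rule B.zero_triple_highest_weight[OF v r B.mid_highest_weight_zero[OF v r]]) simp_all
    thus False using assms by simp
  qed
  obtain c where c: "raise C v = c \<cdot>\<^sub>v raise B v"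
    using R.highest_weight_unique[OF B.highest_weight_raise[OF v(1)] Bv C.highest_weight_raise[OF v(1)]] by blast
  interpret D: equivariant_triple m S "m + 2" R "\<lambda>k. C k + (- c) \<cdot>\<^sub>m B k"
    by unfold_locales (rule equivariant_add_smult[OF C B R.carrier S.carrier])
  have r: "raise (\<lambda>k. C k + (- c) \<cdot>\<^sub>m B k) v = 0\<^sub>v (m + 2)"
    unfolding raise_add_smult(2)[OF C.triple_carrier B.triple_carrier vc] c
    using B.triple_vec_dim[OF v(1)] by (intro eq_vecI) auto
  have "C k + (- c) \<cdot>\<^sub>m B k = 0\<^sub>m (m + 2) m" for k
    by (rule D.zero_triple_highest_weight[OF v r D.mid_highest_weight_zero[OF v r]]) simp_all
  thus ?thesis using add_smult_mat_eq_0[OF C.triple_carrier B.triple_carrier] by blast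
qed

text \<open>\<open>\<ss>\<oo>(3)\<close> is perfect, so a one-dimensional subrepresentation carries the trivial character \<open>l\<close>.\<close>

lemma character_vanishes:
  fixes Ra Rb Rc Sa Sb Sc Ba Bb Bc :: "complex mat"
  assumes R: "Ra \<in> carrier_mat p p" "Rb \<in> carrier_mat p p" "Rc \<in> carrier_mat p p"
    and S: "Sa \<in> carrier_mat m m" "Sb \<in> carrier_mat m m" "Sc \<in> carrier_mat m m"
    and B: "Ba \<in> carrier_mat p m" "Bb \<in> carrier_mat p m" "Bc \<in> carrier_mat p m"
    and RR: "\<And>u. u \<in> carrier_vec p \<Longrightarrow> Ra *\<^sub>v (Rb *\<^sub>v u) = Rb *\<^sub>v (Ra *\<^sub>v u) + Rc *\<^sub>v u"
    and SS: "\<And>u. u \<in> carrier_vec m \<Longrightarrow> Sa *\<^sub>v (Sb *\<^sub>v u) = Sb *\<^sub>v (Sa *\<^sub>v u) + Sc *\<^sub>v u"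
    and aB: "\<And>u. u \<in> carrier_vec m \<Longrightarrow> Ra *\<^sub>v (Ba *\<^sub>v u) = Ba *\<^sub>v (Sa *\<^sub>v u) + la \<cdot>\<^sub>v (Ba *\<^sub>v u)"
      "\<And>u. u \<in> carrier_vec m \<Longrightarrow> Ra *\<^sub>v (Bb *\<^sub>v u) = Bb *\<^sub>v (Sa *\<^sub>v u) + Bc *\<^sub>v u + la \<cdot>\<^sub>v (Bb *\<^sub>v u)"
      "\<And>u. u \<in> carrier_vec m \<Longrightarrow> Ra *\<^sub>v (Bc *\<^sub>v u) = Bc *\<^sub>v (Sa *\<^sub>v u) + (- 1) \<cdot>\<^sub>v (Bb *\<^sub>v u) + la \<cdot>\<^sub>v (Bc *\<^sub>v u)"
    and bB: "\<And>u. u \<in> carrier_vec m \<Longrightarrow> Rb *\<^sub>v (Ba *\<^sub>v u) = Ba *\<^sub>v (Sb *\<^sub>v u) + (- 1) \<cdot>\<^sub>v (Bc *\<^sub>v u) + lb \<cdot>\<^sub>v (Ba *\<^sub>v u)"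
      "\<And>u. u \<in> carrier_vec m \<Longrightarrow> Rb *\<^sub>v (Bb *\<^sub>v u) = Bb *\<^sub>v (Sb *\<^sub>v u) + lb \<cdot>\<^sub>v (Bb *\<^sub>v u)"
      "\<And>u. u \<in> carrier_vec m \<Longrightarrow> Rb *\<^sub>v (Bc *\<^sub>v u) = Bc *\<^sub>v (Sb *\<^sub>v u) + Ba *\<^sub>v u + lb \<cdot>\<^sub>v (Bc *\<^sub>v u)"
    and cB: "\<And>u. u \<in> carrier_vec m \<Longrightarrow> Rc *\<^sub>v (Ba *\<^sub>v u) = Ba *\<^sub>v (Sc *\<^sub>v u) + Bb *\<^sub>v u + lc \<cdot>\<^sub>v (Ba *\<^sub>v u)"
      "\<And>u. u \<in> carrier_vec m \<Longrightarrow> Rc *\<^sub>v (Bb *\<^sub>v u) = Bb *\<^sub>v (Sc *\<^sub>v u) + (- 1) \<cdot>\<^sub>v (Ba *\<^sub>v u) + lc \<cdot>\<^sub>v (Bb *\<^sub>v u)"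
      "\<And>u. u \<in> carrier_vec m \<Longrightarrow> Rc *\<^sub>v (Bc *\<^sub>v u) = Bc *\<^sub>v (Sc *\<^sub>v u) + lc \<cdot>\<^sub>v (Bc *\<^sub>v u)"
    and v: "v \<in> carrier_vec m" and X: "X \<in> {Ba, Bb, Bc}"
  shows "lc \<cdot>\<^sub>v (X *\<^sub>v v) = 0\<^sub>v p"
proof -
  note [simp] = mult_mat_vec_carrier[OF B(1)] mult_mat_vec_carrier[OF B(2)] mult_mat_vec_carrier[OF B(3)]
    mult_mat_vec_carrier[OF S(1)] mult_mat_vec_carrier[OF S(2)] mult_mat_vec_carrier[OF S(3)]
  note lin = mult_add_distrib_mat_vec[OF R(1)] mult_add_distrib_mat_vec[OF R(2)]
    mult_add_distrib_mat_vec[OF B(1)] mult_add_distrib_mat_vec[OF B(2)] mult_add_distrib_mat_vec[OF B(3)]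
    mult_mat_vec[OF R(1)] mult_mat_vec[OF R(2)]
  have dims: "dim_row Ba = p" "dim_row Bb = p" "dim_row Bc = p" using B by auto
  have Xp: "X *\<^sub>v v \<in> carrier_vec p" using X v by auto
  \<comment> \<open>Expand the bracket of a and b on X v. The scalars la and lb cancel because they
    commute with everything, the equivariant parts satisfy the bracket on their own, and only lc X v
    remains.\<close>
  have e: "Ra *\<^sub>v (Rb *\<^sub>v (X *\<^sub>v v)) = Rb *\<^sub>v (Ra *\<^sub>v (X *\<^sub>v v)) + Rc *\<^sub>v (X *\<^sub>v v)"
    by (rule RR[OF Xp])
  show ?thesis
  proof (rule eq_vecI)
    fix r assume "r < dim_vec (0\<^sub>v p :: complex Matrix.vec)"
    hence r: "r < p" by simp
    have er: "(Ra *\<^sub>v (Rb *\<^sub>v (X *\<^sub>v v))) $ r = (Rb *\<^sub>v (Ra *\<^sub>v (X *\<^sub>v v)) + Rc *\<^sub>v (X *\<^sub>v v)) $ r"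
      by (simp only: e)
    consider "X = Ba" | "X = Bb" | "X = Bc" using X by blast
    thus "(lc \<cdot>\<^sub>v (X *\<^sub>v v)) $ r = 0\<^sub>v p $ r"
      using er r v
      by cases (simp_all add: aB bB cB lin SS dims algebra_simps del: index_mult_mat_vec)
  qed (use carrier_vecD[OF Xp] in simp)
qed

lemma (in so3_irrep) brackets:
  assumes "u \<in> carrier_vec m"
  shows "R 2 *\<^sub>v (R 3 *\<^sub>v u) = R 3 *\<^sub>v (R 2 *\<^sub>v u) + R 1 *\<^sub>v u"
    and "R 3 *\<^sub>v (R 1 *\<^sub>v u) = R 1 *\<^sub>v (R 3 *\<^sub>v u) + R 2 *\<^sub>v u"
    and "R 1 *\<^sub>v (R 2 *\<^sub>v u) = R 2 *\<^sub>v (R 1 *\<^sub>v u) + R 3 *\<^sub>v u"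
  unfolding equivariant_vec[OF self_equivariant carrier carrier assms, of 2 3]
    equivariant_vec[OF self_equivariant carrier carrier assms, of 3 1]
    equivariant_vec[OF self_equivariant carrier carrier assms, of 1 2]
  by (rule eq_vecI; simp add: levi_civita_def del: index_mult_mat_vec)+

text \<open>Spanning a one-dimensional subrepresentation means being a common eigenvector, with
  eigenvalues l_j. Equivariance is the case l = 0, which is forced here because B is
  nonzero.\<close>

lemma equivariant_of_character:
  assumes irr: "so3_irrep m S" "so3_irrep p R" and c: "\<And>k. B k \<in> carrier_mat p m"
    and l: "\<And>j k. so3_tensor_action R S j B k = l j \<cdot>\<^sub>m B k" and nz: "B k0 \<noteq> 0\<^sub>m p m"
  shows "equivariant p m R S B"
proof -
  interpret S: so3_irrep m S by fact
  interpret R: so3_irrep p R by fact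
  have d: "dim_row (B k) = p" "dim_col (B k) = m" for k using c[of k] by auto
  have vec: "R j *\<^sub>v (B k *\<^sub>v v) = B k *\<^sub>v (S j *\<^sub>v v) +
      (levi_civita j k 1 \<cdot>\<^sub>v (B 1 *\<^sub>v v) + levi_civita j k 2 \<cdot>\<^sub>v (B 2 *\<^sub>v v) + levi_civita j k 3 \<cdot>\<^sub>v (B 3 *\<^sub>v v)) + l j \<cdot>\<^sub>v (B k *\<^sub>v v)"
    if v: "v \<in> carrier_vec m" for j k v
  proof (rule eq_vecI)
    fix r assume "r < dim_vec (B k *\<^sub>v (S j *\<^sub>v v) +
      (levi_civita j k 1 \<cdot>\<^sub>v (B 1 *\<^sub>v v) + levi_civita j k 2 \<cdot>\<^sub>v (B 2 *\<^sub>v v) + levi_civita j k 3 \<cdot>\<^sub>v (B 3 *\<^sub>v v)) + l j \<cdot>\<^sub>v (B k *\<^sub>v v))"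
    hence r: "r < p" by (simp add: d)
    have lc: "lincomb3 (\<lambda>i. - levi_civita j k i) B \<in> carrier_mat p m"
      using c by (auto simp: lincomb3_def)
    have mc: "R j * B k - B k * S j \<in> carrier_mat p m"
      using mult_carrier_mat[OF c S.carrier] by (rule minus_carrier_mat)
    have "(so3_tensor_action R S j B k *\<^sub>v v) $ r = (l j \<cdot>\<^sub>m B k *\<^sub>v v) $ r" by (simp only: l)
    thus "(R j *\<^sub>v (B k *\<^sub>v v)) $ r = (B k *\<^sub>v (S j *\<^sub>v v) +
      (levi_civita j k 1 \<cdot>\<^sub>v (B 1 *\<^sub>v v) + levi_civita j k 2 \<cdot>\<^sub>v (B 2 *\<^sub>v v) + levi_civita j k 3 \<cdot>\<^sub>v (B 3 *\<^sub>v v)) + l j \<cdot>\<^sub>v (B k *\<^sub>v v)) $ r"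
      unfolding so3_tensor_action_def smult_mat_vec[OF c v] add_mult_distrib_mat_vec[OF mc lc v] lincomb3_mult_vec[OF c v]
        minus_mult_distrib_mat_vec[OF mult_carrier_mat[OF R.carrier c] mult_carrier_mat[OF c S.carrier] v]
        assoc_mult_mat_vec[OF R.carrier c v] assoc_mult_mat_vec[OF c S.carrier v]
      using r by (simp add: d algebra_simps del: index_mult_mat_vec)
  qed (simp add: d)
  note RR = R.brackets and SS = S.brackets
  have v11: "R 1 *\<^sub>v (B 1 *\<^sub>v u) = B 1 *\<^sub>v (S 1 *\<^sub>v u) + l 1 \<cdot>\<^sub>v (B 1 *\<^sub>v u)" and
     v12: "R 1 *\<^sub>v (B 2 *\<^sub>v u) = B 2 *\<^sub>v (S 1 *\<^sub>v u) + B 3 *\<^sub>v u + l 1 \<cdot>\<^sub>v (B 2 *\<^sub>v u)" and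
     v13: "R 1 *\<^sub>v (B 3 *\<^sub>v u) = B 3 *\<^sub>v (S 1 *\<^sub>v u) + (- 1) \<cdot>\<^sub>v (B 2 *\<^sub>v u) + l 1 \<cdot>\<^sub>v (B 3 *\<^sub>v u)" and
     v21: "R 2 *\<^sub>v (B 1 *\<^sub>v u) = B 1 *\<^sub>v (S 2 *\<^sub>v u) + (- 1) \<cdot>\<^sub>v (B 3 *\<^sub>v u) + l 2 \<cdot>\<^sub>v (B 1 *\<^sub>v u)" and
     v22: "R 2 *\<^sub>v (B 2 *\<^sub>v u) = B 2 *\<^sub>v (S 2 *\<^sub>v u) + l 2 \<cdot>\<^sub>v (B 2 *\<^sub>v u)" and
     v23: "R 2 *\<^sub>v (B 3 *\<^sub>v u) = B 3 *\<^sub>v (S 2 *\<^sub>v u) + B 1 *\<^sub>v u + l 2 \<cdot>\<^sub>v (B 3 *\<^sub>v u)" and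
     v31: "R 3 *\<^sub>v (B 1 *\<^sub>v u) = B 1 *\<^sub>v (S 3 *\<^sub>v u) + B 2 *\<^sub>v u + l 3 \<cdot>\<^sub>v (B 1 *\<^sub>v u)" and
     v32: "R 3 *\<^sub>v (B 2 *\<^sub>v u) = B 2 *\<^sub>v (S 3 *\<^sub>v u) + (- 1) \<cdot>\<^sub>v (B 1 *\<^sub>v u) + l 3 \<cdot>\<^sub>v (B 2 *\<^sub>v u)" and
     v33: "R 3 *\<^sub>v (B 3 *\<^sub>v u) = B 3 *\<^sub>v (S 3 *\<^sub>v u) + l 3 \<cdot>\<^sub>v (B 3 *\<^sub>v u)" 
     if "u \<in> carrier_vec m" for u
    unfolding vec[OF that] by (rule eq_vecI; simp add: levi_civita_def d del: index_mult_mat_vec)+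
  have lz: "l j \<cdot>\<^sub>v (B k *\<^sub>v v) = 0\<^sub>v p" if v: "v \<in> carrier_vec m" for j k v
  proof -
    have jk: "j = 1 \<or> j = 2 \<or> j = 3" "k = 1 \<or> k = 2 \<or> k = 3" by (rule exhaust_3)+
    hence k: "B k \<in> {B 1, B 2, B 3}" "B k \<in> {B 2, B 3, B 1}" "B k \<in> {B 3, B 1, B 2}" by auto
    \<comment> \<open>The lemma is used for (a, b, c) = (1, 2, 3), (2, 3, 1) and (3, 1, 2); the nine
      relations are passed in the order permuted accordingly.\<close>
    note carriers = R.carrier R.carrier R.carrier S.carrier S.carrier S.carrier c c c
    have 3: "l 3 \<cdot>\<^sub>v (B k *\<^sub>v v) = 0\<^sub>v p"
      by (rule character_vanishes[OF carriers RR(3) SS(3) v11 v12 v13 v21 v22 v23 v31 v32 v33 v k(1)])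
    have 1: "l 1 \<cdot>\<^sub>v (B k *\<^sub>v v) = 0\<^sub>v p"
      by (rule character_vanishes[OF carriers RR(1) SS(1) v22 v23 v21 v32 v33 v31 v12 v13 v11 v k(2)])
    have 2: "l 2 \<cdot>\<^sub>v (B k *\<^sub>v v) = 0\<^sub>v p"
      by (rule character_vanishes[OF carriers RR(2) SS(2) v33 v31 v32 v13 v11 v12 v23 v21 v22 v k(3)])
    show ?thesis using jk(1) 1 2 3 by auto
  qed
  have l0: "l j = 0" for j
  proof (rule ccontr)
    assume lj: "l j \<noteq> 0"
    have "B k0 = 0\<^sub>m p m"
    proof (rule eq_matI)
      fix r s assume "r < dim_row (0\<^sub>m p m :: complex mat)" "s < dim_col (0\<^sub>m p m :: complex mat)"
      hence rs: "r < p" "s < m" by auto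
      have "(l j \<cdot>\<^sub>v (B k0 *\<^sub>v unit_vec m s)) $ r = 0" using lz[OF unit_vec_carrier] rs by simp
      thus "B k0 $$ (r, s) = 0\<^sub>m p m $$ (r, s)" using lj rs by (simp add: d)
    qed (simp_all add: d)
    thus False using nz by blast
  qed
  have "R j * B k - B k * S j = lincomb3 (levi_civita j k) B" for j k
  proof (rule eq_matI)
    fix r s assume "r < dim_row (lincomb3 (levi_civita j k) B)" "s < dim_col (lincomb3 (levi_civita j k) B)"
    hence rs: "r < p" "s < m" by (auto simp: lincomb3_def d)
    have "so3_tensor_action R S j B k $$ (r, s) = (l j \<cdot>\<^sub>m B k) $$ (r, s)" by (simp only: l)
    thus "(R j * B k - B k * S j) $$ (r, s) = lincomb3 (levi_civita j k) B $$ (r, s)"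
      using rs unfolding so3_tensor_action_def l0
      by (simp add: lincomb3_def d algebra_simps del: index_mult_mat(1))
  qed (simp_all add: lincomb3_def d)
  thus "equivariant p m R S B" using c by (simp add: equivariant_def)
qed

text \<open>Unit length makes some component nonzero, which is what turns the character into the
  trivial one.\<close>

lemma unit_generator_equivariant:
  assumes irr: "so3_irrep m (\<rho> m)" "so3_irrep (m + 2) (\<rho> (m + 2))" and B: "unit_generator \<rho> m B"
  shows "equivariant (m + 2) m (\<rho> (m + 2)) (\<rho> m) B" "\<exists>k. B k \<noteq> 0\<^sub>m (m + 2) m"
proof -
  show nz: "\<exists>k. B k \<noteq> 0\<^sub>m (m + 2) m"
  proof (rule ccontr)
    assume "\<not> ?thesis"
    hence z: "B k = 0\<^sub>m (m + 2) m" for k by blast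
    have "mat_trace (mat_adjoint (B k) * B k) = 0" for k
      unfolding mat_trace_def z by (intro sum.neutral) (auto simp: scalar_prod_def)
    thus False using B by (simp add: unit_generator_def)
  qed
  then obtain k where k: "B k \<noteq> 0\<^sub>m (m + 2) m" ..
  have c: "B k \<in> carrier_mat (m + 2) m" for k using B by (simp add: unit_generator_def)
  have "\<forall>j. \<exists>l. \<forall>k. so3_tensor_action (\<rho> (m + 2)) (\<rho> m) j B k = l \<cdot>\<^sub>m B k"
    using B unfolding unit_generator_def by blast
  then obtain l where l: "\<forall>j k. so3_tensor_action (\<rho> (m + 2)) (\<rho> m) j B k = l j \<cdot>\<^sub>m B k"
    by (rule choice[THEN exE])
  show "equivariant (m + 2) m (\<rho> (m + 2)) (\<rho> m) B"
    by (rule equivariant_of_character[where B = B and l = l and ?k0.0 = k]) (use irr c l k in simp_all)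
qed

section \<open>Unitary diagonalization\<close>

lemma index_sandwich:
  fixes A B C :: "complex mat"
  assumes "A \<in> carrier_mat n m" "B \<in> carrier_mat m m" "C \<in> carrier_mat n m" "i < n" "j < n"
  shows "(A * B * mat_adjoint C) $$ (i, j) = (\<Sum>c<m. \<Sum>d<m. A $$ (i, c) * B $$ (c, d) * cnj (C $$ (j, d)))"
proof -
  have "(A * B * mat_adjoint C) $$ (i, j) = (\<Sum>d<m. (\<Sum>c<m. A $$ (i, c) * B $$ (c, d)) * cnj (C $$ (j, d)))"
    using assms by (auto simp: scalar_prod_def lessThan_atLeast0)
  also have "\<dots> = (\<Sum>c<m. \<Sum>d<m. A $$ (i, c) * B $$ (c, d) * cnj (C $$ (j, d)))"
    unfolding sum_distrib_right by (rule sum.swap)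
  finally show ?thesis .
qed

lemma index_mult_mat_sum:
  assumes "A \<in> carrier_mat n m" "B \<in> carrier_mat m l" "i < n" "j < l"
  shows "(A * B) $$ (i, j) = (\<Sum>c<m. A $$ (i, c) * B $$ (c, j))"
  using assms by (auto simp: scalar_prod_def lessThan_atLeast0)

lemma index_mult_adjoint:
  fixes A B :: "complex mat"
  assumes "A \<in> carrier_mat n m" "B \<in> carrier_mat l m" "i < n" "j < l"
  shows "(A * mat_adjoint B) $$ (i, j) = (\<Sum>c<m. A $$ (i, c) * cnj (B $$ (j, c)))"
  using assms by (subst index_mult_mat_sum[where m = m]) auto

lemma mat_adjoint_mult:
  fixes A B :: "complex mat"
  assumes "A \<in> carrier_mat n m" "B \<in> carrier_mat m l"
  shows "mat_adjoint (A * B) = mat_adjoint B * mat_adjoint A"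
proof (rule eq_matI)
  fix i j assume "i < dim_row (mat_adjoint B * mat_adjoint A)" "j < dim_col (mat_adjoint B * mat_adjoint A)"
  hence ij: "i < l" "j < n" using assms by auto
  hence "mat_adjoint (A * B) $$ (i, j) = cnj ((A * B) $$ (j, i))" using assms by (subst index_mat_adjoint) auto
  also have "\<dots> = (mat_adjoint B * mat_adjoint A) $$ (i, j)"
    using assms ij by (subst index_mult_adjoint[where m = m]) (auto simp: scalar_prod_def lessThan_atLeast0 mult_ac)
  finally show "mat_adjoint (A * B) $$ (i, j) = (mat_adjoint B * mat_adjoint A) $$ (i, j)" .
qed (use assms in auto)

lemma mat_adjoint_adjoint [simp]:
  "mat_adjoint (mat_adjoint A) = (A :: complex mat)"
  by (rule eq_matI) auto

lemma unitary_groupI: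
  assumes "U \<in> carrier_mat n n" "U * mat_adjoint U = 1\<^sub>m n"
  shows "U \<in> unitary_group n"
  using assms mat_mult_left_right_inverse[OF assms(1) mat_adjoint_carrier[OF assms(1)] assms(2)]
  by (simp add: unitary_group_def)

lemma unitary_group_mult:
  assumes "U \<in> unitary_group n" "V \<in> unitary_group n"
  shows "U * V \<in> unitary_group n"
proof (rule unitary_groupI)
  have c: "U \<in> carrier_mat n n" "V \<in> carrier_mat n n" using assms by (auto simp: unitary_group_def)
  have ac: "mat_adjoint U \<in> carrier_mat n n" "mat_adjoint V \<in> carrier_mat n n" using c by auto
  show "U * V \<in> carrier_mat n n" using c by simp
  have "U * V * mat_adjoint (U * V) = U * (V * mat_adjoint V) * mat_adjoint U"
    unfolding mat_adjoint_mult[OF c] using c ac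
    by (simp add: assoc_mult_mat[of _ n n _ n _ n] mult_carrier_mat[of _ n n _ n])
  also have "\<dots> = 1\<^sub>m n" using assms c by (simp add: unitary_group_def)
  finally show "U * V * mat_adjoint (U * V) = 1\<^sub>m n" .
qed

lemma mat_adjoint_unitary:
  "U \<in> unitary_group n \<Longrightarrow> mat_adjoint U \<in> unitary_group n"
  by (auto simp: unitary_group_def)

text \<open>Q is the reflection in the hyperplane orthogonal to w = v - e_0. In the complex case it
  carries v to e_0 only if the inner product of the two unit vectors is real, hence the condition on
  the entry at 0.\<close>

lemma householder:
  fixes v :: "complex Matrix.vec"
  assumes v: "v \<in> carrier_vec (Suc n)" and unit: "(\<Sum>i<Suc n. v $ i * cnj (v $ i)) = 1" and real: "cnj (v $ 0) = v $ 0"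
  obtains Q where "Q \<in> unitary_group (Suc n)" "mat_adjoint Q = Q" "Q *\<^sub>v v = unit_vec (Suc n) 0"
proof
  define w where "w i = v $ i - (if i = 0 then 1 else 0)" for i
  define s where "s = (\<Sum>i<Suc n. w i * cnj (w i))"
  \<comment> \<open>If \<open>v\<close> is already the unit vector, then \<open>s = 0\<close>, hence \<open>b = 0\<close> and \<open>Q = 1\<close>.\<close>
  define b where "b = 2 / s"
  define Q where "Q = mat (Suc n) (Suc n) (\<lambda>(i, j). (if i = j then 1 else 0) - b * w i * cnj (w j))"
  have s_real: "cnj s = s" by (simp add: s_def mult_ac del: sum.lessThan_Suc)
  hence b_real: "cnj b = b" by (simp add: b_def)
  have Qc: "Q \<in> carrier_mat (Suc n) (Suc n)" by (simp add: Q_def)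
  show ad: "mat_adjoint Q = Q"
    by (rule eq_matI) (auto simp: Q_def b_real mult_ac)
  have bs: "b * b * s = 2 * b" by (simp add: b_def)
  have "Q * Q = 1\<^sub>m (Suc n)"
  proof (rule eq_matI)
    fix i j assume "i < dim_row (1\<^sub>m (Suc n) :: complex mat)" "j < dim_col (1\<^sub>m (Suc n) :: complex mat)"
    hence ij: "i < Suc n" "j < Suc n" by auto
    have "(Q * Q) $$ (i, j) = (\<Sum>k<Suc n. ((if i = k then 1 else 0) - b * w i * cnj (w k)) * ((if k = j then 1 else 0) - b * w k * cnj (w j)))"
      using ij by (subst index_mult_mat_sum[OF Qc Qc ij]) (auto simp: Q_def intro!: sum.cong simp del: sum.lessThan_Suc)
    also have "\<dots> = (\<Sum>k<Suc n. (if i = k then (if k = j then 1 else 0) - b * w k * cnj (w j) else 0)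
        - (if k = j then b * w i * cnj (w k) else 0) + (b * b * w i * cnj (w j)) * (w k * cnj (w k)))"
      by (intro sum.cong) (auto simp: algebra_simps)
    also have "\<dots> = ((if i = j then 1 else 0) - b * w i * cnj (w j)) - b * w i * cnj (w j) + b * b * w i * cnj (w j) * s"
      using ij by (simp add: sum.distrib sum_subtractf sum_distrib_left s_def del: sum.lessThan_Suc)
    also have "\<dots> = (if i = j then 1 else 0) - 2 * b * w i * cnj (w j) + (b * b * s) * (w i * cnj (w j))"
      by (simp add: algebra_simps)
    also have "\<dots> = (if i = j then 1 else 0)" unfolding bs by (simp add: algebra_simps)
    finally show "(Q * Q) $$ (i, j) = 1\<^sub>m (Suc n) $$ (i, j)" using ij by simp
  qed (use Qc in auto)
  thus "Q \<in> unitary_group (Suc n)" using Qc ad by (intro unitary_groupI) auto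
  have wv: "(\<Sum>j<Suc n. cnj (w j) * v $ j) = 1 - v $ 0"
  proof -
    have "(\<Sum>j<Suc n. cnj (w j) * v $ j) = (\<Sum>j<Suc n. v $ j * cnj (v $ j) - (if j = 0 then v $ 0 else 0))"
      by (intro sum.cong) (auto simp: w_def algebra_simps)
    thus ?thesis using unit by (simp add: sum_subtractf del: sum.lessThan_Suc)
  qed
  have "s = (\<Sum>j<Suc n. v $ j * cnj (v $ j) - (if j = 0 then v $ 0 + cnj (v $ 0) - 1 else 0))"
    unfolding s_def by (intro sum.cong) (auto simp: w_def algebra_simps)
  \<comment> \<open>The squared length of w is twice the pairing of w with v, so that b times that
    pairing is 1. This is where reality of the entry at 0 is used.\<close>
  hence s: "s = 2 * (1 - v $ 0)" using unit real by (simp add: sum_subtractf del: sum.lessThan_Suc)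
  show "Q *\<^sub>v v = unit_vec (Suc n) 0"
  proof (rule eq_vecI)
    fix i assume "i < dim_vec (unit_vec (Suc n) 0 :: complex Matrix.vec)"
    hence i: "i < Suc n" by simp
    have "(Q *\<^sub>v v) $ i = (\<Sum>j<Suc n. ((if i = j then 1 else 0) - b * w i * cnj (w j)) * v $ j)"
      unfolding index_mult_mat_vec_sum[OF Qc v i] using i by (intro sum.cong) (auto simp: Q_def)
    also have "\<dots> = (\<Sum>j<Suc n. (if i = j then v $ j else 0) - b * w i * (cnj (w j) * v $ j))"
      by (intro sum.cong) (auto simp: algebra_simps)
    also have "\<dots> = v $ i - b * w i * (1 - v $ 0)"
      unfolding sum_subtractf sum_distrib_left[symmetric] wv using i by (simp del: sum.lessThan_Suc)
    also have "\<dots> = v $ i - w i"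
    proof (cases "s = 0")
      case True
      have "(\<Sum>i<Suc n. (cmod (w i))\<^sup>2) = 0"
        using True unfolding s_def complex_norm_square[symmetric] of_real_sum[symmetric] by (simp only: of_real_eq_0_iff)
      hence "\<forall>i<Suc n. w i = 0" by (subst (asm) sum_nonneg_eq_0_iff) auto
      thus ?thesis using i by simp
    next
      case False
      hence "1 - v $ 0 \<noteq> 0" using s by auto
      hence "b * (1 - v $ 0) = 1" unfolding b_def s by simp
      moreover have "b * w i * (1 - v $ 0) = b * (1 - v $ 0) * w i" by (simp only: mult_ac)
      ultimately show ?thesis by simp
    qed
    also have "\<dots> = unit_vec (Suc n) 0 $ i" using i by (simp add: w_def)
    finally show "(Q *\<^sub>v v) $ i = unit_vec (Suc n) 0 $ i" .
  qed (use Qc in simp)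
qed

text \<open>An eigenvector may be scaled freely: the norm makes it a unit vector, and the phase c
  makes its first entry real, as \<open>householder\<close> demands.\<close>

lemma normalized_eigenvector:
  fixes A :: "complex mat"
  assumes A: "A \<in> carrier_mat (Suc n) (Suc n)"
  obtains v :: "complex Matrix.vec" and a where "v \<in> carrier_vec (Suc n)" "A *\<^sub>v v = a \<cdot>\<^sub>v v"
    "(\<Sum>i<Suc n. v $ i * cnj (v $ i)) = 1" "cnj (v $ 0) = v $ 0"
proof -
  obtain a where "a \<in> spectrum A" using spectrum_non_empty[OF A] by blast
  then obtain u where u: "u \<in> carrier_vec (Suc n)" "u \<noteq> 0\<^sub>v (Suc n)" "A *\<^sub>v u = a \<cdot>\<^sub>v u"
    using A by (auto simp: spectrum_def eigenvalue_def eigenvector_def)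
  define N where "N = (\<Sum>i<Suc n. (cmod (u $ i))\<^sup>2)"
  have iu: "inner_vec u u = complex_of_real N" using u(1) by (simp add: inner_vec_self N_def del: sum.lessThan_Suc)
  hence "N \<noteq> 0" using inner_vec_self_eq_0[OF u(1)] u(2) by auto
  moreover have "N \<ge> 0" unfolding N_def by (intro sum_nonneg) auto
  ultimately have N: "N > 0" by simp
  define c where "c = (if u $ 0 = 0 then 1 else cnj (u $ 0) / complex_of_real (cmod (u $ 0)))"
  have "cmod c = 1" by (auto simp: c_def norm_divide)
  hence cc: "c * cnj c = 1" by (simp add: complex_norm_square[symmetric])
  have cu: "cnj (c * u $ 0) = c * u $ 0" by (auto simp: c_def)
  define z where "z = c / complex_of_real (sqrt N)"
  have zz: "z * cnj z = 1 / complex_of_real N"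
    using cc N by (simp add: z_def flip: of_real_mult)
  show ?thesis
  proof
    show "z \<cdot>\<^sub>v u \<in> carrier_vec (Suc n)" using u by simp
    show "A *\<^sub>v (z \<cdot>\<^sub>v u) = a \<cdot>\<^sub>v (z \<cdot>\<^sub>v u)"
      using mult_mat_vec[OF A u(1)] u(3) by (simp add: smult_smult_assoc mult.commute)
    have "(\<Sum>i<Suc n. (z \<cdot>\<^sub>v u) $ i * cnj ((z \<cdot>\<^sub>v u) $ i)) = (z * cnj z) * inner_vec u u"
      unfolding inner_vec_conv[OF u(1,1)] sum_distrib_left using u(1) by (intro sum.cong) (auto simp: mult_ac)
    also have "\<dots> = 1" using N by (simp add: zz iu)
    finally show "(\<Sum>i<Suc n. (z \<cdot>\<^sub>v u) $ i * cnj ((z \<cdot>\<^sub>v u) $ i)) = 1" .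
    show "cnj ((z \<cdot>\<^sub>v u) $ 0) = (z \<cdot>\<^sub>v u) $ 0" using cu u(1) by (simp add: z_def)
  qed
qed

text \<open>Deflation: a reflection moves an eigenvector to e_0, which clears the first column below
  the diagonal and, by hermiticity, the first row. The remaining corner is hermitian and is handled
  by induction.\<close>

theorem hermitian_diagonalization:
  fixes A :: "complex mat"
  assumes "A \<in> carrier_mat n n" "mat_adjoint A = A"
  shows "\<exists>U\<in>unitary_group n. \<forall>i<n. \<forall>j<n. i \<noteq> j \<longrightarrow> (U * A * mat_adjoint U) $$ (i, j) = 0"
  using assms
proof (induction n arbitrary: A)
  case 0
  have "(1\<^sub>m 0 :: complex mat) \<in> unitary_group 0" by (intro unitary_groupI) auto
  thus ?case by auto
next
  case (Suc n)
  note A = Suc.prems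
  obtain v :: "complex Matrix.vec" and a where v: "v \<in> carrier_vec (Suc n)" "A *\<^sub>v v = a \<cdot>\<^sub>v v"
    "(\<Sum>i<Suc n. v $ i * cnj (v $ i)) = 1" "cnj (v $ 0) = v $ 0"
    using normalized_eigenvector[OF A(1)] by blast
  obtain Q where Q: "Q \<in> unitary_group (Suc n)" "mat_adjoint Q = Q" "Q *\<^sub>v v = unit_vec (Suc n) 0"
    using householder[OF v(1,3,4)] by blast
  have Qc: "Q \<in> carrier_mat (Suc n) (Suc n)" and QQ: "Q * Q = 1\<^sub>m (Suc n)"
    using Q by (auto simp: unitary_group_def)
  define D where "D = Q * A * Q"
  have Dc: "D \<in> carrier_mat (Suc n) (Suc n)" using Qc A by (simp add: D_def)
  have "mat_adjoint D = mat_adjoint Q * mat_adjoint (Q * A)"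
    unfolding D_def by (rule mat_adjoint_mult[of _ "Suc n" "Suc n" _ "Suc n"]) (use Qc A in auto)
  also have "\<dots> = Q * (A * Q)" unfolding mat_adjoint_mult[OF Qc A(1)] by (simp only: Q(2) A(2))
  also have "\<dots> = D" unfolding D_def by (rule assoc_mult_mat[OF Qc A(1) Qc, symmetric])
  finally have Dad: "mat_adjoint D = D" .
  have De: "D *\<^sub>v unit_vec (Suc n) 0 = a \<cdot>\<^sub>v unit_vec (Suc n) 0"
  proof -
    have "Q *\<^sub>v unit_vec (Suc n) 0 = (Q * Q) *\<^sub>v v"
      unfolding assoc_mult_mat_vec[OF Qc Qc v(1)] Q(3) ..
    hence Qe: "Q *\<^sub>v unit_vec (Suc n) 0 = v" using v(1) by (simp add: QQ)
    have "D *\<^sub>v unit_vec (Suc n) 0 = Q *\<^sub>v (A *\<^sub>v (Q *\<^sub>v unit_vec (Suc n) 0))"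
      unfolding D_def assoc_mult_mat_vec[OF mult_carrier_mat[OF Qc A(1)] Qc unit_vec_carrier]
      by (rule assoc_mult_mat_vec[OF Qc A(1)]) (simp add: Qe v(1))
    thus ?thesis unfolding Qe v(2) mult_mat_vec[OF Qc v(1)] Q(3) .
  qed
  have D0: "D $$ (i, 0) = 0" "D $$ (0, i) = 0" if i: "i < Suc n" "i \<noteq> 0" for i
  proof -
    have "(D *\<^sub>v unit_vec (Suc n) 0) $ i = 0" unfolding De using i by simp
    thus 1: "D $$ (i, 0) = 0" using i Dc by simp
    have "D $$ (0, i) = mat_adjoint D $$ (0, i)" by (simp only: Dad)
    also have "\<dots> = cnj (D $$ (i, 0))" using i Dc by (intro index_mat_adjoint) auto
    finally show "D $$ (0, i) = 0" using 1 by simp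
  qed
  define E where "E = mat n n (\<lambda>(i, j). D $$ (Suc i, Suc j))"
  have "cnj (D $$ (j, i)) = D $$ (i, j)" if "i < Suc n" "j < Suc n" for i j
  proof -
    have "cnj (D $$ (j, i)) = mat_adjoint D $$ (i, j)" using that Dc by (intro index_mat_adjoint[symmetric]) auto
    thus ?thesis by (simp only: Dad)
  qed
  hence "mat_adjoint E = E" by (intro eq_matI) (auto simp: E_def)
  then obtain V where V: "V \<in> unitary_group n" "\<forall>i<n. \<forall>j<n. i \<noteq> j \<longrightarrow> (V * E * mat_adjoint V) $$ (i, j) = 0"
    using Suc.IH[of E] by (auto simp: E_def)
  have Vc: "V \<in> carrier_mat n n" and VV: "V * mat_adjoint V = 1\<^sub>m n" using V by (auto simp: unitary_group_def)
  define W where "W = mat (Suc n) (Suc n) (\<lambda>(i, j). if i = 0 \<or> j = 0 then (if i = j then 1 else 0) else V $$ (i - 1, j - 1))"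
  have Wc: "W \<in> carrier_mat (Suc n) (Suc n)" by (simp add: W_def)
  have "W * mat_adjoint W = 1\<^sub>m (Suc n)"
  proof (rule eq_matI)
    fix i j assume "i < dim_row (1\<^sub>m (Suc n) :: complex mat)" "j < dim_col (1\<^sub>m (Suc n) :: complex mat)"
    hence ij: "i < Suc n" "j < Suc n" by auto
    have s: "(\<Sum>c<n. V $$ (i, c) * cnj (V $$ (j, c))) = (if i = j then 1 else 0)" if "i < n" "j < n" for i j
    proof -
      have "(V * mat_adjoint V) $$ (i, j) = 1\<^sub>m n $$ (i, j)" by (simp only: VV)
      thus ?thesis using index_mult_adjoint[OF Vc Vc that] that by simp
    qed
    show "(W * mat_adjoint W) $$ (i, j) = 1\<^sub>m (Suc n) $$ (i, j)"
      unfolding index_mult_adjoint[OF Wc Wc ij] sum.lessThan_Suc_shift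
      using ij by (cases i; cases j) (auto simp: W_def s)
  qed (use Wc in auto)
  hence W: "W \<in> unitary_group (Suc n)" by (rule unitary_groupI[OF Wc])
  have WD: "(W * D * mat_adjoint W) $$ (i, j) = 0" if ij: "i < Suc n" "j < Suc n" "i \<noteq> j" for i j
  proof -
    have s: "(\<Sum>c<n. \<Sum>d<n. V $$ (i, c) * D $$ (Suc c, Suc d) * cnj (V $$ (j, d))) = 0" if "i < n" "j < n" "i \<noteq> j" for i j
    proof -
      have "(V * E * mat_adjoint V) $$ (i, j) = 0" using V that by blast
      moreover have "E \<in> carrier_mat n n" by (simp add: E_def)
      ultimately show ?thesis using index_sandwich[OF Vc _ Vc that(1,2), of E] by (simp add: E_def)
    qed
    show ?thesis
      unfolding index_sandwich[OF Wc Dc Wc ij(1,2)] sum.lessThan_Suc_shift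
      using ij by (cases i; cases j) (auto simp: W_def s D0)
  qed
  have WQ: "W * Q \<in> unitary_group (Suc n)" by (rule unitary_group_mult[OF W Q(1)])
  have "W * Q * A * mat_adjoint (W * Q) = W * D * mat_adjoint W"
    unfolding mat_adjoint_mult[OF Wc Qc] Q(2) D_def using Wc Qc A mat_adjoint_carrier[OF Wc]
    by (simp add: assoc_mult_mat[of _ "Suc n" "Suc n" _ "Suc n" _ "Suc n"] mult_carrier_mat[of _ "Suc n" "Suc n" _ "Suc n"])
  hence "\<forall>i<Suc n. \<forall>j<Suc n. i \<noteq> j \<longrightarrow> (W * Q * A * mat_adjoint (W * Q)) $$ (i, j) = 0" using WD by simp
  thus ?case using WQ by blast
qed

text \<open>Diagonalizing fibre by fibre of \<open>f\<close> avoids any reordering of the indices.\<close>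

lemma blockwise_diagonalization:
  fixes D :: "nat \<Rightarrow> nat \<Rightarrow> complex" and f :: "nat \<Rightarrow> nat"
  assumes D: "\<And>a b. a < k \<Longrightarrow> b < k \<Longrightarrow> f a = f b \<Longrightarrow> D a b = cnj (D b a)"
  shows "\<exists>W. (\<forall>a b. f a \<noteq> f b \<longrightarrow> W a b = 0) \<and>
    (\<forall>a<k. \<forall>b<k. (\<Sum>c<k. W a c * cnj (W b c)) = (if a = b then 1 else 0)) \<and>
    (\<forall>a<k. \<forall>b<k. a \<noteq> b \<longrightarrow> f a = f b \<longrightarrow> (\<Sum>c<k. \<Sum>d<k. W a c * D c d * cnj (W b d)) = 0)"
proof -
  \<comment> \<open>An index set A is transported to an initial segment by an enumeration h with
    inverse g, so that the matrix theorem applies; V is the resulting unitary read back on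
    A.\<close>
  have fib: "\<exists>V. (\<forall>a\<in>A. \<forall>b\<in>A. (\<Sum>c\<in>A. V a c * cnj (V b c)) = (if a = b then 1 else 0)) \<and>
      (\<forall>a\<in>A. \<forall>b\<in>A. a \<noteq> b \<longrightarrow> (\<Sum>c\<in>A. \<Sum>d\<in>A. V a c * D c d * cnj (V b d)) = 0)"
    if A: "finite A" "\<And>a b. a \<in> A \<Longrightarrow> b \<in> A \<Longrightarrow> D a b = cnj (D b a)" for A
  proof -
    define n where "n = card A"
    obtain h where h: "bij_betw h {..<n} A"
      using ex_bij_betw_nat_finite[OF A(1)] unfolding n_def lessThan_atLeast0 by blast
    define g where "g = inv_into {..<n} h"
    have g: "bij_betw g A {..<n}" unfolding g_def by (rule bij_betw_inv_into[OF h])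
    have hg: "h (g a) = a" if "a \<in> A" for a
      unfolding g_def by (rule bij_betw_inv_into_right[OF h that])
    have gh: "g (h i) = i" if "i < n" for i
      unfolding g_def by (rule bij_betw_inv_into_left[OF h]) (simp add: that)
    have gA: "g a < n" if "a \<in> A" for a using bij_betwE[OF g] that by simp
    have hA: "h i \<in> A" if "i < n" for i using bij_betwE[OF h] that by simp
    define M where "M = mat n n (\<lambda>(i, j). D (h i) (h j))"
    have Mc: "M \<in> carrier_mat n n" by (simp add: M_def)
    have "mat_adjoint M = M"
      by (rule eq_matI) (simp_all add: M_def A(2)[OF hA hA, symmetric])
    from hermitian_diagonalization[OF Mc this]
    obtain U where U: "U \<in> unitary_group n" "\<forall>i<n. \<forall>j<n. i \<noteq> j \<longrightarrow> (U * M * mat_adjoint U) $$ (i, j) = 0"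
      by (elim bexE)
    have Uc: "U \<in> carrier_mat n n" and UU: "U * mat_adjoint U = 1\<^sub>m n" using U by (auto simp: unitary_group_def)
    define V where "V a b = U $$ (g a, g b)" for a b
    have 1: "(\<Sum>c\<in>A. V a c * cnj (V b c)) = (if a = b then 1 else 0)" if ab: "a \<in> A" "b \<in> A" for a b
    proof -
      have "(\<Sum>c\<in>A. V a c * cnj (V b c)) = (\<Sum>i<n. U $$ (g a, i) * cnj (U $$ (g b, i)))"
        unfolding V_def by (rule sum.reindex_bij_betw[OF g])
      also have "\<dots> = (U * mat_adjoint U) $$ (g a, g b)" using ab gA by (simp only: index_mult_adjoint[OF Uc Uc])
      finally have "(\<Sum>c\<in>A. V a c * cnj (V b c)) = (U * mat_adjoint U) $$ (g a, g b)" .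
      moreover have "g a = g b \<longleftrightarrow> a = b" using hg[OF ab(1)] hg[OF ab(2)] by metis
      hence "(U * mat_adjoint U) $$ (g a, g b) = (if a = b then 1 else 0)" unfolding UU using ab gA by simp
      ultimately show ?thesis by simp
    qed
    have 2: "(\<Sum>c\<in>A. \<Sum>d\<in>A. V a c * D c d * cnj (V b d)) = 0" if ab: "a \<in> A" "b \<in> A" "a \<noteq> b" for a b
    proof -
      have "(\<Sum>c\<in>A. \<Sum>d\<in>A. V a c * D c d * cnj (V b d)) =
          (\<Sum>i<n. \<Sum>j<n. V a (h i) * D (h i) (h j) * cnj (V b (h j)))"
        unfolding sum.reindex_bij_betw[OF h, of "\<lambda>c. \<Sum>j<n. V a c * D c (h j) * cnj (V b (h j))"]
        by (rule sum.cong[OF refl]) (rule sum.reindex_bij_betw[OF h, symmetric])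
      also have "\<dots> = (\<Sum>i<n. \<Sum>j<n. U $$ (g a, i) * M $$ (i, j) * cnj (U $$ (g b, j)))"
        by (intro sum.cong) (auto simp: V_def M_def gh)
      also have "\<dots> = (U * M * mat_adjoint U) $$ (g a, g b)"
        using ab gA by (simp only: index_sandwich[OF Uc Mc Uc])
      also have "\<dots> = 0"
      proof -
        have "g a \<noteq> g b" using hg[OF ab(1)] hg[OF ab(2)] ab(3) by metis
        thus ?thesis using U(2) gA ab by simp
      qed
      finally show ?thesis .
    qed
    show ?thesis by (intro exI[of _ V] conjI ballI impI) (rule 1 2; assumption)+
  qed
  define A where "A m = {a. a < k \<and> f a = m}" for m
  define P where "P m V \<longleftrightarrow> (\<forall>a\<in>A m. \<forall>b\<in>A m. (\<Sum>c\<in>A m. V a c * cnj (V b c)) = (if a = b then 1 else 0)) \<and>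
      (\<forall>a\<in>A m. \<forall>b\<in>A m. a \<noteq> b \<longrightarrow> (\<Sum>c\<in>A m. \<Sum>d\<in>A m. V a c * D c d * cnj (V b d)) = 0)"
    for m and V :: "nat \<Rightarrow> nat \<Rightarrow> complex"
  have "\<exists>V. P m V" for m
    unfolding P_def
  proof (rule fib)
    show "finite (A m)" by (simp add: A_def)
    show "D a b = cnj (D b a)" if "a \<in> A m" "b \<in> A m" for a b
      by (rule D) (use that in \<open>simp_all add: A_def\<close>)
  qed
  hence "\<forall>m. \<exists>V. P m V" ..
  then obtain V where V: "\<forall>m. P m (V m)" by (rule choice[THEN exE])
  \<comment> \<open>The unitaries of the fibres, put together with zero between different fibres.
    Every sum over all indices then collapses to one fibre.\<close>
  define W where "W a b = (if f a = f b then V (f a) a b else 0)" for a b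
  have restr: "(\<Sum>c<k. F c) = (\<Sum>c\<in>A m. F c)" if "\<And>c. f c \<noteq> m \<Longrightarrow> F c = 0" for F :: "nat \<Rightarrow> complex" and m
    by (rule sum.mono_neutral_right) (auto simp: A_def that)
  show ?thesis
  proof (intro exI[of _ W] conjI allI impI)
    show "W a b = 0" if "f a \<noteq> f b" for a b using that by (simp add: W_def)
    show "(\<Sum>c<k. W a c * cnj (W b c)) = (if a = b then 1 else 0)" if ab: "a < k" "b < k" for a b
    proof (cases "f a = f b")
      case True
      have "(\<Sum>c<k. W a c * cnj (W b c)) = (\<Sum>c\<in>A (f a). W a c * cnj (W b c))"
        by (rule restr) (auto simp: W_def)
      also have "\<dots> = (\<Sum>c\<in>A (f a). V (f a) a c * cnj (V (f a) b c))"
        by (intro sum.cong) (auto simp: W_def A_def True)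
      also have "\<dots> = (if a = b then 1 else 0)" using V[rule_format, of "f a"] ab True unfolding P_def A_def by simp
      finally show ?thesis .
    next
      case False
      hence "(\<Sum>c<k. W a c * cnj (W b c)) = 0" by (intro sum.neutral) (auto simp: W_def)
      thus ?thesis using False by auto
    qed
    show "(\<Sum>c<k. \<Sum>d<k. W a c * D c d * cnj (W b d)) = 0" if ab: "a < k" "b < k" "a \<noteq> b" "f a = f b" for a b
    proof -
      have "(\<Sum>c<k. \<Sum>d<k. W a c * D c d * cnj (W b d)) = (\<Sum>c<k. \<Sum>d\<in>A (f a). W a c * D c d * cnj (W b d))"
        by (rule sum.cong[OF refl], rule restr) (auto simp: W_def ab)
      also have "\<dots> = (\<Sum>c\<in>A (f a). \<Sum>d\<in>A (f a). W a c * D c d * cnj (W b d))"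
        by (rule restr) (auto simp: W_def)
      also have "\<dots> = (\<Sum>c\<in>A (f a). \<Sum>d\<in>A (f a). V (f a) a c * D c d * cnj (V (f a) b d))"
        by (intro sum.cong) (auto simp: W_def A_def ab)
      also have "\<dots> = 0" using V[rule_format, of "f a"] ab unfolding P_def A_def by simp
      finally show ?thesis .
    qed
  qed
qed

section \<open>Block matrices and gauge transformations\<close>

abbreviation offset :: "nat list \<Rightarrow> nat \<Rightarrow> nat" where
  "offset ns a \<equiv> sum_list (take a ns)"

lemma offset_less:
  "a < length ns \<Longrightarrow> r < ns ! a \<Longrightarrow> offset ns a + r < sum_list ns"
proof (induction ns arbitrary: a)
  case (Cons x xs)
  thus ?case by (cases a) auto
qed simp

lemma offset_ex:
  "q < sum_list ns \<Longrightarrow> \<exists>a r. a < length ns \<and> r < ns ! a \<and> q = offset ns a + r"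
proof (induction ns arbitrary: q)
  case (Cons x xs)
  show ?case
  proof (cases "q < x")
    case True
    thus ?thesis by (intro exI[of _ 0] exI[of _ q]) simp
  next
    case False
    hence "q - x < sum_list xs" using Cons.prems by auto
    from Cons.IH[OF this] obtain a r where "a < length xs" "r < xs ! a" "q - x = offset xs a + r" by blast
    thus ?thesis using False by (intro exI[of _ "Suc a"] exI[of _ r]) simp
  qed
qed simp

lemma offset_inj:
  "a < length ns \<Longrightarrow> b < length ns \<Longrightarrow> r < ns ! a \<Longrightarrow> s < ns ! b \<Longrightarrow>
    offset ns a + r = offset ns b + s \<longleftrightarrow> a = b \<and> r = s"
proof (induction ns arbitrary: a b)
  case (Cons x xs)
  thus ?case by (cases a; cases b) auto
qed simp

lemma sum_lessThan_add:
  fixes f :: "nat \<Rightarrow> 'a :: comm_monoid_add"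
  shows "(\<Sum>q<x + y. f q) = (\<Sum>q<x. f q) + (\<Sum>q<y. f (x + q))"
  by (induction y) (simp_all add: add.assoc)

lemma sum_blocks:
  fixes f :: "nat \<Rightarrow> 'a :: comm_monoid_add"
  shows "(\<Sum>q<sum_list ns. f q) = (\<Sum>a<length ns. \<Sum>r<ns ! a. f (offset ns a + r))"
proof (induction ns arbitrary: f)
  case (Cons x xs)
  have "(\<Sum>q<sum_list (x # xs). f q) = (\<Sum>q<x. f q) + (\<Sum>q<sum_list xs. f (x + q))"
    by (simp add: sum_lessThan_add)
  thus ?case unfolding Cons.IH by (simp add: sum.lessThan_Suc_shift add.assoc del: sum.lessThan_Suc)
qed simp

lemma diag_block_mat_carrier:
  assumes "\<And>m. m \<in> set ns \<Longrightarrow> F m \<in> carrier_mat m m"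
  shows "diag_block_mat (map F ns) \<in> carrier_mat (sum_list ns) (sum_list ns)"
proof -
  have "map (dim_row \<circ> F) ns = ns" "map (dim_col \<circ> F) ns = ns"
    by (auto intro!: map_idI carrier_matD(1)[OF assms] carrier_matD(2)[OF assms])
  thus ?thesis by (intro carrier_matI) (simp_all add: dim_diag_block_mat)
qed

lemma index_diag_block_mat:
  assumes "\<And>m. m \<in> set ns \<Longrightarrow> F m \<in> carrier_mat m m"
    and "a < length ns" "b < length ns" "r < ns ! a" "s < ns ! b"
  shows "diag_block_mat (map F ns) $$ (offset ns a + r, offset ns b + s) = (if a = b then F (ns ! a) $$ (r, s) else 0)"
  using assms
proof (induction ns arbitrary: a b)
  case (Cons x xs)
  have B: "diag_block_mat (map F xs) \<in> carrier_mat (sum_list xs) (sum_list xs)"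
    using Cons.prems(1) by (intro diag_block_mat_carrier) auto
  have A: "F x \<in> carrier_mat x x" using Cons.prems(1) by simp
  have AB: "dim_row (F x) = x" "dim_col (F x) = x"
    "dim_row (diag_block_mat (map F xs)) = sum_list xs" "dim_col (diag_block_mat (map F xs)) = sum_list xs"
    using A B by auto
  show ?case
  proof (cases a)
    case 0
    show ?thesis
    proof (cases b)
      case (Suc b')
      hence "offset xs b' + s < sum_list xs" using Cons.prems by (intro offset_less) auto
      thus ?thesis using Cons.prems 0 Suc by (simp add: Let_def AB)
    qed (use Cons.prems 0 in \<open>simp add: Let_def AB\<close>)
  next
    case (Suc a')
    note a = Suc
    have oa: "offset xs a' + r < sum_list xs" using Cons.prems a by (intro offset_less) auto
    show ?thesis
    proof (cases b)
      case (Suc b')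
      have "offset xs b' + s < sum_list xs" using Cons.prems Suc by (intro offset_less) auto
      moreover have "diag_block_mat (map F xs) $$ (offset xs a' + r, offset xs b' + s) = (if a' = b' then F (xs ! a') $$ (r, s) else 0)"
        using Cons.prems a Suc by (intro Cons.IH) auto
      ultimately show ?thesis using oa a Suc by (simp add: Let_def AB)
    qed (use Cons.prems a oa in \<open>simp add: Let_def AB\<close>)
  qed
qed simp

lemma mat_eq_blockI:
  assumes "X \<in> carrier_mat (sum_list ns) (sum_list ns)" "Y \<in> carrier_mat (sum_list ns) (sum_list ns)"
    and "\<And>a b r s. a < length ns \<Longrightarrow> b < length ns \<Longrightarrow> r < ns ! a \<Longrightarrow> s < ns ! b \<Longrightarrow>
      X $$ (offset ns a + r, offset ns b + s) = Y $$ (offset ns a + r, offset ns b + s)"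
  shows "X = Y"
proof (rule eq_matI)
  fix i j assume "i < dim_row Y" "j < dim_col Y"
  hence "i < sum_list ns" "j < sum_list ns" using assms(2) by auto
  then obtain a r b s where "a < length ns" "r < ns ! a" "i = offset ns a + r"
    "b < length ns" "s < ns ! b" "j = offset ns b + s" using offset_ex by metis
  thus "X $$ (i, j) = Y $$ (i, j)" using assms(3) by simp
qed (use assms in auto)

text \<open>\<open>dec\<close> inverts the map from a pair (a, r) to the index
  \<open>offset ns a + r\<close>; it is chosen by \<open>offset_ex\<close> and determined by
  \<open>offset_inj\<close>.\<close>

lemma block_mat_ex:
  fixes F :: "nat \<Rightarrow> nat \<Rightarrow> nat \<Rightarrow> nat \<Rightarrow> complex"
  obtains X where "X \<in> carrier_mat (sum_list ns) (sum_list ns)"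
    "\<And>a b r s. a < length ns \<Longrightarrow> b < length ns \<Longrightarrow> r < ns ! a \<Longrightarrow> s < ns ! b \<Longrightarrow>
      X $$ (offset ns a + r, offset ns b + s) = F a b r s"
proof -
  have "\<forall>q. \<exists>ar. q < sum_list ns \<longrightarrow> fst ar < length ns \<and> snd ar < ns ! fst ar \<and> q = offset ns (fst ar) + snd ar"
    using offset_ex[of _ ns] by fastforce
  then obtain dec where dec: "\<forall>q. q < sum_list ns \<longrightarrow>
      fst (dec q) < length ns \<and> snd (dec q) < ns ! fst (dec q) \<and> q = offset ns (fst (dec q)) + snd (dec q)"
    by (rule choice[THEN exE])
  have d: "fst (dec (offset ns a + r)) = a \<and> snd (dec (offset ns a + r)) = r" if "a < length ns" "r < ns ! a" for a r
  proof -
    have *: "fst (dec (offset ns a + r)) < length ns" "snd (dec (offset ns a + r)) < ns ! fst (dec (offset ns a + r))"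
      "offset ns a + r = offset ns (fst (dec (offset ns a + r))) + snd (dec (offset ns a + r))"
      using dec offset_less[OF that] by blast+
    show ?thesis using offset_inj[OF that(1) *(1) that(2) *(2)] *(3) by metis
  qed
  show ?thesis
    by (rule that[of "mat (sum_list ns) (sum_list ns)
        (\<lambda>(i, j). F (fst (dec i)) (fst (dec j)) (snd (dec i)) (snd (dec j)))"])
      (auto simp: offset_less d)
qed

lemma index_mat_block [simp]:
  "r < ns ! a \<Longrightarrow> s < ns ! b \<Longrightarrow> mat_block ns M a b $$ (r, s) = M $$ (offset ns a + r, offset ns b + s)"
  by (simp add: mat_block_def)

lemma mat_block_carrier [simp]: "mat_block ns M a b \<in> carrier_mat (ns ! a) (ns ! b)"
  by (simp add: mat_block_def)

lemma dim_mat_block [simp]: "dim_row (mat_block ns M a b) = ns ! a" "dim_col (mat_block ns M a b) = ns ! b"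
  by (simp_all add: mat_block_def)

lemma diag_block_mult:
  assumes F: "\<And>m. m \<in> set ns \<Longrightarrow> F m \<in> carrier_mat m m" and M: "M \<in> carrier_mat (sum_list ns) (sum_list ns)"
    and a: "a < length ns" and b: "b < length ns"
  shows "mat_block ns (diag_block_mat (map F ns) * M) a b = F (ns ! a) * mat_block ns M a b"
    and "mat_block ns (M * diag_block_mat (map F ns)) a b = mat_block ns M a b * F (ns ! b)"
proof -
  let ?D = "diag_block_mat (map F ns)"
  have D: "?D \<in> carrier_mat (sum_list ns) (sum_list ns)" by (rule diag_block_mat_carrier[OF F])
  have Fa: "F (ns ! a) \<in> carrier_mat (ns ! a) (ns ! a)" and Fb: "F (ns ! b) \<in> carrier_mat (ns ! b) (ns ! b)"
    using F a b by auto
  show "mat_block ns (?D * M) a b = F (ns ! a) * mat_block ns M a b"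
  proof (rule eq_matI)
    fix r s assume "r < dim_row (F (ns ! a) * mat_block ns M a b)" "s < dim_col (F (ns ! a) * mat_block ns M a b)"
    hence rs: "r < ns ! a" "s < ns ! b" using Fa by auto
    have "mat_block ns (?D * M) a b $$ (r, s) = (?D * M) $$ (offset ns a + r, offset ns b + s)"
      using rs by simp
    also have "\<dots> = (\<Sum>q<sum_list ns. ?D $$ (offset ns a + r, q) * M $$ (q, offset ns b + s))"
      by (rule index_mult_mat_sum[OF D M offset_less[OF a rs(1)] offset_less[OF b rs(2)]])
    also have "\<dots> = (\<Sum>c<length ns. \<Sum>t<ns ! c. ?D $$ (offset ns a + r, offset ns c + t) * M $$ (offset ns c + t, offset ns b + s))"
      by (rule sum_blocks)
    also have "\<dots> = (\<Sum>c<length ns. if c = a then \<Sum>t<ns ! a. F (ns ! a) $$ (r, t) * mat_block ns M a b $$ (t, s) else 0)"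
      using rs a by (intro sum.cong) (auto simp: index_diag_block_mat[OF F])
    also have "\<dots> = (\<Sum>t<ns ! a. F (ns ! a) $$ (r, t) * mat_block ns M a b $$ (t, s))" using a by simp
    also have "\<dots> = (F (ns ! a) * mat_block ns M a b) $$ (r, s)"
      by (rule index_mult_mat_sum[OF Fa mat_block_carrier rs, symmetric])
    finally show "mat_block ns (?D * M) a b $$ (r, s) = (F (ns ! a) * mat_block ns M a b) $$ (r, s)" .
  qed (use Fa in auto)
  show "mat_block ns (M * ?D) a b = mat_block ns M a b * F (ns ! b)"
  proof (rule eq_matI)
    fix r s assume "r < dim_row (mat_block ns M a b * F (ns ! b))" "s < dim_col (mat_block ns M a b * F (ns ! b))"
    hence rs: "r < ns ! a" "s < ns ! b" using Fb by auto
    have "mat_block ns (M * ?D) a b $$ (r, s) = (M * ?D) $$ (offset ns a + r, offset ns b + s)"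
      using rs by simp
    also have "\<dots> = (\<Sum>q<sum_list ns. M $$ (offset ns a + r, q) * ?D $$ (q, offset ns b + s))"
      by (rule index_mult_mat_sum[OF M D offset_less[OF a rs(1)] offset_less[OF b rs(2)]])
    also have "\<dots> = (\<Sum>c<length ns. \<Sum>t<ns ! c. M $$ (offset ns a + r, offset ns c + t) * ?D $$ (offset ns c + t, offset ns b + s))"
      by (rule sum_blocks)
    also have "\<dots> = (\<Sum>c<length ns. if c = b then \<Sum>t<ns ! b. mat_block ns M a b $$ (r, t) * F (ns ! b) $$ (t, s) else 0)"
      using rs b by (intro sum.cong) (auto simp: index_diag_block_mat[OF F])
    also have "\<dots> = (\<Sum>t<ns ! b. mat_block ns M a b $$ (r, t) * F (ns ! b) $$ (t, s))" using b by simp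
    also have "\<dots> = (mat_block ns M a b * F (ns ! b)) $$ (r, s)"
      by (rule index_mult_mat_sum[OF mat_block_carrier Fb rs, symmetric])
    finally show "mat_block ns (M * ?D) a b $$ (r, s) = (mat_block ns M a b * F (ns ! b)) $$ (r, s)" .
  qed (use Fb in auto)
qed

text \<open>Multiplication by a block diagonal matrix acts on each block separately, so the relation
  for M splits into one relation for every pair of summands.\<close>

lemma equivariant_block:
  assumes \<rho>: "\<And>m j. m \<in> set ns \<Longrightarrow> \<rho> m j \<in> carrier_mat m m"
    and M: "equivariant (sum_list ns) (sum_list ns) (\<lambda>j. diag_block_mat (map (\<lambda>m. \<rho> m j) ns))
      (\<lambda>j. diag_block_mat (map (\<lambda>m. \<rho> m j) ns)) M"
    and a: "a < length ns" and b: "b < length ns"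
  shows "equivariant (ns ! a) (ns ! b) (\<rho> (ns ! a)) (\<rho> (ns ! b)) (\<lambda>i. mat_block ns (M i) a b)"
  unfolding equivariant_def
proof (intro conjI allI)
  fix j k
  let ?D = "diag_block_mat (map (\<lambda>m. \<rho> m j) ns)" and ?L = "lincomb3 (levi_civita j k)"
  have Mc: "M i \<in> carrier_mat (sum_list ns) (sum_list ns)" for i using M by (simp add: equivariant_def)
  have Md: "dim_row (M i) = sum_list ns" "dim_col (M i) = sum_list ns" for i using Mc[of i] by auto
  have D: "?D \<in> carrier_mat (sum_list ns) (sum_list ns)" by (rule diag_block_mat_carrier[OF \<rho>])
  have Dd: "dim_row ?D = sum_list ns" "dim_col ?D = sum_list ns" using D by auto
  have \<rho>d: "dim_row (\<rho> (ns ! a) j) = ns ! a" "dim_col (\<rho> (ns ! b) j) = ns ! b"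
    using \<rho>[OF nth_mem[OF a], of j] \<rho>[OF nth_mem[OF b], of j] by auto
  have eq: "?D * M k - M k * ?D = ?L M" using M by (simp add: equivariant_def)
  note mult = diag_block_mult[where F = "\<lambda>m. \<rho> m j", OF \<rho> Mc a b, of k]
  have "mat_block ns (?D * M k) a b - mat_block ns (M k * ?D) a b = ?L (\<lambda>i. mat_block ns (M i) a b)"
  proof (rule eq_matI)
    fix r s assume "r < dim_row (?L (\<lambda>i. mat_block ns (M i) a b))" "s < dim_col (?L (\<lambda>i. mat_block ns (M i) a b))"
    hence rs: "r < ns ! a" "s < ns ! b" by (auto simp: lincomb3_def)
    have "(?D * M k - M k * ?D) $$ (offset ns a + r, offset ns b + s) = ?L M $$ (offset ns a + r, offset ns b + s)"
      by (simp only: eq)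
    thus "(mat_block ns (?D * M k) a b - mat_block ns (M k * ?D) a b) $$ (r, s) = ?L (\<lambda>i. mat_block ns (M i) a b) $$ (r, s)"
      using rs offset_less[OF a rs(1)] offset_less[OF b rs(2)]
      by (simp add: lincomb3_def Md Dd del: index_mult_mat(1))
  qed (auto simp: lincomb3_def)
  thus "\<rho> (ns ! a) j * mat_block ns (M k) a b - mat_block ns (M k) a b * \<rho> (ns ! b) j = ?L (\<lambda>i. mat_block ns (M i) a b)"
    by (simp only: mult)
qed simp

text \<open>The block (a, b) of X is W a b times the identity, and it is nonzero only between
  summands of equal dimension. Conjugation by X therefore acts on the block indices alone and leaves
  the positions r and s inside the blocks fixed.\<close>

lemma index_block_sandwich:
  assumes X: "X \<in> carrier_mat (sum_list ns) (sum_list ns)" and M: "M \<in> carrier_mat (sum_list ns) (sum_list ns)"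
    and XW: "\<And>a b r s. a < length ns \<Longrightarrow> b < length ns \<Longrightarrow> r < ns ! a \<Longrightarrow> s < ns ! b \<Longrightarrow>
      X $$ (offset ns a + r, offset ns b + s) = (if r = s then W a b else 0)"
    and W: "\<And>a b. ns ! a \<noteq> ns ! b \<Longrightarrow> W a b = 0"
    and ab: "a < length ns" "b < length ns" "r < ns ! a" "s < ns ! b"
  shows "mat_block ns (gauge_transform X M) a b $$ (r, s) =
    (\<Sum>c<length ns. \<Sum>d<length ns. W a c * mat_block ns M c d $$ (r, s) * cnj (W b d))"
proof -
  have pick: "(\<Sum>t<ns ! c. (if r = t then W a c else 0) * g t) = W a c * g r" if "r < ns ! a" for a c r and g :: "nat \<Rightarrow> complex"
  proof (cases "ns ! a = ns ! c")
    case True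
    have "(\<Sum>t<ns ! c. (if r = t then W a c else 0) * g t) = (\<Sum>t<ns ! c. if r = t then W a c * g t else 0)"
      by (intro sum.cong) auto
    thus ?thesis using that True by simp
  qed (simp add: W)
  have pick': "(\<Sum>t<ns ! c. g t * cnj (if r = t then W a c else 0)) = g r * cnj (W a c)" if "r < ns ! a" for a c r and g :: "nat \<Rightarrow> complex"
  proof (cases "ns ! a = ns ! c")
    case True
    have "(\<Sum>t<ns ! c. g t * cnj (if r = t then W a c else 0)) = (\<Sum>t<ns ! c. if r = t then g t * cnj (W a c) else 0)"
      by (intro sum.cong) auto
    thus ?thesis using that True by simp
  qed (simp add: W)
  let ?o = "offset ns"
  have "mat_block ns (gauge_transform X M) a b $$ (r, s) = (X * M * mat_adjoint X) $$ (?o a + r, ?o b + s)"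
    using ab by (simp add: gauge_transform_def)
  also have "\<dots> = (\<Sum>p<sum_list ns. \<Sum>q<sum_list ns. X $$ (?o a + r, p) * M $$ (p, q) * cnj (X $$ (?o b + s, q)))"
    by (rule index_sandwich[OF X M X offset_less[OF ab(1,3)] offset_less[OF ab(2,4)]])
  also have "\<dots> = (\<Sum>c<length ns. \<Sum>t<ns ! c. \<Sum>d<length ns. \<Sum>u<ns ! d.
      X $$ (?o a + r, ?o c + t) * M $$ (?o c + t, ?o d + u) * cnj (X $$ (?o b + s, ?o d + u)))"
    by (simp only: sum_blocks)
  also have "\<dots> = (\<Sum>c<length ns. \<Sum>t<ns ! c. \<Sum>d<length ns. \<Sum>u<ns ! d.
      ((if r = t then W a c else 0) * M $$ (?o c + t, ?o d + u)) * cnj (if s = u then W b d else 0))"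
    by (intro sum.cong refl) (auto simp: XW ab)
  also have "\<dots> = (\<Sum>c<length ns. \<Sum>t<ns ! c. \<Sum>d<length ns. (if r = t then W a c else 0) * M $$ (?o c + t, ?o d + s) * cnj (W b d))"
    unfolding pick'[OF ab(4)] ..
  also have "\<dots> = (\<Sum>c<length ns. \<Sum>t<ns ! c. (if r = t then W a c else 0) * (\<Sum>d<length ns. M $$ (?o c + t, ?o d + s) * cnj (W b d)))"
    by (simp only: sum_distrib_left mult.assoc)
  also have "\<dots> = (\<Sum>c<length ns. W a c * (\<Sum>d<length ns. M $$ (?o c + r, ?o d + s) * cnj (W b d)))"
    unfolding pick[OF ab(3)] ..
  also have "\<dots> = (\<Sum>c<length ns. \<Sum>d<length ns. W a c * M $$ (?o c + r, ?o d + s) * cnj (W b d))"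
    by (simp only: sum_distrib_left mult.assoc)
  \<comment> \<open>If r or s lies outside the block (c, d), the dimensions differ and a factor W
    vanishes, so the value of \<open>mat_block\<close> out of range does not matter.\<close>
  also have "\<dots> = (\<Sum>c<length ns. \<Sum>d<length ns. W a c * mat_block ns M c d $$ (r, s) * cnj (W b d))"
  proof (intro sum.cong refl)
    fix c d
    show "W a c * M $$ (?o c + r, ?o d + s) * cnj (W b d) = W a c * mat_block ns M c d $$ (r, s) * cnj (W b d)"
      using ab W[of a c] W[of b d] by (cases "ns ! a = ns ! c"; cases "ns ! b = ns ! d") auto
  qed
  finally show ?thesis .
qed

section \<open>Conjugation by unitary matrices\<close>

lemma gauge_transform_carrier [simp]:
  "U \<in> carrier_mat n n \<Longrightarrow> M \<in> carrier_mat n n \<Longrightarrow> gauge_transform U M \<in> carrier_mat n n"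
  unfolding gauge_transform_def by (intro mult_carrier_mat[of _ n n _ n] mat_adjoint_carrier)

lemma gauge_transform_gauge_transform:
  assumes "U \<in> carrier_mat n n" "V \<in> carrier_mat n n" "M \<in> carrier_mat n n"
  shows "gauge_transform U (gauge_transform V M) = gauge_transform (U * V) M"
  unfolding gauge_transform_def mat_adjoint_mult[OF assms(1,2)] using assms
  by (simp add: assoc_mult_mat[of _ n n _ n _ n] mult_carrier_mat[of _ n n _ n])

lemma gauge_transform_mult:
  assumes U: "U \<in> unitary_group n" and AB: "A \<in> carrier_mat n n" "B \<in> carrier_mat n n"
  shows "gauge_transform U A * gauge_transform U B = gauge_transform U (A * B)"
proof -
  have c: "U \<in> carrier_mat n n" and u: "mat_adjoint U * U = 1\<^sub>m n" using U by (auto simp: unitary_group_def)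
  have "gauge_transform U A * gauge_transform U B = U * A * (mat_adjoint U * U) * B * mat_adjoint U"
    unfolding gauge_transform_def using c AB
    by (simp add: assoc_mult_mat[of _ n n _ n _ n] mult_carrier_mat[of _ n n _ n])
  also have "\<dots> = gauge_transform U (A * B)"
    unfolding gauge_transform_def u using c AB
    by (simp add: assoc_mult_mat[of _ n n _ n _ n] mult_carrier_mat[of _ n n _ n])
  finally show ?thesis .
qed

lemma gauge_transform_linear:
  assumes U: "U \<in> carrier_mat n n" and AB: "A \<in> carrier_mat n n" "B \<in> carrier_mat n n"
  shows "gauge_transform U (A - B) = gauge_transform U A - gauge_transform U B"
    and "gauge_transform U (A + B) = gauge_transform U A + gauge_transform U B"
    and "gauge_transform U (a \<cdot>\<^sub>m A) = a \<cdot>\<^sub>m gauge_transform U A"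
    and "gauge_transform U (- A) = - gauge_transform U A"
    and "gauge_transform U (mat_adjoint A) = mat_adjoint (gauge_transform U A)"
proof -
  note c = mult_carrier_mat[OF U AB(1)] mult_carrier_mat[OF U AB(2)] mat_adjoint_carrier[OF U]
  show "gauge_transform U (A - B) = gauge_transform U A - gauge_transform U B"
    unfolding gauge_transform_def mult_minus_distrib_mat[OF U AB] by (rule minus_mult_distrib_mat[OF c])
  show "gauge_transform U (A + B) = gauge_transform U A + gauge_transform U B"
    unfolding gauge_transform_def mult_add_distrib_mat[OF U AB] by (rule add_mult_distrib_mat[OF c])
  show sm: "gauge_transform U (a \<cdot>\<^sub>m A) = a \<cdot>\<^sub>m gauge_transform U A" for a
    unfolding gauge_transform_def mult_smult_distrib[OF U AB(1)] by (rule mult_smult_assoc_mat[OF c(1,3)])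
  have "- M = (- 1) \<cdot>\<^sub>m M" for M :: "complex mat" by (intro eq_matI) auto
  thus "gauge_transform U (- A) = - gauge_transform U A" using sm by metis
  have aA: "mat_adjoint A \<in> carrier_mat n n" using AB by simp
  show "gauge_transform U (mat_adjoint A) = mat_adjoint (gauge_transform U A)"
    unfolding gauge_transform_def mat_adjoint_mult[OF c(1,3)] mat_adjoint_mult[OF U AB(1)] mat_adjoint_adjoint
    by (rule assoc_mult_mat[OF U aA c(3)])
qed

lemma equivariant_gauge_transform:
  assumes P: "P \<in> unitary_group n" and Y: "\<And>j. Y j \<in> carrier_mat n n" and M: "equivariant n n Y Y M"
  shows "equivariant n n (\<lambda>j. gauge_transform P (Y j)) (\<lambda>j. gauge_transform P (Y j)) (\<lambda>j. gauge_transform P (M j))"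
  unfolding equivariant_def
proof (intro conjI allI)
  have Pc: "P \<in> carrier_mat n n" using P by (simp add: unitary_group_def)
  have Mc: "M j \<in> carrier_mat n n" for j using M by (simp add: equivariant_def)
  note lin = gauge_transform_linear[OF Pc]
  show "gauge_transform P (M k) \<in> carrier_mat n n" for k using Pc Mc by simp
  fix j k
  have YM: "Y j * M k \<in> carrier_mat n n" "M k * Y j \<in> carrier_mat n n"
    by (rule mult_carrier_mat[OF Y Mc] mult_carrier_mat[OF Mc Y])+
  have sc: "a \<cdot>\<^sub>m M i \<in> carrier_mat n n" for a i using Mc by simp
  have "gauge_transform P (Y j) * gauge_transform P (M k) - gauge_transform P (M k) * gauge_transform P (Y j) =
      gauge_transform P (Y j * M k - M k * Y j)"
    unfolding gauge_transform_mult[OF P Y Mc] gauge_transform_mult[OF P Mc Y] lin(1)[OF YM] ..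
  also have "Y j * M k - M k * Y j = lincomb3 (levi_civita j k) M" using M by (simp add: equivariant_def)
  also have "gauge_transform P (lincomb3 (levi_civita j k) M) = lincomb3 (levi_civita j k) (\<lambda>j. gauge_transform P (M j))"
    unfolding lincomb3_def lin(2)[OF add_carrier_mat[OF sc] sc] lin(2)[OF sc sc] lin(3)[OF Mc Mc] ..
  finally show "gauge_transform P (Y j) * gauge_transform P (M k) - gauge_transform P (M k) * gauge_transform P (Y j) =
      lincomb3 (levi_civita j k) (\<lambda>j. gauge_transform P (M j))" .
qed

section \<open>Determinants and phases of unitary matrices\<close>

lemma det_mat_adjoint:
  fixes A :: "complex mat"
  assumes "A \<in> carrier_mat n n"
  shows "Determinant.det (mat_adjoint A) = cnj (Determinant.det A)"
proof -
  interpret cnj: comm_ring_hom cnj by unfold_locales auto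
  have "mat_adjoint A = map_mat cnj (transpose_mat A)" by (rule eq_matI) auto
  thus ?thesis using det_transpose[OF assms] by (simp add: cnj.hom_det)
qed

lemma cmod_det_unitary:
  assumes "U \<in> unitary_group n"
  shows "cmod (Determinant.det U) = 1"
proof -
  have c: "U \<in> carrier_mat n n" and u: "U * mat_adjoint U = 1\<^sub>m n" using assms by (auto simp: unitary_group_def)
  have "Determinant.det U * cnj (Determinant.det U) = Determinant.det (U * mat_adjoint U)"
    using det_mult[OF c mat_adjoint_carrier[OF c]] det_mat_adjoint[OF c] by simp
  also have "\<dots> = 1" unfolding u by simp
  finally have "complex_of_real ((cmod (Determinant.det U))\<^sup>2) = 1" by (simp only: complex_norm_square)
  hence "(cmod (Determinant.det U))\<^sup>2 = 1" by (simp only: of_real_eq_1_iff)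
  hence "cmod (Determinant.det U) = 1 \<or> cmod (Determinant.det U) = - 1" by (simp add: power2_eq_1_iff)
  thus ?thesis using norm_ge_zero[of "Determinant.det U"] by (elim disjE) simp_all
qed

lemma smult_gauge_transform:
  assumes "U \<in> carrier_mat n n" "M \<in> carrier_mat n n" "cmod z = 1"
  shows "gauge_transform (z \<cdot>\<^sub>m U) M = gauge_transform U M"
proof (rule eq_matI)
  fix i j assume "i < dim_row (gauge_transform U M)" "j < dim_col (gauge_transform U M)"
  hence ij: "i < n" "j < n" using assms by (auto simp: gauge_transform_def)
  have zU: "z \<cdot>\<^sub>m U \<in> carrier_mat n n" using assms by simp
  have zz: "z * cnj z = 1" using assms(3) by (simp add: complex_norm_square[symmetric])
  have "z * x * y * cnj (z * w) = (z * cnj z) * (x * y * cnj w)" for x y w by (simp add: mult_ac)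
  thus "gauge_transform (z \<cdot>\<^sub>m U) M $$ (i, j) = gauge_transform U M $$ (i, j)"
    unfolding gauge_transform_def index_sandwich[OF zU assms(2) zU ij] index_sandwich[OF assms(1,2,1) ij]
    using assms(1) ij by (intro sum.cong) (auto simp: zz)
qed (use assms in \<open>auto simp: gauge_transform_def\<close>)

text \<open>z is an n-th root of the inverse determinant. By \<open>smult_gauge_transform\<close>
  such a phase leaves the conjugation unchanged.\<close>

lemma unitary_to_SU:
  assumes U: "U \<in> unitary_group n"
  obtains z where "cmod z = 1" "z \<cdot>\<^sub>m U \<in> SU n"
proof -
  have c: "U \<in> carrier_mat n n" using U by (auto simp: unitary_group_def)
  define d where "d = Determinant.det U"
  have d: "cmod d = 1" unfolding d_def by (rule cmod_det_unitary[OF U])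
  define z where "z = cis (- (Arg d / real n))"
  have z: "cmod z = 1" by (simp add: z_def)
  have dz: "z ^ n * d = 1"
  proof (cases "n = 0")
    case True
    thus ?thesis using det_dim_zero[of U] c by (simp add: d_def)
  next
    case False
    have "z ^ n = cis (- Arg d)" unfolding z_def Complex.DeMoivre using False by simp
    moreover have "d = cis (Arg d)"
    proof -
      have "d \<noteq> 0" using d by auto
      from cis_Arg[OF this] show ?thesis using d by (simp add: sgn_div_norm)
    qed
    ultimately have "z ^ n * d = cis (- Arg d) * cis (Arg d)" by simp
    also have "\<dots> = 1" by (simp add: cis_mult)
    finally show ?thesis .
  qed
  have "gauge_transform (z \<cdot>\<^sub>m U) (1\<^sub>m n) = gauge_transform U (1\<^sub>m n)"
    by (rule smult_gauge_transform[OF c _ z]) simp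
  hence "z \<cdot>\<^sub>m U * mat_adjoint (z \<cdot>\<^sub>m U) = 1\<^sub>m n"
    using U c by (simp add: gauge_transform_def unitary_group_def)
  hence "z \<cdot>\<^sub>m U \<in> unitary_group n" using c by (intro unitary_groupI) auto
  moreover have "Determinant.det (z \<cdot>\<^sub>m U) = 1" using dz c by (simp add: d_def)
  ultimately show ?thesis using that[OF z] by (simp add: SU_def)
qed

section \<open>The blocks of a spherically symmetric solution\<close>

lemma gauge_transform_antihermitian:
  assumes "P \<in> carrier_mat n n" "M \<in> carrier_mat n n" "mat_adjoint M = - M"
  shows "mat_adjoint (gauge_transform P M) = - gauge_transform P M"
  using gauge_transform_linear(4,5)[OF assms(1,2,2)] assms(3) by simp

lemma mat_block_antihermitian:
  assumes M: "M \<in> carrier_mat (sum_list ns) (sum_list ns)" "mat_adjoint M = - M"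
    and ab: "a < length ns" "b < length ns"
  shows "mat_block ns M a b = - mat_adjoint (mat_block ns M b a)"
proof (rule eq_matI)
  fix r s assume "r < dim_row (- mat_adjoint (mat_block ns M b a))" "s < dim_col (- mat_adjoint (mat_block ns M b a))"
  hence rs: "r < ns ! a" "s < ns ! b" by auto
  have o: "offset ns a + r < sum_list ns" "offset ns b + s < sum_list ns"
    using offset_less ab rs by auto
  have "mat_adjoint M $$ (offset ns a + r, offset ns b + s) = (- M) $$ (offset ns a + r, offset ns b + s)"
    by (simp only: M(2))
  hence "cnj (M $$ (offset ns b + s, offset ns a + r)) = - M $$ (offset ns a + r, offset ns b + s)"
    using M(1) o by auto
  thus "mat_block ns M a b $$ (r, s) = (- mat_adjoint (mat_block ns M b a)) $$ (r, s)"
    using rs by simp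
qed simp_all

lemma mat_trace_smult: "mat_trace (c \<cdot>\<^sub>m M) = c * mat_trace M" if "M \<in> carrier_mat n n"
  using that by (auto simp: mat_trace_def sum_distrib_left)

text \<open>Taking adjoints twice introduces two signs that cancel: if block (b, a) is d b a times
  the representation, then block (a, b) is \<open>cnj (d b a)\<close> times it. Hence d a b and
  \<open>cnj (d b a)\<close> describe the same block, and so does their mean D.\<close>

lemma equivariant_blocks_gauge:
  assumes irr: "\<And>a. a < length ns \<Longrightarrow> so3_irrep (ns ! a) (\<rho> (ns ! a))"
    and C: "\<And>a b. a < length ns \<Longrightarrow> b < length ns \<Longrightarrow>
      equivariant (ns ! a) (ns ! b) (\<rho> (ns ! a)) (\<rho> (ns ! b)) (\<lambda>i. mat_block ns (M i) a b)"
    and M: "\<And>i. M i \<in> carrier_mat (sum_list ns) (sum_list ns)" "\<And>i. mat_adjoint (M i) = - M i"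
  shows "\<exists>D. (\<forall>a<length ns. \<forall>b<length ns. \<forall>i. ns ! a = ns ! b \<longrightarrow>
      mat_block ns (M i) a b = D a b \<cdot>\<^sub>m \<rho> (ns ! a) i) \<and> (\<forall>a b. D a b = cnj (D b a))"
proof -
  have "\<forall>a b. \<exists>d. a < length ns \<and> b < length ns \<and> ns ! a = ns ! b \<longrightarrow>
      (\<forall>i. mat_block ns (M i) a b = d \<cdot>\<^sub>m \<rho> (ns ! a) i)"
  proof (intro allI)
    fix a b
    show "\<exists>d. a < length ns \<and> b < length ns \<and> ns ! a = ns ! b \<longrightarrow>
      (\<forall>i. mat_block ns (M i) a b = d \<cdot>\<^sub>m \<rho> (ns ! a) i)"
    proof (cases "a < length ns \<and> b < length ns \<and> ns ! a = ns ! b")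
      case True
      thus ?thesis using so3_irrep.equivariant_endo[OF irr, of a "\<lambda>i. mat_block ns (M i) a b"] C[of a b] by auto
    qed blast
  qed
  then obtain d where d: "\<And>a b i. a < length ns \<Longrightarrow> b < length ns \<Longrightarrow> ns ! a = ns ! b \<Longrightarrow>
      mat_block ns (M i) a b = d a b \<cdot>\<^sub>m \<rho> (ns ! a) i" by metis
  \<comment> \<open>For \<open>n\<^sub>a = 1\<close> the representation is zero and \<open>d a b\<close> is arbitrary; symmetrizing makes it hermitian.\<close>
  define D where "D a b = (d a b + cnj (d b a)) / 2" for a b
  show ?thesis
  proof (intro exI[of _ D] conjI allI impI)
    show "D a b = cnj (D b a)" for a b by (simp add: D_def)
    fix a b i assume ab: "a < length ns" "b < length ns" "ns ! a = ns ! b"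
    interpret so3_irrep "ns ! a" "\<rho> (ns ! a)" by (rule irr[OF ab(1)])
    show "mat_block ns (M i) a b = D a b \<cdot>\<^sub>m \<rho> (ns ! a) i"
    proof (rule eq_matI)
      fix r s assume "r < dim_row (D a b \<cdot>\<^sub>m \<rho> (ns ! a) i)" "s < dim_col (D a b \<cdot>\<^sub>m \<rho> (ns ! a) i)"
      hence rs: "r < ns ! a" "s < ns ! a" by auto
      have "mat_adjoint (\<rho> (ns ! a) i) $$ (r, s) = (- \<rho> (ns ! a) i) $$ (r, s)"
        using in_su[of i] by (simp add: su_def)
      hence h: "cnj (\<rho> (ns ! a) i $$ (s, r)) = - \<rho> (ns ! a) i $$ (r, s)" using rs by simp
      have "mat_block ns (M i) a b $$ (r, s) = (- mat_adjoint (mat_block ns (M i) b a)) $$ (r, s)"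
        by (simp only: mat_block_antihermitian[OF M ab(1,2)])
      also have "\<dots> = - cnj ((d b a \<cdot>\<^sub>m \<rho> (ns ! a) i) $$ (s, r))"
        unfolding d[OF ab(2,1) ab(3)[symmetric]] ab(3)[symmetric] using rs by simp
      also have "\<dots> = cnj (d b a) * \<rho> (ns ! a) i $$ (r, s)" using rs by (simp add: h)
      finally have 1: "mat_block ns (M i) a b $$ (r, s) = cnj (d b a) * \<rho> (ns ! a) i $$ (r, s)" .
      have "mat_block ns (M i) a b $$ (r, s) = (d a b \<cdot>\<^sub>m \<rho> (ns ! a) i) $$ (r, s)" by (simp only: d[OF ab])
      also have "\<dots> = d a b * \<rho> (ns ! a) i $$ (r, s)" using rs by simp
      finally have "2 * mat_block ns (M i) a b $$ (r, s) = (d a b + cnj (d b a)) * \<rho> (ns ! a) i $$ (r, s)"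
        using 1 by (simp only: mult_2 distrib_right)
      hence "mat_block ns (M i) a b $$ (r, s) = D a b * \<rho> (ns ! a) i $$ (r, s)"
        by (simp add: D_def field_simps)
      thus "mat_block ns (M i) a b $$ (r, s) = (D a b \<cdot>\<^sub>m \<rho> (ns ! a) i) $$ (r, s)" using rs by simp
    qed (use dims[of i] ab(3) in simp_all)
  qed
qed

text \<open>X mixes isomorphic summands by the unitary W and acts as a scalar inside each block, so
  it commutes with the representation. Pulled back by P it becomes a gauge V commuting with Y, and a
  phase puts it into SU.\<close>

lemma scalar_block_gauge_ex:
  assumes F: "\<And>m j. m \<in> set ns \<Longrightarrow> \<rho> m j \<in> carrier_mat m m"
    and P: "P \<in> unitary_group (sum_list ns)"
    and Y: "\<And>j. Y j \<in> carrier_mat (sum_list ns) (sum_list ns)"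
    and PY: "\<And>j. gauge_transform P (Y j) = diag_block_mat (map (\<lambda>m. \<rho> m j) ns)"
    and W0: "\<And>a b. ns ! a \<noteq> ns ! b \<Longrightarrow> W a b = 0"
    and WW: "\<And>a b. a < length ns \<Longrightarrow> b < length ns \<Longrightarrow>
      (\<Sum>c<length ns. W a c * cnj (W b c)) = (if a = b then 1 else 0)"
  shows "\<exists>U\<in>SU (sum_list ns). (\<forall>j. U * Y j = Y j * U) \<and>
    (\<forall>M\<in>carrier_mat (sum_list ns) (sum_list ns).
      \<forall>a<length ns. \<forall>b<length ns. \<forall>r<ns ! a. \<forall>s<ns ! b. mat_block ns (gauge_transform P (gauge_transform U M)) a b $$ (r, s) =
      (\<Sum>c<length ns. \<Sum>d<length ns. W a c * mat_block ns (gauge_transform P M) c d $$ (r, s) * cnj (W b d)))"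
proof -
  let ?n = "sum_list ns" and ?D = "\<lambda>j. diag_block_mat (map (\<lambda>m. \<rho> m j) ns)"
  obtain X where X: "X \<in> carrier_mat ?n ?n"
    and XW: "\<And>a b r s. a < length ns \<Longrightarrow> b < length ns \<Longrightarrow> r < ns ! a \<Longrightarrow> s < ns ! b \<Longrightarrow>
      X $$ (offset ns a + r, offset ns b + s) = (if r = s then W a b else 0)"
    using block_mat_ex[of ns "\<lambda>a b r s. if r = s then W a b else 0"] by blast
  have D: "?D j \<in> carrier_mat ?n ?n" for j by (rule diag_block_mat_carrier[OF F])
  have "X * mat_adjoint X = 1\<^sub>m ?n"
  proof (rule mat_eq_blockI)
    show "X * mat_adjoint X \<in> carrier_mat ?n ?n" using X by simp
    fix a b r s assume ab: "a < length ns" "b < length ns" "r < ns ! a" "s < ns ! b"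
    \<comment> \<open>Unitarity of X is read off from its conjugation action on the identity, to
      which the block formula applies.\<close>
    have W1: "gauge_transform X (1\<^sub>m ?n) = X * mat_adjoint X" using X by (simp add: gauge_transform_def)
    have "(X * mat_adjoint X) $$ (offset ns a + r, offset ns b + s) = mat_block ns (gauge_transform X (1\<^sub>m ?n)) a b $$ (r, s)"
      using ab by (simp add: W1)
    also have "\<dots> = (\<Sum>c<length ns. \<Sum>d<length ns. W a c * mat_block ns (1\<^sub>m ?n) c d $$ (r, s) * cnj (W b d))"
      by (rule index_block_sandwich[OF X _ XW W0 ab]) simp_all
    also have "\<dots> = (\<Sum>c<length ns. \<Sum>d<length ns. if c = d then (if r = s then W a c * cnj (W b c) else 0) else 0)"
    proof (intro sum.cong refl)
      fix c d assume "c \<in> {..<length ns}" "d \<in> {..<length ns}"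
      hence cd: "c < length ns" "d < length ns" by auto
      show "W a c * mat_block ns (1\<^sub>m ?n) c d $$ (r, s) * cnj (W b d) = (if c = d then (if r = s then W a c * cnj (W b c) else 0) else 0)"
      proof (cases "ns ! a = ns ! c \<and> ns ! b = ns ! d")
        case True
        hence rs: "r < ns ! c" "s < ns ! d" using ab by auto
        show ?thesis using rs offset_less[OF cd(1) rs(1)] offset_less[OF cd(2) rs(2)] offset_inj[OF cd rs] by auto
      qed (use W0[of a c] W0[of b d] in auto)
    qed
    also have "\<dots> = (\<Sum>c<length ns. if r = s then W a c * cnj (W b c) else 0)" by simp
    also have "\<dots> = 1\<^sub>m ?n $$ (offset ns a + r, offset ns b + s)"
      using ab offset_less[OF ab(1,3)] offset_less[OF ab(2,4)] offset_inj[OF ab] WW[OF ab(1,2)] by (cases "r = s") auto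
    finally show "(X * mat_adjoint X) $$ (offset ns a + r, offset ns b + s) = 1\<^sub>m ?n $$ (offset ns a + r, offset ns b + s)" .
  qed simp
  hence XU: "X \<in> unitary_group ?n" by (rule unitary_groupI[OF X])
  have XD: "X * ?D j = ?D j * X" for j
  proof (rule mat_eq_blockI)
    show "X * ?D j \<in> carrier_mat ?n ?n" "?D j * X \<in> carrier_mat ?n ?n" using X D[of j] by simp_all
    fix a b r s assume ab: "a < length ns" "b < length ns" "r < ns ! a" "s < ns ! b"
    have Fa: "\<rho> (ns ! a) j \<in> carrier_mat (ns ! a) (ns ! a)" and Fb: "\<rho> (ns ! b) j \<in> carrier_mat (ns ! b) (ns ! b)"
      using F ab by auto
    note mult = diag_block_mult[where F = "\<lambda>m. \<rho> m j", OF F X ab(1,2)]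
    have "(X * ?D j) $$ (offset ns a + r, offset ns b + s) = mat_block ns (X * ?D j) a b $$ (r, s)"
      using ab by simp
    also have "\<dots> = (mat_block ns X a b * \<rho> (ns ! b) j) $$ (r, s)" by (simp only: mult(2))
    also have "\<dots> = (\<Sum>t<ns ! b. (if r = t then W a b else 0) * \<rho> (ns ! b) j $$ (t, s))"
      unfolding index_mult_mat_sum[OF mat_block_carrier Fb ab(3,4)] using ab by (intro sum.cong) (auto simp: XW)
    also have "\<dots> = (\<Sum>t<ns ! b. if r = t then W a b * \<rho> (ns ! b) j $$ (r, s) else 0)"
      by (intro sum.cong) auto
    \<comment> \<open>Where W a b is nonzero, both blocks have the same dimension and carry the same
      representation, so the scalar may stand on either side of it.\<close>
    also have "\<dots> = W a b * \<rho> (ns ! b) j $$ (r, s)" using ab(3) W0[of a b] by (cases "ns ! a = ns ! b") auto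
    also have "\<dots> = (\<Sum>t<ns ! a. if t = s then W a b * \<rho> (ns ! a) j $$ (r, s) else 0)"
      using ab(4) W0[of a b] by (cases "ns ! a = ns ! b") auto
    also have "\<dots> = (\<Sum>t<ns ! a. \<rho> (ns ! a) j $$ (r, t) * (if t = s then W a b else 0))"
      by (intro sum.cong) auto
    also have "\<dots> = (\<rho> (ns ! a) j * mat_block ns X a b) $$ (r, s)"
      unfolding index_mult_mat_sum[OF Fa mat_block_carrier ab(3,4)] using ab by (intro sum.cong) (auto simp: XW)
    also have "\<dots> = mat_block ns (?D j * X) a b $$ (r, s)" by (simp only: mult(1))
    also have "\<dots> = (?D j * X) $$ (offset ns a + r, offset ns b + s)" using ab by simp
    finally show "(X * ?D j) $$ (offset ns a + r, offset ns b + s) = (?D j * X) $$ (offset ns a + r, offset ns b + s)" .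
  qed
  have Pc: "P \<in> carrier_mat ?n ?n" and PP: "P * mat_adjoint P = 1\<^sub>m ?n" "mat_adjoint P * P = 1\<^sub>m ?n"
    using P by (auto simp: unitary_group_def)
  have Pa: "mat_adjoint P \<in> carrier_mat ?n ?n" using Pc by simp
  note sq = assoc_mult_mat[of _ ?n ?n _ ?n _ ?n] mult_carrier_mat[of _ ?n ?n _ ?n]
  define V where "V = mat_adjoint P * X * P"
  have VU: "V \<in> unitary_group ?n"
    unfolding V_def by (intro unitary_group_mult mat_adjoint_unitary P XU)
  have Vc: "V \<in> carrier_mat ?n ?n" using VU by (simp add: unitary_group_def)
  have "P * V = (P * mat_adjoint P) * (X * P)" unfolding V_def using Pc Pa X by (simp add: sq)
  hence PV: "P * V = X * P" unfolding PP using X Pc by (simp add: sq)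
  have VY: "V * Y j = Y j * V" for j
  proof -
    have "P * Y j = P * Y j * (mat_adjoint P * P)" unfolding PP using Pc Y[of j] by (simp add: sq)
    also have "\<dots> = gauge_transform P (Y j) * P" unfolding gauge_transform_def using Pc Pa Y[of j] by (simp add: sq)
    finally have PYj: "P * Y j = ?D j * P" by (simp only: PY)
    have "Y j * mat_adjoint P = (mat_adjoint P * P) * Y j * mat_adjoint P" unfolding PP using Pa Y[of j] by (simp add: sq)
    also have "\<dots> = mat_adjoint P * gauge_transform P (Y j)" unfolding gauge_transform_def using Pc Pa Y[of j] by (simp add: sq)
    finally have YP: "Y j * mat_adjoint P = mat_adjoint P * ?D j" by (simp only: PY)
    have "V * Y j = mat_adjoint P * X * (P * Y j)" unfolding V_def using Pc Pa X Y[of j] by (simp add: sq)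
    also have "\<dots> = mat_adjoint P * (X * ?D j) * P" unfolding PYj using Pc Pa X D[of j] by (simp add: sq)
    also have "\<dots> = (mat_adjoint P * ?D j) * X * P" unfolding XD using Pc Pa X D[of j] by (simp add: sq)
    also have "\<dots> = Y j * V" unfolding YP[symmetric] V_def using Pc Pa X Y[of j] by (simp add: sq)
    finally show ?thesis .
  qed
  obtain z where z: "cmod z = 1" "z \<cdot>\<^sub>m V \<in> SU ?n" using unitary_to_SU[OF VU] by blast
  show ?thesis
  proof (intro bexI[of _ "z \<cdot>\<^sub>m V"] conjI allI ballI impI)
    show "z \<cdot>\<^sub>m V \<in> SU ?n" by fact
    show "z \<cdot>\<^sub>m V * Y j = Y j * (z \<cdot>\<^sub>m V)" for j
      unfolding mult_smult_distrib[OF Y Vc] mult_smult_assoc_mat[OF Vc Y] VY ..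
    fix M :: "complex mat" and a b r s
    assume M: "M \<in> carrier_mat ?n ?n" and ab: "a < length ns" "b < length ns" "r < ns ! a" "s < ns ! b"
    have "gauge_transform P (gauge_transform (z \<cdot>\<^sub>m V) M) = gauge_transform X (gauge_transform P M)"
      unfolding smult_gauge_transform[OF Vc M z(1)] gauge_transform_gauge_transform[OF Pc Vc M] PV
        gauge_transform_gauge_transform[OF X Pc M] ..
    thus "mat_block ns (gauge_transform P (gauge_transform (z \<cdot>\<^sub>m V) M)) a b $$ (r, s) =
      (\<Sum>c<length ns. \<Sum>d<length ns. W a c * mat_block ns (gauge_transform P M) c d $$ (r, s) * cnj (W b d))"
      using index_block_sandwich[OF X gauge_transform_carrier[OF Pc M] XW W0 ab] by simp
  qed
qed

section \<open>From the coefficients of the blocks to the gauge and the three statements\<close>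

theorem theorem4p5:
  fixes n :: nat
    and I :: "real set"
    and T :: "3 \<Rightarrow> real \<Rightarrow> complex mat"
    and Y :: "3 \<Rightarrow> complex mat"
    and \<rho> :: "nat \<Rightarrow> 3 \<Rightarrow> complex mat"
    and B :: "nat \<Rightarrow> 3 \<Rightarrow> complex mat"
    and ns :: "nat list"
    and P :: "complex mat"
    and t0 :: real
  assumes irreps: "\<forall>m\<ge>1. irreducible_so3_rep m (\<rho> m)"
    and B: "\<forall>m\<ge>1. unit_generator \<rho> m (B m)"
    and nahm: "nahm_solution n I T"
    and symmetric: "spherically_symmetric n I T"
    and generators: "symmetry_generators n I T Y"
    and rep: "induces_so3_rep Y"
    and decomposition: "irreducible_decomposition \<rho> n Y ns P"
    and t0: "t0 \<in> I"
  defines "k \<equiv> length ns"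
    and "blk \<equiv> (\<lambda>M. mat_block ns (gauge_transform P M))"
  shows "(\<forall>i. \<forall>a<k. blk (T i t0) a a \<in> su (ns ! a)) \<and>
    (\<forall>i. \<forall>a<k. \<forall>b<k. blk (T i t0) a b = - mat_adjoint (blk (T i t0) b a)) \<and>
    (\<exists>U\<in>SU n. (\<forall>i. U * Y i = Y i * U) \<and>
      (\<forall>a<k. \<exists>c::real. \<forall>i. blk (gauge_transform U (T i t0)) a a = complex_of_real c \<cdot>\<^sub>m \<rho> (ns ! a) i) \<and>
      (\<forall>a<k. \<forall>b<k. a \<noteq> b \<and> \<bar>int (ns ! a) - int (ns ! b)\<bar> \<noteq> 2 \<longrightarrow>
         (\<forall>i. blk (gauge_transform U (T i t0)) a b = 0\<^sub>m (ns ! a) (ns ! b))) \<and>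
      (\<forall>a<k. \<forall>b<k. ns ! a = ns ! b + 2 \<longrightarrow>
         (\<exists>c::complex. \<forall>i. blk (gauge_transform U (T i t0)) a b = c \<cdot>\<^sub>m B (ns ! b) i)))"
proof -
  have dec: "sum_list ns = n" "P \<in> unitary_group n" "\<forall>m\<in>set ns. m \<ge> 1"
      "\<forall>i. gauge_transform P (Y i) = diag_block_mat (map (\<lambda>m. \<rho> m i) ns)"
    using decomposition unfolding irreducible_decomposition_def by blast+
  have n: "n = sum_list ns" by (rule dec(1)[symmetric])
  have P: "P \<in> unitary_group (sum_list ns)" using dec(2) by (simp only: n)
  have ns: "m \<ge> 1" if "m \<in> set ns" for m using dec(3) that by blast
  have PY: "gauge_transform P (Y i) = diag_block_mat (map (\<lambda>m. \<rho> m i) ns)" for i using dec(4) by blast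
  let ?n = "sum_list ns" and ?T = "\<lambda>i. T i t0"
  have Pc: "P \<in> carrier_mat ?n ?n" using P by (simp add: unitary_group_def)
  have "T i t0 \<in> su n" for i using nahm t0 unfolding nahm_solution_def by blast
  hence T: "T i t0 \<in> carrier_mat ?n ?n" "mat_adjoint (T i t0) = - T i t0" for i
    by (simp_all add: su_def n)
  have "Y i \<in> su n" for i using generators unfolding symmetry_generators_def by blast
  hence Y: "Y i \<in> carrier_mat ?n ?n" for i by (simp add: su_def n)
  have irr: "so3_irrep m (\<rho> m)" if "m \<ge> 1" for m
    using irreps that by (intro so3_irrep.intro) simp
  have irr': "so3_irrep (ns ! a) (\<rho> (ns ! a))" if "a < k" for a
    by (rule irr[OF ns[OF nth_mem[OF that[unfolded k_def]]]])
  have \<rho>: "\<rho> m j \<in> carrier_mat m m" if "m \<in> set ns" for m j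
    using so3_irrep.carrier[OF irr[OF ns[OF that]]] .
  let ?M = "\<lambda>i. gauge_transform P (T i t0)"
  have Mc: "?M i \<in> carrier_mat ?n ?n" for i using Pc T by simp
  have Ma: "mat_adjoint (?M i) = - ?M i" for i by (rule gauge_transform_antihermitian[OF Pc T])
  have "equivariant ?n ?n Y Y ?T"
    unfolding equivariant_def
  proof (intro conjI allI)
    show "T j t0 \<in> carrier_mat ?n ?n" for j by (rule T(1))
    show "Y i * T j t0 - T j t0 * Y i = lincomb3 (levi_civita i j) ?T" for i j
      using generators t0 by (simp add: symmetry_generators_def commutator_def)
  qed
  note eqvM = equivariant_gauge_transform[OF P Y this, unfolded PY]
  have eqv: "equivariant (ns ! a) (ns ! b) (\<rho> (ns ! a)) (\<rho> (ns ! b)) (\<lambda>i. mat_block ns (?M i) a b)"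
    if "a < k" "b < k" for a b
    by (rule equivariant_block[where \<rho> = \<rho> and M = ?M, OF \<rho> eqvM that[unfolded k_def]])
  have "\<exists>D. (\<forall>a<length ns. \<forall>b<length ns. \<forall>i. ns ! a = ns ! b \<longrightarrow>
      mat_block ns (?M i) a b = D a b \<cdot>\<^sub>m \<rho> (ns ! a) i) \<and> (\<forall>a b. D a b = cnj (D b a))"
    by (rule equivariant_blocks_gauge) (simp_all add: irr'[unfolded k_def] eqv[unfolded k_def] Mc Ma)
  then obtain D where D: "\<forall>a<length ns. \<forall>b<length ns. \<forall>i. ns ! a = ns ! b \<longrightarrow>
      mat_block ns (?M i) a b = D a b \<cdot>\<^sub>m \<rho> (ns ! a) i" and Dh: "\<forall>a b. D a b = cnj (D b a)"
    by (elim exE conjE)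
  \<comment> \<open>The fibres are the sets of summands of equal dimension, so W only mixes
    isomorphic ones.\<close>
  have "\<exists>W. (\<forall>a b. ns ! a \<noteq> ns ! b \<longrightarrow> W a b = 0) \<and>
      (\<forall>a<k. \<forall>b<k. (\<Sum>c<k. W a c * cnj (W b c)) = (if a = b then 1 else 0)) \<and>
      (\<forall>a<k. \<forall>b<k. a \<noteq> b \<longrightarrow> ns ! a = ns ! b \<longrightarrow> (\<Sum>c<k. \<Sum>d<k. W a c * D c d * cnj (W b d)) = 0)"
    by (rule blockwise_diagonalization) (rule Dh[rule_format])
  then obtain W where W0: "\<forall>a b. ns ! a \<noteq> ns ! b \<longrightarrow> W a b = 0"
    and WW: "\<forall>a<k. \<forall>b<k. (\<Sum>c<k. W a c * cnj (W b c)) = (if a = b then 1 else 0)"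
    and WD: "\<forall>a<k. \<forall>b<k. a \<noteq> b \<longrightarrow> ns ! a = ns ! b \<longrightarrow> (\<Sum>c<k. \<Sum>d<k. W a c * D c d * cnj (W b d)) = 0"
    by (elim exE conjE)
  have "\<exists>U\<in>SU ?n. (\<forall>j. U * Y j = Y j * U) \<and> (\<forall>M\<in>carrier_mat ?n ?n.
      \<forall>a<length ns. \<forall>b<length ns. \<forall>r<ns ! a. \<forall>s<ns ! b.
      mat_block ns (gauge_transform P (gauge_transform U M)) a b $$ (r, s) =
      (\<Sum>c<length ns. \<Sum>d<length ns. W a c * mat_block ns (gauge_transform P M) c d $$ (r, s) * cnj (W b d)))"
    by (rule scalar_block_gauge_ex[where \<rho> = \<rho>])
      (simp_all only: \<rho> P Y PY W0[rule_format] WW[unfolded k_def, rule_format] simp_thms)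
  then obtain U where U: "U \<in> SU ?n" "\<forall>j. U * Y j = Y j * U"
    and UW: "\<forall>M\<in>carrier_mat ?n ?n.
      \<forall>a<length ns. \<forall>b<length ns. \<forall>r<ns ! a. \<forall>s<ns ! b.
      mat_block ns (gauge_transform P (gauge_transform U M)) a b $$ (r, s) =
      (\<Sum>c<length ns. \<Sum>d<length ns. W a c * mat_block ns (gauge_transform P M) c d $$ (r, s) * cnj (W b d))"
    by (elim bexE conjE)
  \<comment> \<open>If all blocks between summands of the dimensions of a and b are multiples of one
    matrix N, so are they after the gauge. It is applied with N the representation, the zero matrix
    and B.\<close>
  have blkU: "blk (gauge_transform U (T i t0)) a b = (\<Sum>c<k. \<Sum>d<k. W a c * E c d * cnj (W b d)) \<cdot>\<^sub>m N"
    if ab: "a < k" "b < k" and N: "N \<in> carrier_mat (ns ! a) (ns ! b)"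
      and E: "\<And>c d. c < k \<Longrightarrow> d < k \<Longrightarrow> ns ! c = ns ! a \<Longrightarrow> ns ! d = ns ! b \<Longrightarrow> mat_block ns (?M i) c d = E c d \<cdot>\<^sub>m N"
    for a b i N E
  proof (rule eq_matI)
    fix r s assume "r < dim_row ((\<Sum>c<k. \<Sum>d<k. W a c * E c d * cnj (W b d)) \<cdot>\<^sub>m N)"
      "s < dim_col ((\<Sum>c<k. \<Sum>d<k. W a c * E c d * cnj (W b d)) \<cdot>\<^sub>m N)"
    hence rs: "r < ns ! a" "s < ns ! b" "r < dim_row N" "s < dim_col N" using N by auto
    have "blk (gauge_transform U (T i t0)) a b $$ (r, s) =
        (\<Sum>c<k. \<Sum>d<k. W a c * mat_block ns (?M i) c d $$ (r, s) * cnj (W b d))"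
      unfolding blk_def k_def by (rule UW[rule_format, OF T(1) ab[unfolded k_def] rs(1,2)])
    also have "\<dots> = (\<Sum>c<k. \<Sum>d<k. W a c * E c d * cnj (W b d) * N $$ (r, s))"
    proof (intro sum.cong refl)
      fix c d assume "c \<in> {..<k}" "d \<in> {..<k}"
      thus "W a c * mat_block ns (?M i) c d $$ (r, s) * cnj (W b d) = W a c * E c d * cnj (W b d) * N $$ (r, s)"
        using W0[rule_format, of a c] W0[rule_format, of b d] E[of c d] rs(3,4)
        by (cases "ns ! c = ns ! a"; cases "ns ! d = ns ! b") (auto simp del: index_mat_block)
    qed
    also have "\<dots> = ((\<Sum>c<k. \<Sum>d<k. W a c * E c d * cnj (W b d)) \<cdot>\<^sub>m N) $$ (r, s)"
      using rs(3,4) by (simp add: sum_distrib_right)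
    finally show "blk (gauge_transform U (T i t0)) a b $$ (r, s) = ((\<Sum>c<k. \<Sum>d<k. W a c * E c d * cnj (W b d)) \<cdot>\<^sub>m N) $$ (r, s)" .
  qed (use N in \<open>simp_all add: blk_def\<close>)
  have same: "blk (gauge_transform U (T i t0)) a b = (\<Sum>c<k. \<Sum>d<k. W a c * D c d * cnj (W b d)) \<cdot>\<^sub>m \<rho> (ns ! a) i"
    if ab: "a < k" "b < k" "ns ! a = ns ! b" for a b i
  proof (rule blkU[OF ab(1,2)])
    show "\<rho> (ns ! a) i \<in> carrier_mat (ns ! a) (ns ! b)"
      using so3_irrep.carrier[OF irr'[OF ab(1)], of i] ab(3) by simp
    show "mat_block ns (?M i) c d = D c d \<cdot>\<^sub>m \<rho> (ns ! a) i" if "c < k" "d < k" "ns ! c = ns ! a" "ns ! d = ns ! b" for c d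
      using D[rule_format, of c d i] that ab(3) by (simp add: k_def)
  qed
  have anti: "blk (T i t0) a b = - mat_adjoint (blk (T i t0) b a)" if "a < k" "b < k" for i a b
    unfolding blk_def by (rule mat_block_antihermitian[OF Mc Ma]) (use that in \<open>simp_all add: k_def\<close>)
  have diag: "blk (T i t0) a a \<in> su (ns ! a)" if a: "a < k" for i a
  proof -
    interpret so3_irrep "ns ! a" "\<rho> (ns ! a)" by (rule irr'[OF a])
    \<comment> \<open>A diagonal block of a traceless matrix need not be traceless; here it is,
      being a multiple of a traceless matrix of the representation.\<close>
    have "mat_trace (blk (T i t0) a a) = D a a * mat_trace (\<rho> (ns ! a) i)"
      using D[rule_format, of a a i] a mat_trace_smult[OF carrier, of "D a a" i] by (simp add: blk_def k_def)
    also have "\<dots> = 0" using in_su[of i] by (simp add: su_def)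
    finally have tr: "mat_trace (blk (T i t0) a a) = 0" .
    have "mat_adjoint (blk (T i t0) a a) = - (- mat_adjoint (blk (T i t0) a a))" by (rule eq_matI) auto
    also have "- mat_adjoint (blk (T i t0) a a) = blk (T i t0) a a" by (rule anti[OF a a, symmetric])
    finally show ?thesis using tr by (simp add: su_def blk_def)
  qed
  have part1: "\<exists>c::real. \<forall>i. blk (gauge_transform U (T i t0)) a a = complex_of_real c \<cdot>\<^sub>m \<rho> (ns ! a) i" if a: "a < k" for a
  proof -
    let ?c = "\<Sum>c<k. \<Sum>d<k. W a c * D c d * cnj (W a d)"
    \<comment> \<open>A diagonal entry of a unitary conjugate of the hermitian matrix D is
      real.\<close>
    have "cnj ?c = (\<Sum>c<k. \<Sum>d<k. cnj (W a c) * D d c * W a d)"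
      unfolding cnj_sum complex_cnj_mult complex_cnj_cnj Dh[rule_format, symmetric] ..
    also have "\<dots> = (\<Sum>d<k. \<Sum>c<k. cnj (W a c) * D d c * W a d)" by (rule sum.swap)
    also have "\<dots> = ?c" by (simp add: mult_ac)
    finally have "?c \<in> \<real>" by (simp only: Reals_cnj_iff)
    then obtain c :: real where "?c = complex_of_real c" by (elim Reals_cases)
    thus ?thesis using same[OF a a refl] by auto
  qed
  have part2: "blk (gauge_transform U (T i t0)) a b = 0\<^sub>m (ns ! a) (ns ! b)"
    if ab: "a < k" "b < k" "a \<noteq> b" "\<bar>int (ns ! a) - int (ns ! b)\<bar> \<noteq> 2" for a b i
  proof (cases "ns ! a = ns ! b")
    case True
    \<comment> \<open>W was chosen to make exactly this coefficient vanish.\<close>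
    show ?thesis unfolding same[OF ab(1,2) True] WD[rule_format, OF ab(1-3) True]
      using so3_irrep.carrier[OF irr'[OF ab(1)], of i] True by (intro eq_matI) auto
  next
    case False
    \<comment> \<open>All blocks mixed into this one have the same pair of dimensions and vanish by
      the weight argument.\<close>
    have "blk (gauge_transform U (T i t0)) a b = (\<Sum>c<k. \<Sum>d<k. W a c * 0 * cnj (W b d)) \<cdot>\<^sub>m 0\<^sub>m (ns ! a) (ns ! b)"
    proof (rule blkU[OF ab(1,2)])
      fix c d assume cd: "c < k" "d < k" "ns ! c = ns ! a" "ns ! d = ns ! b"
      have "equivariant_triple (ns ! d) (\<rho> (ns ! d)) (ns ! c) (\<rho> (ns ! c)) (\<lambda>i. mat_block ns (?M i) c d)"
        by (intro equivariant_triple.intro equivariant_triple_axioms.intro irr' eqv cd)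
      hence "mat_block ns (?M i) c d = 0\<^sub>m (ns ! c) (ns ! d)"
        by (rule equivariant_triple.triple_zero) (use False ab(4) cd in auto)
      thus "mat_block ns (?M i) c d = 0 \<cdot>\<^sub>m 0\<^sub>m (ns ! a) (ns ! b)" using cd by auto
    qed simp
    thus ?thesis by auto
  qed
  have part3: "\<exists>c::complex. \<forall>i. blk (gauge_transform U (T i t0)) a b = c \<cdot>\<^sub>m B (ns ! b) i"
    if ab: "a < k" "b < k" "ns ! a = ns ! b + 2" for a b
  proof -
    let ?m = "ns ! b"
    have m: "?m \<ge> 1" by (rule ns[OF nth_mem[OF ab(2)[unfolded k_def]]])
    have irrm: "so3_irrep ?m (\<rho> ?m)" "so3_irrep (?m + 2) (\<rho> (?m + 2))" using irr m by auto
    have unit: "unit_generator \<rho> ?m (B ?m)" using B m by blast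
    note Beq = unit_generator_equivariant[OF irrm unit]
    obtain i0 where i0: "B ?m i0 \<noteq> 0\<^sub>m (?m + 2) ?m" using Beq(2) by blast
    \<comment> \<open>Each block with these dimensions is a multiple of the same B, so the gauge
      only changes the coefficient.\<close>
    have "\<forall>c d. \<exists>e. c < k \<and> d < k \<and> ns ! c = ns ! a \<and> ns ! d = ns ! b \<longrightarrow>
        (\<forall>i. mat_block ns (?M i) c d = e \<cdot>\<^sub>m B ?m i)"
    proof (intro allI)
      fix c d
      show "\<exists>e. c < k \<and> d < k \<and> ns ! c = ns ! a \<and> ns ! d = ns ! b \<longrightarrow>
        (\<forall>i. mat_block ns (?M i) c d = e \<cdot>\<^sub>m B ?m i)"
      proof (cases "c < k \<and> d < k \<and> ns ! c = ns ! a \<and> ns ! d = ns ! b")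
        case True
        hence "equivariant (?m + 2) ?m (\<rho> (?m + 2)) (\<rho> ?m) (\<lambda>i. mat_block ns (?M i) c d)"
          using eqv[of c d] by (simp only: ab(3))
        from equivariant_proportional[OF irrm this Beq(1) i0] show ?thesis by blast
      qed blast
    qed
    then obtain E where E: "\<And>c d i. c < k \<Longrightarrow> d < k \<Longrightarrow> ns ! c = ns ! a \<Longrightarrow> ns ! d = ns ! b \<Longrightarrow>
        mat_block ns (?M i) c d = E c d \<cdot>\<^sub>m B ?m i" by metis
    have "B ?m i \<in> carrier_mat (ns ! a) ?m" for i using unit by (simp add: unit_generator_def ab(3))
    hence "blk (gauge_transform U (T i t0)) a b = (\<Sum>c<k. \<Sum>d<k. W a c * E c d * cnj (W b d)) \<cdot>\<^sub>m B ?m i" for i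
      by (rule blkU[OF ab(1,2)]) (rule E)
    thus ?thesis by blast
  qed
  show ?thesis
    unfolding n
    by (intro conjI bexI[OF _ U(1)] allI impI) (auto intro: anti diag U(2)[rule_format] part1 part2 part3)
qed

end
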